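(* For all $c,t\in\mathbb{C}$ the set $\mathcal{B}^t_{\mathcal{V}_c(\mathfrak{sl}_2)}=\{b\cdot\mathbf{1}\,:\,b\in B^t_{\mathcal{V}_c(\mathfrak{sl}_2)}\}$ forms a topological basis for the principal subspace $W_{\mathcal{V}_c(\mathfrak{sl}_2)}$.
   Context: Let $h$ be a formal parameter and let $R(u)=1-hPu^{-1}$ be the Yang $R$-matrix, where $P$ is the permutation operator on $\mathbb{C}^2\otimes\mathbb{C}^2$. Dual Yangian: ${\rm Y}^+(\mathfrak{sl}_2)$ is the associative unital $\mathbb{C}[[h]]$-algebra with generators $t_{ij}^{(-r)}$, $i,j=1,2$, $r=1,2,\ldots$, and defining relations $R(u-v)T_1^+(u)T_2^+(v)=T_2^+(v)T_1^+(u)R(u-v)$ and $\mathrm{qdet}\,T^+(u)=1$, where $T^+(u)=\sum_{i,j}e_{ij}\otimes t^+_{ij}(u)$, $t_{ij}^+(u)=\delta_{ij}-h\sum_{r\ge1}t_{ij}^{(-r)}u^{r-1}$, and $\mathrm{qdet}\,T^+(u)=t^+_{11}(u)t^+_{22}(u-h)-t^+_{21}(u)t^+_{12}(u-h)$. (The relations are read as relations among the $t_{ij}^{(-r)}$ with common powers of $h$ cancelled, and $h$-adic completion is understood where needed.) The unit is denoted $\mathbf{1}$. For $c\in\mathbb{C}$, $\mathcal{V}_c(\mathfrak{sl}_2)$ denotes the $h$-adic completion of ${\rm Y}^+(\mathfrak{sl}_2)$. Principal subspace: put $x(-r)=t_{12}^{(-r)}$ and $x^+(u)=\sum_{r\ge1}x(-r)u^{r-1}$.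 The $x(-r)$ commute with each other. $W_{\mathcal{V}_c(\mathfrak{sl}_2)}$ is the $h$-adic completion of the unital subalgebra generated by all $x(-r)$, $r\ge1$. By the Poincaré–Birkhoff–Witt theorem for the dual Yangian, the ordered monomials $x(r_m)\cdots x(r_1)\mathbf{1}$ with $r_m\le\dots\le r_1\le-1$, $m\ge0$, form a topological basis of it. Topological basis: a subset $\mathcal B$ of an $h$-adically complete $\mathbb{C}[[h]]$-module $M$ is a topological basis if it is linearly independent over $\mathbb{C}[[h]]$ and for every $v\in M$, $n\ge1$ there is $w$ in the $\mathbb{C}[[h]]$-span of $\mathcal B$ with $v=w$ mod $h^n$. Quasi-particles: for an integer $m>0$ and $t\in\mathbb{C}$ define $x^t_{(m)}(-r)\in W_{\mathcal{V}_c(\mathfrak{sl}_2)}$, $r\ge m$, by $$\sum_{r\ge m}x^t_{(m)}(-r)u^{r-m}=x^+(u)\,x^+(u+th)\cdots x^+(u+(m-1)th).$$ $B^t_{\mathcal{V}_c(\mathfrak{sl}_2)}$ is the set of all monomials $x^t_{(m_r)}(n_r)\cdots x^t_{(m_1)}(n_1)$ with $r\ge0$, integers $m_1\ge\dots\ge m_r\ge1$ and $n_1,\ldots,n_r\le-1$ such that $n_{s+1}\le n_s-2m_s$ whenever $m_{s+1}=m_s$ ($1\le s\le r-1$), and $n_s\le -m_s-2(s-1)m_s$ for $1\le s\le r$. *)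

theory Defs
  imports "HOL-Analysis.Analysis" "HOL-Library.Poly_Mapping"
    "HOL-Computational_Algebra.Formal_Power_Series"
begin

section \<open>The completed free algebra\<close>

text \<open>
  \<open>Gen i j k\<close> stands for the generator $t_{ij}^{(-k-1)}$, so that the index set
  is exactly $r = k + 1 \ge 1$. Type \<open>2\<close> has the two elements \<open>1\<close> and \<open>2\<close>.
\<close>

datatype gen = Gen 2 2 nat

datatype gword = GWord (letters: "gen list")

instantiation gword :: monoid_add
begin

definition zero_gword :: gword where
  "0 = GWord []"

definition plus_gword :: "gword \<Rightarrow> gword \<Rightarrow> gword" where
  "v + w = GWord (letters v @ letters w)"

instance
  by standard (auto simp: zero_gword_def plus_gword_def)

end

text \<open>
  \<open>gword \<Rightarrow>\<^sub>0 complex\<close> is the monoid algebra of the free monoid, i.e. the free unital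
  associative algebra on the $t_{ij}^{(-r)}$ over the complex numbers. Formal power series over
  it, in the variable $h =$ \<^const>\<open>fps_X\<close>, form the $h$-adic completion of the free
  $\mathbb{C}[[h]]$-algebra on these generators. The completion is needed already to write down
  $t^+_{ij}(u-h)$, whose coefficients are infinite $h$-adically convergent sums.
\<close>

type_synonym falg = "(gword \<Rightarrow>\<^sub>0 complex) fps"

definition falg_of_series :: "complex fps \<Rightarrow> falg" where
  "falg_of_series f = Abs_fps (\<lambda>n. Poly_Mapping.single 0 (fps_nth f n))"

definition tgen :: "2 \<Rightarrow> 2 \<Rightarrow> nat \<Rightarrow> falg" where
  "tgen i j r = fps_const (Poly_Mapping.single (GWord [Gen i j (r - 1)]) 1)"

definition gen_series :: "2 \<Rightarrow> 2 \<Rightarrow> falg fps" where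
  "gen_series i j = Abs_fps (\<lambda>k. tgen i j (k + 1))"

definition tplus :: "2 \<Rightarrow> 2 \<Rightarrow> falg fps" where
  "tplus i j = of_bool (i = j) - fps_const fps_X * gen_series i j"

text \<open>
  \<open>shift_series a f\<close> is $f(u + a h)$. Its coefficients are infinite sums, which converge in the
  $h$-adic metric that the library puts on formal power series.
\<close>

definition shift_series :: "complex \<Rightarrow> falg fps \<Rightarrow> falg fps" where
  "shift_series a f = Abs_fps (\<lambda>k. suminf (\<lambda>n.
     of_nat ((n + k) choose k) * falg_of_series (fps_const a * fps_X) ^ n * fps_nth f (n + k)))"


section \<open>The defining relations\<close>

text \<open>
  Elements of type \<^typ>\<open>falg fps fps\<close> are series in two variables: $u$ is the variable of the
  inner, $v$ that of the outer series. Operators on $\mathbb{C}^2 \otimes \mathbb{C}^2$ are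
  matrices indexed by pairs, with entry \<open>(i, k), (j, l)\<close> the coefficient of
  $e_{ij} \otimes e_{kl}$.
\<close>

type_synonym rtt_matrix = "falg fps fps ^ (2 \<times> 2) ^ (2 \<times> 2)"

definition in_u :: "falg fps \<Rightarrow> falg fps fps" where
  "in_u f = fps_const f"

definition in_v :: "falg fps \<Rightarrow> falg fps fps" where
  "in_v f = Abs_fps (\<lambda>s. fps_const (fps_nth f s))"

definition hh :: "falg fps fps" where
  "hh = fps_const (fps_const fps_X)"

definition perm_matrix :: rtt_matrix where
  "perm_matrix = (\<chi> a b. of_bool (fst a = snd b \<and> snd a = fst b))"

text \<open>$(u - v) R(u - v) = (u - v) - h P$; clearing the denominator does not change the relation.\<close>

definition R_matrix :: rtt_matrix where
  "R_matrix = (\<chi> a b. (in_u fps_X - in_v fps_X) * of_bool (a = b) - hh * perm_matrix $ a $ b)"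

definition T1 :: rtt_matrix where
  "T1 = (\<chi> a b. in_u (tplus (fst a) (fst b)) * of_bool (snd a = snd b))"

definition T2 :: rtt_matrix where
  "T2 = (\<chi> a b. in_v (tplus (snd a) (snd b)) * of_bool (fst a = fst b))"

definition rtt :: rtt_matrix where
  "rtt = R_matrix ** T1 ** T2 - T2 ** T1 ** R_matrix"

definition qdet :: "falg fps" where
  "qdet = tplus 1 1 * shift_series (-1) (tplus 2 2) - tplus 2 1 * shift_series (-1) (tplus 1 2)"

text \<open>
  In terms of the $t_{ij}^{(-r)}$ the coefficients of the $RTT$ relation are divisible by $h^2$ and
  those of $\mathrm{qdet}\, T^+(u) - 1$ by $h$ (see \<open>rtt_divisible\<close> and
  \<open>qdet_divisible\<close> below); the relators are the quotients. They are unique, because \<^typ>\<open>falg\<close>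
  is $h$-torsion free.
\<close>

definition relators :: "falg set" where
  "relators =
     {\<rho>. \<exists>a b r s. fps_X ^ 2 * \<rho> = fps_nth (fps_nth (rtt $ a $ b) s) r} \<union>
     {\<rho>. \<exists>r. fps_X * \<rho> = fps_nth (qdet - 1) r}"

inductive_set relation_ideal :: "falg set" where
  zero: "0 \<in> relation_ideal"
| add: "x \<in> relation_ideal \<Longrightarrow> y \<in> relation_ideal \<Longrightarrow> x + y \<in> relation_ideal"
| relator: "\<rho> \<in> relators \<Longrightarrow> a * \<rho> * b \<in> relation_ideal"

definition hadic_closure :: "'a::{ring,monoid_mult} \<Rightarrow> 'a set \<Rightarrow> 'a set" where
  "hadic_closure h S = {x. \<forall>n. \<exists>y\<in>S. \<exists>z. x - y = h ^ n * z}"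


section \<open>Auxiliary facts\<close>

lemma falg_of_series_add: "falg_of_series (f + g) = falg_of_series f + falg_of_series g"
  by (rule fps_ext) (simp add: falg_of_series_def single_add)

lemma single_zero_sum:
  "Poly_Mapping.single (0::gword) (sum f A :: complex) = (\<Sum>i\<in>A. Poly_Mapping.single 0 (f i))"
  by (induction A rule: infinite_finite_induct) (simp_all add: single_add)

lemma falg_of_series_mult: "falg_of_series (f * g) = falg_of_series f * falg_of_series g"
  by (rule fps_ext) (simp add: falg_of_series_def fps_mult_nth single_zero_sum mult_single)

lemma falg_of_series_1: "falg_of_series 1 = 1"
  by (rule fps_ext) (simp add: falg_of_series_def)

lemma falg_of_series_X: "falg_of_series fps_X = fps_X"
  by (rule fps_ext) (simp add: falg_of_series_def)

lemma update_eq_add_single: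
  fixes x :: "gword \<Rightarrow>\<^sub>0 complex"
  assumes "a \<notin> Poly_Mapping.keys x"
  shows "Poly_Mapping.update a b x = x + Poly_Mapping.single a b"
  using assms
  by (intro poly_mapping_eqI)
    (auto simp: lookup_update lookup_add lookup_single when_def in_keys_iff)

lemma single_zero_commute:
  fixes x :: "gword \<Rightarrow>\<^sub>0 complex"
  shows "Poly_Mapping.single 0 c * x = x * Poly_Mapping.single 0 c"
proof (induction x rule: update_induct)
  case const
  show ?case by simp
next
  case (update x a b)
  then show ?case
    by (simp only: update_eq_add_single[OF update(1)] distrib_left distrib_right mult_single
        add_0_left add_0_right mult.commute[of c b])
qed

lemma falg_of_series_commute: "falg_of_series f * x = x * falg_of_series f"
proof (rule fps_ext)
  fix n
  have "fps_nth (falg_of_series f * x) n = (\<Sum>i=0..n. fps_nth x (n - i) * fps_nth (falg_of_series f) i)"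
    by (simp add: fps_mult_nth falg_of_series_def single_zero_commute)
  also have "\<dots> = (\<Sum>i=0..n. fps_nth x i * fps_nth (falg_of_series f) (n - i))"
    by (rule sum.reindex_bij_witness[of _ "\<lambda>i. n - i" "\<lambda>i. n - i"]) auto
  finally show "fps_nth (falg_of_series f * x) n = fps_nth (x * falg_of_series f) n"
    by (simp add: fps_mult_nth)
qed

lemma fps_X_commute: "(fps_X :: falg) * x = x * fps_X"
  using falg_of_series_commute[of fps_X x] by (simp add: falg_of_series_X)

lemma fps_X_power_commute: "(fps_X :: falg) ^ n * x = x * fps_X ^ n"
  by (simp add: power_commuting_commutes fps_X_commute)

lemma relation_ideal_mult_left: "x \<in> relation_ideal \<Longrightarrow> a * x \<in> relation_ideal"
proof (induction rule: relation_ideal.induct)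
  case (relator \<rho> c b)
  then show ?case
    using relation_ideal.relator[of \<rho> "a * c" b] by (simp add: mult.assoc)
qed (auto simp: distrib_left intro: relation_ideal.intros)

lemma relation_ideal_mult_right: "x \<in> relation_ideal \<Longrightarrow> x * a \<in> relation_ideal"
proof (induction rule: relation_ideal.induct)
  case (relator \<rho> c b)
  then show ?case
    using relation_ideal.relator[of \<rho> c "b * a"] by (simp add: mult.assoc)
qed (auto simp: distrib_right intro: relation_ideal.intros)

abbreviation closed_ideal :: "falg set" where
  "closed_ideal \<equiv> hadic_closure fps_X relation_ideal"

lemma closed_ideal_base: "x \<in> relation_ideal \<Longrightarrow> x \<in> closed_ideal"
  unfolding hadic_closure_def
  by (intro CollectI allI bexI[of _ x] exI[of _ 0]) simp_all

lemma closed_ideal_add: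
  assumes "x \<in> closed_ideal" "y \<in> closed_ideal"
  shows "x + y \<in> closed_ideal"
  unfolding hadic_closure_def
proof (intro CollectI allI)
  fix n
  obtain a b where "a \<in> relation_ideal" "b \<in> relation_ideal"
      "\<exists>z. x - a = fps_X ^ n * z" "\<exists>z. y - b = fps_X ^ n * z"
    using assms unfolding hadic_closure_def by blast
  then show "\<exists>z\<in>relation_ideal. \<exists>w. x + y - z = fps_X ^ n * w"
    by (intro bexI[of _ "a + b"])
      (auto simp: add_diff_add simp flip: distrib_left intro: relation_ideal.add)
qed

lemma closed_ideal_mult_left:
  assumes "x \<in> closed_ideal"
  shows "a * x \<in> closed_ideal"
  unfolding hadic_closure_def
proof (intro CollectI allI)
  fix n
  obtain y k where y: "y \<in> relation_ideal" and "x - y = fps_X ^ n * k"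
    using assms unfolding hadic_closure_def by blast
  then have "a * x - a * y = fps_X ^ n * (a * k)"
    by (metis fps_X_power_commute mult.assoc right_diff_distrib)
  then show "\<exists>z\<in>relation_ideal. \<exists>w. a * x - z = fps_X ^ n * w"
    using y relation_ideal_mult_left by blast
qed

lemma closed_ideal_mult_right:
  assumes "x \<in> closed_ideal"
  shows "x * a \<in> closed_ideal"
  unfolding hadic_closure_def
proof (intro CollectI allI)
  fix n
  obtain y k where y: "y \<in> relation_ideal" and "x - y = fps_X ^ n * k"
    using assms unfolding hadic_closure_def by blast
  then have "x * a - y * a = fps_X ^ n * (k * a)"
    by (metis mult.assoc left_diff_distrib)
  then show "\<exists>z\<in>relation_ideal. \<exists>w. x * a - z = fps_X ^ n * w"
    using y relation_ideal_mult_right by blast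
qed

lemma closed_ideal_zero: "0 \<in> closed_ideal"
  by (intro closed_ideal_base relation_ideal.zero)

lemma closed_ideal_uminus: "x \<in> closed_ideal \<Longrightarrow> - x \<in> closed_ideal"
  using closed_ideal_mult_left[of x "- 1"] by simp

lemma closed_ideal_diff: "x \<in> closed_ideal \<Longrightarrow> y \<in> closed_ideal \<Longrightarrow> x - y \<in> closed_ideal"
  using closed_ideal_add[of x "- y"] closed_ideal_uminus[of y] by simp


lemma sum_UNIV_pair: "(\<Sum>p\<in>UNIV. f p) = (\<Sum>i\<in>UNIV. \<Sum>k\<in>UNIV. f (i, k))"
  for f :: "'i::finite \<times> 'k::finite \<Rightarrow> 'a::comm_monoid_add"
  using sum.cartesian_product[of "\<lambda>i k. f (i, k)" UNIV UNIV] by simp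

lemma rtt_matrix_entry:
  fixes w h :: "'a::ring_1" and t1 t2 :: "2 \<Rightarrow> 2 \<Rightarrow> 'a"
    and P R M N :: "'a ^ (2 \<times> 2) ^ (2 \<times> 2)"
  assumes "P = (\<chi> a b. of_bool (fst a = snd b \<and> snd a = fst b))"
    and "R = (\<chi> a b. w * of_bool (a = b) - h * P $ a $ b)"
    and "M = (\<chi> a b. t1 (fst a) (fst b) * of_bool (snd a = snd b))"
    and "N = (\<chi> a b. t2 (snd a) (snd b) * of_bool (fst a = fst b))"
  shows "(R ** M ** N - N ** M ** R) $ (i, k) $ (j, l) =
     (w * t1 i j * t2 k l - h * t1 k j * t2 i l)
     - (t2 k l * t1 i j * w - t2 k j * t1 i l * h)"
proof -
  have R: "R $ a $ b = (if a = b then w else 0) - (if b = prod.swap a then h else 0)" for a b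
    unfolding assms(1,2) vec_lambda_beta
    by (simp only: of_bool_def prod_eq_iff fst_swap snd_swap mult_1_right mult_zero_right
        if_distrib[of "(*) _"] eq_commute conj_commute cong: if_cong)
  have R': "R $ a $ b = (if a = b then w else 0) - (if a = prod.swap b then h else 0)" for a b
    unfolding assms(1,2) vec_lambda_beta
    by (simp only: of_bool_def prod_eq_iff fst_swap snd_swap mult_1_right mult_zero_right
        if_distrib[of "(*) _"] eq_commute conj_commute cong: if_cong)
  have 1: "(R ** L) $ a $ b = w * L $ a $ b - h * L $ prod.swap a $ b" for L :: "'a ^ (2 \<times> 2) ^ (2 \<times> 2)" and a b
    by (simp add: matrix_matrix_mult_def R left_diff_distrib sum_subtractf if_distrib[of "\<lambda>x. x * _"]
        cong: if_cong)
  have 2: "(L ** R) $ a $ b = L $ a $ b * w - L $ a $ prod.swap b * h" for L :: "'a ^ (2 \<times> 2) ^ (2 \<times> 2)" and a b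
    by (simp add: matrix_matrix_mult_def R' right_diff_distrib sum_subtractf if_distrib[of "\<lambda>x. _ * x"]
        cong: if_cong)
  have if_sum: "(\<Sum>y\<in>UNIV. if q then f y else 0) = (if q then \<Sum>y\<in>UNIV. f y else 0)"
    for q and f :: "2 \<Rightarrow> 'a"
    by simp
  have 3: "(M ** N) $ (i, k) $ (j, l) = t1 i j * t2 k l" for i j k l
    by (simp add: matrix_matrix_mult_def assms(3,4) sum_UNIV_pair of_bool_def if_sum
        if_distrib[of "\<lambda>x. _ * x"] if_distrib[of "\<lambda>x. x * _"] cong: if_cong)
  have 4: "(N ** M) $ (i, k) $ (j, l) = t2 k l * t1 i j" for i j k l
    by (simp add: matrix_matrix_mult_def assms(3,4) sum_UNIV_pair of_bool_def if_sum
        if_distrib[of "\<lambda>x. _ * x"] if_distrib[of "\<lambda>x. x * _"] cong: if_cong)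
  show ?thesis
    by (simp add: 1 2 3 4 mult.assoc flip: matrix_mul_assoc[of R])
qed

lemma rtt_entry:
  "rtt $ (i, k) $ (j, l) =
     ((in_u fps_X - in_v fps_X) * in_u (tplus i j) * in_v (tplus k l)
        - hh * in_u (tplus k j) * in_v (tplus i l))
     - (in_v (tplus k l) * in_u (tplus i j) * (in_u fps_X - in_v fps_X)
        - in_v (tplus k j) * in_u (tplus i l) * hh)"
  unfolding rtt_def by (rule rtt_matrix_entry[OF perm_matrix_def R_matrix_def T1_def T2_def])

lemma fps_const_commute_all:
  fixes c :: "'a::ring_1"
  assumes "\<And>x. c * x = x * c"
  shows "fps_const c * f = f * fps_const c"
  by (rule fps_ext) (simp add: assms)

lemma hh_commute: "hh * x = x * hh"
  unfolding hh_def by (intro fps_const_commute_all fps_X_commute)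

lemma rtt_identity:
  fixes h w :: "'a::ring_1"
  assumes h: "\<And>x. h * x = x * h" and w: "\<And>x. w * x = x * w"
  shows "(w * (of_bool p - h * A) * (of_bool q - h * B)
            - h * (of_bool r - h * C) * (of_bool s - h * D))
       - ((of_bool q - h * B) * (of_bool p - h * A) * w
            - (of_bool r - h * E) * (of_bool s - h * F) * h)
     = h ^ 2 * (w * (A * B - B * A)
        + of_bool s * (C - E) + of_bool r * (D - F) + h * (E * F - C * D))"
proof -
  have 1: "x * h = h * x" "x * (h * y) = h * (x * y)" if "x \<in> {A,B,C,D,E,F}" for x y
    by (simp_all only: mult.assoc[symmetric] h[of x])
  have 2: "x * w = w * x" "x * (w * y) = w * (x * y)" if "x \<in> {A,B,C,D,E,F}" for x y
    by (simp_all only: mult.assoc[symmetric] w[of x])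
  have 3: "h * w = w * h" "h * (w * y) = w * (h * y)" for y
    by (simp_all only: mult.assoc[symmetric] w[of h])
  have A: "A \<in> {A,B,C,D,E,F}" "B \<in> {A,B,C,D,E,F}" "C \<in> {A,B,C,D,E,F}" 
    "D \<in> {A,B,C,D,E,F}" "E \<in> {A,B,C,D,E,F}" "F \<in> {A,B,C,D,E,F}" by auto
  note r = 1[OF A(1)] 1[OF A(2)] 1[OF A(3)] 1[OF A(4)] 1[OF A(5)] 1[OF A(6)]
    2[OF A(1)] 2[OF A(2)] 2[OF A(3)] 2[OF A(4)] 2[OF A(5)] 2[OF A(6)] 3
  show ?thesis
    by (cases p; cases q; cases r; cases s)
      (simp_all add: power2_eq_square mult.assoc distrib_left distrib_right
        left_diff_distrib right_diff_distrib r)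
qed

lemma rtt_divisible: "\<exists>\<rho>. fps_X ^ 2 * \<rho> = fps_nth (fps_nth (rtt $ a $ b) s) r"
proof -
  obtain i k j l where ab: "a = (i, k)" "b = (j, l)"
    by (metis surj_pair)
  have u: "in_u fps_X * x = x * in_u fps_X" for x :: "falg fps fps"
    unfolding in_u_def by (intro fps_const_commute_all fps_mult_fps_X_commute)
  have "in_v fps_X = (fps_X :: falg fps fps)"
    by (intro fps_ext) (auto simp: in_v_def fps_X_def)
  then have v: "in_v fps_X * x = x * in_v fps_X" for x :: "falg fps fps"
    by (simp only: fps_mult_fps_X_commute[of x])
  have w: "(in_u fps_X - in_v fps_X) * x = x * (in_u fps_X - in_v fps_X)" for x :: "falg fps fps"
    by (simp add: left_diff_distrib right_diff_distrib u[of x] v[of x])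
  have tu: "in_u (tplus i j) = of_bool (i = j) - hh * in_u (gen_series i j)" for i j
    by (simp add: in_u_def tplus_def hh_def of_bool_def flip: fps_const_sub fps_const_mult)
  have tv: "in_v (tplus i j) = of_bool (i = j) - hh * in_v (gen_series i j)" for i j
    by (intro fps_ext) (auto simp: in_v_def tplus_def hh_def)
  obtain y where y: "rtt $ a $ b = hh ^ 2 * y"
    unfolding ab rtt_entry tu tv using rtt_identity[of hh, OF hh_commute w] by blast
  have "hh ^ 2 = fps_const (fps_const (fps_X ^ 2))"
    by (simp add: hh_def power2_eq_square)
  then have "fps_nth (fps_nth (rtt $ a $ b) s) r = fps_X ^ 2 * fps_nth (fps_nth y s) r"
    by (simp add: y)
  then show ?thesis by metis
qed

lemma falg_of_series_X_power:
  "falg_of_series (fps_const a * fps_X) ^ n = falg_of_series (fps_const (a ^ n)) * fps_X ^ n"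
proof (induction n)
  case (Suc n)
  have "falg_of_series (fps_const a * fps_X) ^ Suc n
      = falg_of_series (fps_const a) * (fps_X * falg_of_series (fps_const (a ^ n))) * fps_X ^ n"
    unfolding power_Suc Suc by (simp add: falg_of_series_mult falg_of_series_X mult.assoc)
  also have "\<dots> = falg_of_series (fps_const a) * falg_of_series (fps_const (a ^ n)) * (fps_X * fps_X ^ n)"
    by (simp only: fps_X_commute[of "falg_of_series (fps_const (a ^ n))"] mult.assoc)
  finally show ?case
    by (simp flip: falg_of_series_mult)
qed (simp add: falg_of_series_1)

lemma sums_shift_series:
  "(\<lambda>n. of_nat ((n + k) choose k) * falg_of_series (fps_const a * fps_X) ^ n * fps_nth f (n + k))
     sums fps_nth (shift_series a f) k" (is "?g sums _")
  and shift_series_nth: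
  "fps_nth (fps_nth (shift_series a f) k) N =
     (\<Sum>n\<le>N. Poly_Mapping.single 0 (of_nat ((n + k) choose k) * a ^ n)
               * fps_nth (fps_nth f (n + k)) (N - n))" (is "_ = ?s N")
proof -
  have c: "of_nat ((n + k) choose k) * falg_of_series (fps_const a * fps_X) ^ n
      = falg_of_series (fps_const (of_nat ((n + k) choose k) * a ^ n)) * fps_X ^ n" for n
  proof -
    have "of_nat m = falg_of_series (fps_const (of_nat m))" for m
      by (induction m) (simp_all add: falg_of_series_1 falg_of_series_add flip: fps_const_add, simp add: falg_of_series_def fps_eq_iff)
    note this[of "(n + k) choose k"]
    moreover have "fps_const (of_nat ((n + k) choose k) * a ^ n)
        = fps_const (of_nat ((n + k) choose k)) * fps_const (a ^ n)"
      by simp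
    ultimately show ?thesis
      unfolding falg_of_series_X_power by (simp only: falg_of_series_mult mult.assoc)
  qed
  have g: "fps_nth (?g n) N = (if n \<le> N then Poly_Mapping.single 0 (of_nat ((n + k) choose k) * a ^ n)
               * fps_nth (fps_nth f (n + k)) (N - n) else 0)" for n N
  proof -
    have e: "falg_of_series (fps_const c) = fps_const (Poly_Mapping.single 0 c)" for c
      by (rule fps_ext) (simp add: falg_of_series_def)
    show ?thesis
      unfolding c e mult.assoc by (simp add: fps_X_power_mult_nth)
  qed
  have *: "?g sums Abs_fps ?s"
    unfolding sums_def tendsto_fps_iff
  proof
    fix N
    have "fps_nth (\<Sum>n<M. ?g n) N = ?s N" if "M \<ge> Suc N" for M
      unfolding fps_sum_nth g using that
      by (intro sum.mono_neutral_cong_right) auto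
    then show "\<forall>\<^sub>F M in sequentially. fps_nth (\<Sum>n<M. ?g n) N = fps_nth (Abs_fps ?s) N"
      unfolding eventually_sequentially by auto
  qed
  then have "fps_nth (shift_series a f) k = Abs_fps ?s"
    by (simp add: shift_series_def sums_iff)
  then show "?g sums fps_nth (shift_series a f) k"
    "fps_nth (fps_nth (shift_series a f) k) N = ?s N"
    using * by simp_all
qed

lemma qdet_divisible: "\<exists>\<rho>. fps_X * \<rho> = fps_nth (qdet - 1) r"
proof -
  have z: "\<exists>\<rho>. x = fps_X * \<rho>" if "fps_nth x 0 = 0" for x :: falg
    using that by (intro exI[of _ "fps_shift 1 x"]) (auto simp: fps_eq_iff)
  have t: "fps_nth (fps_nth (tplus i j) n) 0 = (if n = 0 then of_bool (i = j) else 0)" for i j n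
    by (simp add: tplus_def of_bool_def)
  have s: "fps_nth (fps_nth (shift_series a (tplus i j)) n) 0 = (if n = 0 then of_bool (i = j) else 0)"
    for a i j n
    by (simp add: shift_series_nth t)
  have "fps_nth (fps_nth (qdet - 1) r) 0 = 0"
    by (cases r) (simp_all add: qdet_def fps_mult_nth fps_sum_nth s t of_bool_def sum.atLeast_Suc_atMost)
  then show ?thesis using z by metis
qed


section \<open>The completed dual Yangian\<close>

text \<open>
  The $h$-adic completion of the quotient by an ideal is the quotient by the $h$-adic
  closure of the ideal, as the algebra \<^typ>\<open>falg\<close> is itself $h$-adically complete.
\<close>

quotient_type dual_yangian = falg / "\<lambda>x y. x - y \<in> hadic_closure fps_X relation_ideal"
proof (rule equivpI)
  show "reflp (\<lambda>x y. x - y \<in> closed_ideal)"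
    by (simp add: reflp_def closed_ideal_zero)
  show "symp (\<lambda>x y. x - y \<in> closed_ideal)"
    unfolding symp_def using closed_ideal_uminus by fastforce
  show "transp (\<lambda>x y. x - y \<in> closed_ideal)"
    unfolding transp_def using closed_ideal_add by fastforce
qed

instantiation dual_yangian :: "{ring,monoid_mult}"
begin

lift_definition zero_dual_yangian :: dual_yangian is 0 .

lift_definition one_dual_yangian :: dual_yangian is 1 .

lift_definition plus_dual_yangian :: "dual_yangian \<Rightarrow> dual_yangian \<Rightarrow> dual_yangian" is "(+)"
  by (simp add: add_diff_add closed_ideal_add)

lift_definition uminus_dual_yangian :: "dual_yangian \<Rightarrow> dual_yangian" is uminus
  by (metis closed_ideal_uminus minus_diff_minus)

lift_definition minus_dual_yangian :: "dual_yangian \<Rightarrow> dual_yangian \<Rightarrow> dual_yangian" is "(-)"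
proof -
  fix x x' y y' :: falg
  assume "x - x' \<in> closed_ideal" "y - y' \<in> closed_ideal"
  then have "(x - x') - (y - y') \<in> closed_ideal"
    by (rule closed_ideal_diff)
  then show "(x - y) - (x' - y') \<in> closed_ideal"
    by (simp add: algebra_simps)
qed

lift_definition times_dual_yangian :: "dual_yangian \<Rightarrow> dual_yangian \<Rightarrow> dual_yangian" is "(*)"
proof -
  fix x x' y y' :: falg
  assume "x - x' \<in> closed_ideal" "y - y' \<in> closed_ideal"
  then have "(x - x') * y + x' * (y - y') \<in> closed_ideal"
    by (intro closed_ideal_add closed_ideal_mult_left closed_ideal_mult_right)
  then show "x * y - x' * y' \<in> closed_ideal"
    by (simp add: algebra_simps)
qed

instance
  by intro_classes (transfer; simp add: algebra_simps closed_ideal_zero)+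

end

definition yangian_of :: "falg \<Rightarrow> dual_yangian" where
  "yangian_of = abs_dual_yangian"

definition hscale :: "complex fps \<Rightarrow> dual_yangian \<Rightarrow> dual_yangian" where
  "hscale f x = yangian_of (falg_of_series f) * x"

lemma yangian_of_add: "yangian_of (x + y) = yangian_of x + yangian_of y"
  by (simp add: yangian_of_def plus_dual_yangian.abs_eq)

lemma yangian_of_diff: "yangian_of (x - y) = yangian_of x - yangian_of y"
  by (simp add: yangian_of_def minus_dual_yangian.abs_eq)

lemma yangian_of_mult: "yangian_of (x * y) = yangian_of x * yangian_of y"
  by (simp add: yangian_of_def times_dual_yangian.abs_eq)

lemma yangian_of_1: "yangian_of 1 = 1"
  by (simp add: yangian_of_def one_dual_yangian_def)

lemma yangian_of_eq_0_iff: "yangian_of x = 0 \<longleftrightarrow> x \<in> closed_ideal"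
  by (simp add: yangian_of_def zero_dual_yangian_def dual_yangian.abs_eq_iff)

lemma yangian_of_power: "yangian_of (x ^ n) = yangian_of x ^ n"
  by (induction n) (simp_all add: yangian_of_1 yangian_of_mult)

lemma yangian_of_surj: "\<exists>y. x = yangian_of y"
  unfolding yangian_of_def by (metis Quotient_dual_yangian Quotient_abs_rep)

global_interpretation hmod: module hscale
  defines hspan = hmod.span
    and hdependent = hmod.dependent
  by standard
    (simp_all add: hscale_def algebra_simps falg_of_series_add falg_of_series_mult
      falg_of_series_1 yangian_of_add yangian_of_mult yangian_of_1)

definition hbar :: dual_yangian where
  "hbar = yangian_of fps_X"

lemma yangian_separated:
  assumes "\<And>n. \<exists>z. x = hbar ^ n * z"
  shows "x = 0"
proof -
  obtain y where y: "x = yangian_of y"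
    using yangian_of_surj by blast
  have "\<exists>a\<in>relation_ideal. \<exists>w. y - a = fps_X ^ n * w" for n
  proof -
    obtain z where "x = hbar ^ n * yangian_of z"
      using assms[of n] yangian_of_surj by metis
    then have "y - fps_X ^ n * z \<in> closed_ideal"
      by (simp add: y hbar_def yangian_of_diff yangian_of_mult yangian_of_power
        flip: yangian_of_eq_0_iff)
    then obtain a w where "a \<in> relation_ideal" "y - fps_X ^ n * z - a = fps_X ^ n * w"
      unfolding hadic_closure_def by blast
    then show ?thesis
      by (intro bexI[of _ a] exI[of _ "z + w"]) (auto simp: algebra_simps)
  qed
  then show ?thesis
    by (auto simp: y yangian_of_eq_0_iff hadic_closure_def)
qed

lemma yangian_complete:
  assumes "\<And>n. \<exists>z. a (Suc n) - a n = hbar ^ n * z"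
  shows "\<exists>l. \<forall>n. \<exists>z. l - a n = hbar ^ n * z"
proof -
  obtain Z where Z: "\<And>n. a (Suc n) - a n = hbar ^ n * yangian_of (Z n)"
  proof -
    have "\<exists>Z. a (Suc n) - a n = hbar ^ n * yangian_of Z" for n
      using assms[of n] yangian_of_surj by metis
    then show ?thesis using that by metis
  qed
  obtain A where A: "a 0 = yangian_of A"
    using yangian_of_surj by blast
  define T :: "nat \<Rightarrow> falg" where
    "T n = Abs_fps (\<lambda>N. \<Sum>k\<le>N. fps_nth (Z (n + k)) (N - k))" for n
  have T: "T n = Z n + fps_X * T (Suc n)" for n
  proof (rule fps_ext)
    fix N
    show "fps_nth (T n) N = fps_nth (Z n + fps_X * T (Suc n)) N"
      by (cases N) (simp_all add: T_def sum.atMost_Suc_shift del: sum.atMost_Suc)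
  qed
  have "yangian_of (A + T 0) - a n = hbar ^ n * yangian_of (T n)" for n
  proof (induction n)
    case 0
    show ?case by (simp add: A yangian_of_add)
  next
    case (Suc n)
    have "yangian_of (A + T 0) - a (Suc n) = (yangian_of (A + T 0) - a n) - (a (Suc n) - a n)"
      by simp
    also have "\<dots> = hbar ^ n * (yangian_of (T n) - yangian_of (Z n))"
      by (simp only: Suc Z right_diff_distrib)
    also have "yangian_of (T n) - yangian_of (Z n) = hbar * yangian_of (T (Suc n))"
      by (subst T) (simp add: yangian_of_add yangian_of_mult hbar_def)
    finally show ?case
      by (simp add: power_Suc2 mult.assoc del: power_Suc)
  qed
  then show ?thesis by blast
qed


section \<open>The principal subspace and quasi-particles\<close>

definition is_topological_basis :: "dual_yangian set \<Rightarrow> dual_yangian set \<Rightarrow> bool" where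
  "is_topological_basis M B \<longleftrightarrow>
     B \<subseteq> M \<and> \<not> hdependent B \<and>
     (\<forall>v\<in>M. \<forall>n\<ge>1. \<exists>w\<in>hspan B. \<exists>z\<in>M. v - w = hscale (fps_X ^ n) z)"

text \<open>
  The level \<open>c\<close> enters only the vertex algebra structure; the underlying
  $\mathbb{C}[[h]]$-module is the completed dual Yangian, with vacuum vector \<open>1\<close>.
\<close>

definition vacuum_module :: "complex \<Rightarrow> dual_yangian set" where
  "vacuum_module c = UNIV"

definition x_gen :: "nat \<Rightarrow> dual_yangian" where
  "x_gen r = yangian_of (tgen 1 2 r)"

inductive_set unital_subalgebra :: "dual_yangian set \<Rightarrow> dual_yangian set" for S where
  one: "1 \<in> unital_subalgebra S"
| base: "x \<in> S \<Longrightarrow> x \<in> unital_subalgebra S"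
| scale: "x \<in> unital_subalgebra S \<Longrightarrow> hscale f x \<in> unital_subalgebra S"
| add: "x \<in> unital_subalgebra S \<Longrightarrow> y \<in> unital_subalgebra S \<Longrightarrow> x + y \<in> unital_subalgebra S"
| mult: "x \<in> unital_subalgebra S \<Longrightarrow> y \<in> unital_subalgebra S \<Longrightarrow> x * y \<in> unital_subalgebra S"

text \<open>
  The completion of the subalgebra is realised as its closure inside the complete algebra
  \<^typ>\<open>dual_yangian\<close>. By the PBW theorem the subalgebra is spanned by part of a topological basis,
  so its own $h$-adic topology is the subspace topology.
\<close>

definition principal_subspace :: "complex \<Rightarrow> dual_yangian set" where
  "principal_subspace c =
     vacuum_module c \<inter> hadic_closure hbar (unital_subalgebra {x_gen r |r. r \<ge> 1})"

text \<open>
  The product $x^+(u) x^+(u + th) \cdots x^+(u + (m-1)th)$ is formed over the completed free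
  algebra, where the shifts are defined, and its coefficients are mapped to the dual Yangian
  by the $h$-adically continuous projection \<^const>\<open>yangian_of\<close>.
\<close>

definition quasi_series :: "complex \<Rightarrow> nat \<Rightarrow> falg fps" where
  "quasi_series t m =
     prod_list (map (\<lambda>k. shift_series (of_nat k * t) (gen_series 1 2)) [0..<m])"

text \<open>\<open>quasi_particle t m n\<close> is $x^t_{(m)}(n)$ for $n \le -m$; the value for other $n$ is a dummy.\<close>

definition quasi_particle :: "complex \<Rightarrow> nat \<Rightarrow> int \<Rightarrow> dual_yangian" where
  "quasi_particle t m n =
     (if n \<le> - int m then yangian_of (fps_nth (quasi_series t m) (nat (- n - int m))) else 0)"

definition quasi_monomials :: "complex \<Rightarrow> dual_yangian set" where
  "quasi_monomials t =
     {prod_list (map (\<lambda>s. quasi_particle t (m s) (n s)) (rev [1..<r + 1])) | r m n.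
        (\<forall>s\<in>{1..r}. m s \<ge> 1 \<and> n s \<le> -1) \<and>
        (\<forall>s\<in>{1..<r}. m (s + 1) \<le> m s) \<and>
        (\<forall>s\<in>{1..<r}. m (s + 1) = m s \<longrightarrow> n (s + 1) \<le> n s - 2 * int (m s)) \<and>
        (\<forall>s\<in>{1..r}. n s \<le> - int (m s) - 2 * (int s - 1) * int (m s))}"

definition quasi_basis :: "complex \<Rightarrow> complex \<Rightarrow> dual_yangian set" where
  "quasi_basis c t = {b * 1 | b. b \<in> quasi_monomials t}"

end

theory Submission
  imports Defs "HOL-Library.Multiset_Order"
begin

text \<open>
  The generators $x(-r)$ commute, and modulo $h$ the shifts by multiples of $th$ disappear, so that a
  quasi-particle of charge $m$ becomes a coefficient of the $m$-th power of
  $x(u) = \sum_k x_k u^k$, where $x_k$ stands for $x(-k-1)$. The theorem therefore follows from two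
  facts. The first concerns only the commutative polynomial ring in the $x_k$: the quasi-particle
  monomials that satisfy the difference conditions are a basis of it. The second is the part of the
  Poincare--Birkhoff--Witt theorem that concerns the $x(-r)$: a $\mathbb{C}[[h]]$-linear
  combination of monomials in the $x(-r)$ is divisible by $h^n$ in the dual Yangian only if all its
  coefficients are.

  The commutative statement is proved by duality. A linear functional $f$ on the
  polynomial ring is tested on the generating series of the products $x(u_1)^{m_1} \cdots x(u_r)^{m_r}$.
  If $f$ vanishes on all types that are larger than $m$ in the multiset order, then a Taylor expansion of $x(u_q)$
  at $u_p$ shows that its series is divisible by $(u_p - u_q)^{2 m_q}$ for $p < q$ (lemma
  \<open>quasi_product_divisible\<close>). The lexicographically lowest exponent of a nonzero series
  with all these divisibilities satisfies the difference conditions, so a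
  functional that kills all admissible monomials is zero (\<open>functional_zero_of_admissible\<close>).
  This is spanning. For independence, every admissible monomial gets a functional that kills all
  larger types and, within its own type, all lexicographically lower exponents, but not the monomial
  itself (\<open>exists_dual_functional\<close>). It is the constant term after differential
  operators $\det(\partial_{i + \lambda_j})$, one for each column of the Young diagram of the type.
  Such a determinant must hit different clusters with its derivatives and thereby
  removes one column.

  The second fact needs representations of the dual Yangian on which the $x(-r)$ act by independent
  operators. They come from products of evaluation matrices $1 - h b E / (1 - b u)$ with distinct
  $b$, where $E$ is the matrix of generators of $\mathfrak{gl}_2$ in a module with trace zero and
  vanishing Casimir element; then the quantum determinant is exactly $1$. With $N$ factors, a Vandermonde
  argument turns any functional on the polynomials in $N$ variables into the leading term of a
  $\mathbb{C}[[h]]$-linear functional on the dual Yangian (\<open>coefficient_functional_extends\<close>).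

  Finally, this saturation (\<open>lift_saturated\<close>) makes it possible to expand an element of the completed subalgebra step by step
  in powers of $h$ without leaving the subalgebra, and a linear relation between
  quasi-particle monomials can be divided by $h$ for ever, so that it is trivial.
\<close>

section \<open>Maps out of monoid algebras\<close>

abbreviation "single \<equiv> Poly_Mapping.single"
abbreviation "keys \<equiv> Poly_Mapping.keys"
abbreviation "lookup \<equiv> Poly_Mapping.lookup"

definition pm_sum :: "('m \<Rightarrow> 'k \<Rightarrow> 'r) \<Rightarrow> ('m \<Rightarrow>\<^sub>0 'k::zero) \<Rightarrow> 'r::comm_monoid_add" where
  "pm_sum g p = (\<Sum>w\<in>keys p. g w (lookup p w))"

lemma pm_sum_superset:
  assumes "\<And>w. g w 0 = 0" "finite A" "keys p \<subseteq> A"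
  shows "pm_sum g p = (\<Sum>w\<in>A. g w (lookup p w))"
  unfolding pm_sum_def using assms
  by (intro sum.mono_neutral_left) (auto simp: in_keys_iff)

lemma pm_sum_0 [simp]: "pm_sum g 0 = 0"
  by (simp add: pm_sum_def)

lemma pm_sum_single: "g w 0 = 0 \<Longrightarrow> pm_sum g (single w a) = g w a"
  by (simp add: pm_sum_def)

lemma pm_sum_add:
  assumes "\<And>w. g w 0 = 0" "\<And>w a b. g w (a + b) = g w a + g w b"
  shows "pm_sum g (p + q) = pm_sum g p + pm_sum g q"
proof -
  define A where "A = keys p \<union> keys q"
  have "finite A" "keys p \<subseteq> A" "keys q \<subseteq> A" "keys (p + q) \<subseteq> A"
    using Poly_Mapping.keys_add[of p q] by (auto simp: A_def)
  then show ?thesis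
    by (simp add: pm_sum_superset[where A = A] assms lookup_add sum.distrib)
qed

lemma single_sum_keys:
  "(\<Sum>w\<in>keys p. single w (lookup p w)) = p"
  by (rule poly_mapping_eqI)
    (auto simp: lookup_sum lookup_single when_def in_keys_iff sum.delta' if_distrib cong: if_cong)

lemma poly_mapping_induct [case_names zero single add]:
  fixes p :: "'m \<Rightarrow>\<^sub>0 'k::comm_monoid_add"
  assumes "P 0" "\<And>w a. P (single w a)"
    "\<And>p q. P p \<Longrightarrow> P q \<Longrightarrow> P (p + q)"
  shows "P p"
proof -
  have "P (\<Sum>w\<in>A. single w (lookup p w))" if "finite A" for A
    using that by induction (auto intro: assms)
  from this[of "keys p"] show ?thesis
    by (simp add: single_sum_keys)
qed

text \<open>
  The universal property of a monoid algebra over a commutative ring, with values in a possibly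
  noncommutative ring whose unit may be zero: the dual Yangian is not known in advance to be nontrivial.
\<close>

locale monoid_algebra_lift =
  fixes s :: "'k::comm_ring_1 \<Rightarrow> 'r::{ring,monoid_mult}" and mon :: "'m::monoid_add \<Rightarrow> 'r"
  assumes s_add: "s (a + b) = s a + s b" and s_mult: "s (a * b) = s a * s b" and s_1: "s 1 = 1"
    and s_central: "s a * x = x * s a"
    and mon_0: "mon 0 = 1" and mon_add: "mon (v + w) = mon v * mon w"
begin

definition lift :: "('m \<Rightarrow>\<^sub>0 'k) \<Rightarrow> 'r" where
  "lift = pm_sum (\<lambda>w a. s a * mon w)"

lemma s_0 [simp]: "s 0 = 0"
  using s_add[of 0 0] by simp

lemma lift_0 [simp]: "lift 0 = 0"
  by (simp add: lift_def)

lemma lift_single: "lift (single w a) = s a * mon w"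
  by (simp add: lift_def pm_sum_single)

lemma lift_add: "lift (p + q) = lift p + lift q"
  unfolding lift_def by (intro pm_sum_add) (simp_all add: s_add distrib_right)

lemma lift_uminus: "lift (- p) = - lift p"
  using lift_add[of p "- p"] by (simp add: eq_neg_iff_add_eq_0 add.commute)

lemma lift_diff: "lift (p - q) = lift p - lift q"
  using lift_add[of p "- q"] by (simp add: lift_uminus)

lemma lift_1 [simp]: "lift 1 = 1"
  using lift_single[of 0 1] by (simp add: s_1 mon_0)

lemma lift_sum: "lift (\<Sum>i\<in>A. f i) = (\<Sum>i\<in>A. lift (f i))"
  by (induction A rule: infinite_finite_induct) (simp_all add: lift_add)

lemma lift_mult: "lift (p * q) = lift p * lift q"
proof (induction p rule: poly_mapping_induct)
  case (single v a)
  show ?case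
  proof (induction q rule: poly_mapping_induct)
    case (single w b)
    have "lift (single v a * single w b) = s a * (s b * mon v) * mon w"
      by (simp add: mult_single lift_single s_mult mon_add mult.assoc)
    also have "s b * mon v = mon v * s b"
      by (rule s_central)
    also have "s a * (mon v * s b) * mon w = lift (single v a) * lift (single w b)"
      by (simp add: lift_single mult.assoc)
    finally show ?case .
  qed (simp_all add: lift_add distrib_left)
qed (simp_all add: lift_add distrib_right)

end

section \<open>Commutative quasi-particles\<close>

text \<open>
  A monomial in the $x_k$ is the multiset of its indices. The functional with coefficient
  function \<open>c\<close> takes the value \<open>c M\<close> on the monomial \<open>M\<close>; every linear functional is of this form.
\<close>

type_synonym poly_ring = "nat multiset \<Rightarrow>\<^sub>0 complex"

definition functional :: "(nat multiset \<Rightarrow> complex) \<Rightarrow> poly_ring \<Rightarrow> complex" where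
  "functional c = pm_sum (\<lambda>M a. a * c M)"

lemma functional_0 [simp]: "functional c 0 = 0"
  by (simp add: functional_def)

lemma functional_single [simp]: "functional c (single M a) = a * c M"
  by (simp add: functional_def pm_sum_single)

lemma functional_add: "functional c (p + q) = functional c p + functional c q"
  unfolding functional_def by (intro pm_sum_add) (simp_all add: distrib_right)

lemma functional_uminus: "functional c (- p) = - functional c p"
  using functional_add[of c p "- p"] by (simp add: eq_neg_iff_add_eq_0 add.commute)

lemma functional_diff: "functional c (p - q) = functional c p - functional c q"
  using functional_add[of c p "- q"] by (simp add: functional_uminus)

lemma functional_sum: "functional c (\<Sum>i\<in>A. f i) = (\<Sum>i\<in>A. functional c (f i))"
  by (induction A rule: infinite_finite_induct) (simp_all add: functional_add)

lemma functional_scale: "functional c (single 0 a * p) = a * functional c p"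
  by (induction p rule: poly_mapping_induct)
    (simp_all add: functional_add distrib_left mult_single)

lemma functional_of_nat: "functional c (of_nat n * p) = of_nat n * functional c p"
  by (induction n) (simp_all add: functional_add distrib_right)

definition var :: "nat \<Rightarrow> poly_ring" where
  "var k = single {#k#} 1"

definition var_series :: "poly_ring fps" where
  "var_series = Abs_fps var"

text \<open>
  The reduction modulo $h$ of $x^t_{(a)}(n)$ with $j = -n - a$. The exponent is an integer, with value
  \<open>0\<close> at negative ones, so that differences of exponents need no case distinction.
\<close>

definition qcoeff :: "nat \<Rightarrow> int \<Rightarrow> poly_ring" where
  "qcoeff a j = (if j < 0 then 0 else fps_nth (var_series ^ a) (nat j))"

definition qmono :: "nat \<Rightarrow> (nat \<Rightarrow> nat) \<Rightarrow> (nat \<Rightarrow> int) \<Rightarrow> poly_ring" where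
  "qmono r m j = (\<Prod>p<r. qcoeff (m p) (j p))"

text \<open>
  The conditions of the quasi-particle basis, with clusters numbered from \<open>0\<close> and the energy
  $n$ of a cluster of charge $m$ replaced by the exponent $j = -n - m$.
\<close>

definition admissible :: "nat \<Rightarrow> (nat \<Rightarrow> nat) \<Rightarrow> (nat \<Rightarrow> int) \<Rightarrow> bool" where
  "admissible r m j \<longleftrightarrow> (\<forall>p<r. m p \<ge> 1 \<and> j p \<ge> 2 * int p * int (m p)) \<and>
     (\<forall>p. Suc p < r \<longrightarrow> m (Suc p) \<le> m p \<and>
        (m (Suc p) = m p \<longrightarrow> j (Suc p) \<ge> j p + 2 * int (m p)))"

lemma keys_qcoeff: "M \<in> keys (fps_nth (var_series ^ a) n) \<Longrightarrow> size M = a"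
proof (induction a arbitrary: M n)
  case 0
  then show ?case by (auto simp: fps_one_nth split: if_splits)
next
  case (Suc a)
  have "keys (fps_nth (var_series ^ Suc a) n)
     \<subseteq> (\<Union>i\<in>{0..n}. keys (var i * fps_nth (var_series ^ a) (n - i)))"
    using keys_sum[of "\<lambda>i. var i * fps_nth (var_series ^ a) (n - i)" "{0..n}"]
    by (simp add: fps_mult_nth var_series_def)
  with Suc.prems obtain i where i: "M \<in> keys (var i * fps_nth (var_series ^ a) (n - i))"
    by blast
  then obtain A B where "M = A + B" "A \<in> keys (var i)"
     "B \<in> keys (fps_nth (var_series ^ a) (n - i))"
    using keys_mult by blast
  with Suc.IH[of B] show ?case
    by (auto simp: var_def split: if_splits)
qed

lemma keys_qmono: "M \<in> keys (qmono r m j) \<Longrightarrow> size M = (\<Sum>p<r. m p)"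
proof (induction r arbitrary: M)
  case 0
  then show ?case by (simp add: qmono_def)
next
  case (Suc r)
  have "qmono (Suc r) m j = qmono r m j * qcoeff (m r) (j r)"
    by (simp add: qmono_def)
  with Suc.prems obtain A B where "M = A + B" "A \<in> keys (qmono r m j)"
     "B \<in> keys (qcoeff (m r) (j r))"
    using keys_mult[of "qmono r m j" "qcoeff (m r) (j r)"] by force
  with Suc.IH[of A] show ?case
    using keys_qcoeff[of B "m r" "nat (j r)"] by (auto simp: qcoeff_def split: if_splits)
qed

lemma qcoeff_1: "qcoeff 1 (int k) = var k"
  by (simp add: qcoeff_def var_series_def)

section \<open>Two quasi-particles at nearby points\<close>

definition vdiff :: "'a::comm_ring_1 fps fps" where
  "vdiff = fps_X - fps_const fps_X"

lemma vdiff_nth: "fps_nth (fps_nth (vdiff * g) n) m =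
   (if n = 0 then 0 else fps_nth (fps_nth g (n - 1)) m) - (if m = 0 then 0 else fps_nth (fps_nth g n) (m - 1))"
  by (simp add: vdiff_def left_diff_distrib)

text \<open>
  In a series divisible by $(v - u)^c$, where $u$ is the inner and $v$ the outer variable, the
  quotient inherits lower bounds on the order in each variable, since $v - u$ has a nonzero constant
  term in $u$ and in $v$. The lowest coefficient in $u$ of the product is that of the quotient times $v^c$.
\<close>

lemma vdiff_order:
  fixes H :: "'a::comm_ring_1 fps fps"
  assumes "\<And>n m. n < A \<Longrightarrow> fps_nth (fps_nth (vdiff ^ c * H) n) m = 0"
    and "\<And>n m. m < D \<Longrightarrow> fps_nth (fps_nth (vdiff ^ c * H) n) m = 0"
    and "n < A + c"
  shows "fps_nth (fps_nth (vdiff ^ c * H) n) D = 0"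
  using assms
proof (induction c arbitrary: n)
  case (Suc c)
  define g where "g = vdiff ^ c * H"
  have e: "vdiff ^ Suc c * H = vdiff * g"
    by (simp add: g_def mult.assoc)
  have p1: "fps_nth (fps_nth (vdiff * g) n) m = 0" if "n < A" for n m
    using Suc.prems(1)[OF that] by (simp only: e)
  have p2: "fps_nth (fps_nth (vdiff * g) n) m = 0" if "m < D" for n m
    using Suc.prems(2)[OF that] by (simp only: e)
  have g1: "fps_nth (fps_nth g n) m = 0" if "n < A" for n m
    using that
  proof (induction n arbitrary: m)
    case 0
    then show ?case using p1[of 0 "Suc m", unfolded vdiff_nth] by simp
  next
    case (Suc n)
    then show ?case using p1[of "Suc n" "Suc m", unfolded vdiff_nth] by simp
  qed
  have g2: "fps_nth (fps_nth g n) m = 0" if "m < D" for n m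
    using that
  proof (induction m arbitrary: n)
    case 0
    then show ?case using p2[of 0 "Suc n", unfolded vdiff_nth] by simp
  next
    case (Suc m)
    then show ?case using p2[of "Suc m" "Suc n", unfolded vdiff_nth] by simp
  qed
  have "fps_nth (fps_nth g (n - 1)) D = 0" if "n > 0"
    using Suc.IH[of "n - 1"] g1 g2 Suc.prems(3) that unfolding g_def by simp
  then show ?case
    unfolding e vdiff_nth by (auto simp: g2)
qed (simp add: assms)

definition series_in_v :: "'a::comm_ring_1 fps \<Rightarrow> 'a fps fps" where
  "series_in_v f = Abs_fps (\<lambda>n. fps_const (fps_nth f n))"

lemma series_in_v_mult: "series_in_v (f * g) = series_in_v f * series_in_v g"
  by (intro fps_ext) (simp add: series_in_v_def fps_mult_nth fps_sum_nth)

lemma series_in_v_power: "series_in_v (f ^ n) = series_in_v f ^ n"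
proof (induction n)
  case 0
  show ?case by (intro fps_ext) (auto simp: series_in_v_def)
qed (simp add: series_in_v_mult)

text \<open>
  The remainder is an explicit series with coefficients $(l+1) f_{i+l+2}$, so no division is needed.
\<close>

lemma taylor_order_2:
  fixes f :: "'a::comm_ring_1 fps"
  shows "\<exists>Q. series_in_v f = fps_const f + vdiff * fps_const (fps_deriv f) + vdiff ^ 2 * Q"
proof -
  define D where "D = Abs_fps (\<lambda>i. Abs_fps (\<lambda>l. fps_nth f (i + l + 1)))"
  define Q where "Q = Abs_fps (\<lambda>i. Abs_fps (\<lambda>l. of_nat (l + 1) * fps_nth f (i + l + 2)))"
  have 1: "series_in_v f - fps_const f = vdiff * D"
  proof (rule fps_ext, rule fps_ext)
    fix n m
    show "fps_nth (fps_nth (series_in_v f - fps_const f) n) m = fps_nth (fps_nth (vdiff * D) n) m"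
      unfolding vdiff_nth by (cases n; cases m) (simp_all add: series_in_v_def D_def)
  qed
  have 2: "D - fps_const (fps_deriv f) = vdiff * Q"
  proof (rule fps_ext, rule fps_ext)
    fix n m
    show "fps_nth (fps_nth (D - fps_const (fps_deriv f)) n) m = fps_nth (fps_nth (vdiff * Q) n) m"
      unfolding vdiff_nth by (cases n; cases m) (simp_all add: Q_def D_def algebra_simps)
  qed
  have "series_in_v f = fps_const f + vdiff * D"
    using 1 by (simp add: algebra_simps)
  also have "D = fps_const (fps_deriv f) + vdiff * Q"
    using 2 by (simp add: algebra_simps)
  finally show ?thesis
    by (intro exI[of _ Q]) (simp add: algebra_simps power2_eq_square)
qed

definition coeffwise :: "('a::comm_ring_1 \<Rightarrow> 'b::comm_ring_1) \<Rightarrow> 'a fps fps \<Rightarrow> 'b fps fps" where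
  "coeffwise f g = Abs_fps (\<lambda>n. Abs_fps (\<lambda>m. f (fps_nth (fps_nth g n) m)))"

lemma coeffwise_nth [simp]: "fps_nth (fps_nth (coeffwise f g) n) m = f (fps_nth (fps_nth g n) m)"
  by (simp add: coeffwise_def)

lemma coeffwise_vdiff_power:
  assumes "\<And>x y. f (x - y) = f x - f y"
  shows "coeffwise f (vdiff ^ k * g) = vdiff ^ k * coeffwise f g"
proof -
  have f0: "f 0 = 0" using assms[of 0 0] by simp
  have 1: "coeffwise f (vdiff * g) = vdiff * coeffwise f g" for g
  proof (rule fps_ext, rule fps_ext)
    fix n m
    show "fps_nth (fps_nth (coeffwise f (vdiff * g)) n) m = fps_nth (fps_nth (vdiff * coeffwise f g) n) m"
      unfolding vdiff_nth coeffwise_nth by (simp add: assms f0)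
  qed
  show ?thesis
    by (induction k) (simp_all add: mult.assoc 1)
qed

text \<open>
  Expand $x(v) = x(u) + (v-u) x'(u) + (v-u)^2 Q$ in the last $b$ factors of
  $x(u)^a x(v)^b$. Every term that contains $x(u)$ once more, or $x(u)^a x'(u)$, which is a multiple of
  $(x(u)^{a+1})'$, is killed by the functional. Only $(v-u)^{2b} x(u)^a Q^b$ survives.
\<close>

lemma quasi_product_divisible:
  assumes kill: "\<And>n y. functional c (Z * (fps_nth (var_series ^ Suc a) n * y)) = 0"
  shows "\<exists>H. Abs_fps (\<lambda>n. Abs_fps (\<lambda>m. functional c
             (Z * (fps_nth (var_series ^ a) m * fps_nth (var_series ^ b) n)))) = vdiff ^ (2 * b) * H"
proof -
  define f where "f = (\<lambda>p. functional c (Z * p))"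
  have f_diff: "f (x - y) = f x - f y" for x y
    by (simp add: f_def right_diff_distrib functional_diff)
  have f_add: "f (x + y) = f x + f y" for x y
    by (simp add: f_def distrib_left functional_add)
  have f_sum: "f (\<Sum>i\<in>A. g i) = (\<Sum>i\<in>A. f (g i))" for A :: "nat set" and g
    by (simp add: f_def sum_distrib_left functional_sum)
  define U V D where "U = fps_const var_series" and "V = series_in_v var_series"
    and "D = fps_const (fps_deriv var_series)"
  obtain Q where Q: "V = U + vdiff * D + vdiff ^ 2 * Q"
    using taylor_order_2[of var_series] by (auto simp: U_def V_def D_def)
  obtain S where "V ^ b - (vdiff ^ 2 * Q) ^ b = (V - vdiff ^ 2 * Q) * S"
    using power_diff_sumr2[of V b "vdiff ^ 2 * Q"] by blast
  moreover have "(vdiff ^ 2 * Q) ^ b = vdiff ^ (2 * b) * Q ^ b"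
    by (simp add: power_mult_distrib flip: power_mult)
  ultimately have "V ^ b = vdiff ^ (2 * b) * Q ^ b + (U + vdiff * D) * S"
    using Q by (simp add: algebra_simps)
  then have e: "U ^ a * V ^ b = vdiff ^ (2 * b) * (U ^ a * Q ^ b) + U ^ Suc a * S + U ^ a * D * (vdiff * S)"
    by (simp add: algebra_simps)
  have k1: "f (fps_nth (fps_nth (U ^ Suc a * S) n) m) = 0" for n m
  proof -
    have "fps_nth (fps_nth (U ^ Suc a * S) n) m
        = (\<Sum>i=0..m. fps_nth (var_series ^ Suc a) i * fps_nth (fps_nth S n) (m - i))"
      by (simp only: U_def fps_const_power fps_mult_left_const_nth fps_mult_nth[of "var_series ^ Suc a"])
    then show ?thesis
      by (simp add: f_sum del: power_Suc) (simp add: f_def kill del: power_Suc)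
  qed
  have d: "of_nat (Suc a) * fps_nth (var_series ^ a * fps_deriv var_series) i
      = of_nat (Suc i) * fps_nth (var_series ^ Suc a) (Suc i)" for i
  proof -
    have "fps_const (of_nat (Suc a)) * (var_series ^ a * fps_deriv var_series) = fps_deriv (var_series ^ Suc a)"
      unfolding fps_deriv_power by (simp add: mult.assoc mult.left_commute mult.commute)
    then have "fps_nth (fps_const (of_nat (Suc a)) * (var_series ^ a * fps_deriv var_series)) i
        = fps_nth (fps_deriv (var_series ^ Suc a)) i" by (rule arg_cong)
    then show ?thesis by (simp del: power_Suc of_nat_Suc)
  qed
  \<comment> \<open>Characteristic zero is used here: $x^a x'$ is $1/(a+1)$ times a derivative.\<close>
  have k2: "f (fps_nth (var_series ^ a * fps_deriv var_series) i * y) = 0" for i y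
  proof -
    have "of_nat (Suc a) * f (fps_nth (var_series ^ a * fps_deriv var_series) i * y)
      = functional c (of_nat (Suc a) * (Z * (fps_nth (var_series ^ a * fps_deriv var_series) i * y)))"
      by (simp only: functional_of_nat f_def)
    also have "of_nat (Suc a) * (Z * (fps_nth (var_series ^ a * fps_deriv var_series) i * y))
       = Z * ((of_nat (Suc a) * fps_nth (var_series ^ a * fps_deriv var_series) i) * y)"
      by (simp only: mult_ac)
    also have "\<dots> = of_nat (Suc i) * (Z * (fps_nth (var_series ^ Suc a) (Suc i) * y))"
      unfolding d by (simp only: mult_ac)
    finally have "of_nat (Suc a) * f (fps_nth (var_series ^ a * fps_deriv var_series) i * y) = 0"
      by (simp only: functional_of_nat kill mult_zero_right)
    then show ?thesis by (simp del: of_nat_Suc)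
  qed
  have k3: "f (fps_nth (fps_nth (U ^ a * D * S') n) m) = 0" for n m S'
  proof -
    have "U ^ a * D = fps_const (var_series ^ a * fps_deriv var_series)"
      by (simp add: U_def D_def fps_const_power)
    then have "fps_nth (fps_nth (U ^ a * D * S') n) m
        = (\<Sum>i=0..m. fps_nth (var_series ^ a * fps_deriv var_series) i * fps_nth (fps_nth S' n) (m - i))"
      by (simp only: fps_mult_left_const_nth fps_mult_nth[of "var_series ^ a * fps_deriv var_series"])
    then show ?thesis
      by (simp add: f_sum k2)
  qed
  have "Abs_fps (\<lambda>n. Abs_fps (\<lambda>m. functional c
             (Z * (fps_nth (var_series ^ a) m * fps_nth (var_series ^ b) n)))) = coeffwise f (U ^ a * V ^ b)"
    by (intro fps_ext)
      (simp add: f_def U_def V_def fps_const_power flip: series_in_v_power, simp add: series_in_v_def)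
  also have "\<dots> = coeffwise f (vdiff ^ (2 * b) * (U ^ a * Q ^ b))"
    by (intro fps_ext) (simp add: e f_add k1 k3 del: power_Suc)
  also have "\<dots> = vdiff ^ (2 * b) * coeffwise f (U ^ a * Q ^ b)"
    by (rule coeffwise_vdiff_power[OF f_diff])
  finally show ?thesis by blast
qed

text \<open>
  Products over multisets of pairs of a charge and an exponent: the order of the clusters is
  irrelevant as long as types are only compared.
\<close>

definition qprod :: "(nat \<times> int) multiset \<Rightarrow> poly_ring" where
  "qprod L = prod_mset (image_mset (\<lambda>(a, j). qcoeff a j) L)"

lemma qprod_add: "qprod (L + L') = qprod L * qprod L'"
  by (simp add: qprod_def)

lemma qprod_single [simp]: "qprod {#(a, j)#} = qcoeff a j"
  by (simp add: qprod_def)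

lemma qprod_mset_set: "finite A \<Longrightarrow> qprod (image_mset (\<lambda>p. (m p, j p)) (mset_set A)) = (\<Prod>p\<in>A. qcoeff (m p) (j p))"
  by (simp add: qprod_def image_mset.compositionality o_def prod_unfold_prod_mset)

lemma qmono_qprod: "qmono r m j = qprod (image_mset (\<lambda>p. (m p, j p)) (mset_set {..<r}))"
  by (simp add: qprod_mset_set qmono_def)

lemma qprod_vars: "qprod (image_mset (\<lambda>k. (1, int k)) M) = single M 1"
proof (induction M)
  case empty
  show ?case by (simp add: qprod_def)
next
  case (add k M)
  have "qprod (image_mset (\<lambda>k. (1, int k)) (add_mset k M))
     = qcoeff 1 (int k) * qprod (image_mset (\<lambda>k. (1, int k)) M)"
    by (simp add: qprod_def)
  then show ?case
    unfolding add qcoeff_1 by (simp add: var_def mult_single)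
qed

lemma keys_qprod: "M \<in> keys (qprod L) \<Longrightarrow> size M = sum_mset (image_mset fst L)"
proof (induction L arbitrary: M)
  case empty
  then show ?case by (simp add: qprod_def)
next
  case (add x L)
  obtain a j where x: "x = (a, j)" by force
  have "qprod (add_mset x L) = qcoeff a j * qprod L"
    by (simp add: qprod_def x)
  with add.prems obtain A B where "M = A + B" "B \<in> keys (qprod L)"
     "A \<in> keys (qcoeff a j)"
    using keys_mult[of "qcoeff a j" "qprod L"] by force
  with add.IH[of B] show ?case
    using keys_qcoeff[of A a "nat j"] by (auto simp: qcoeff_def x split: if_splits)
qed

lemma functional_qprod_charge:
  assumes "functional c (qprod L) \<noteq> 0"
  shows "\<exists>M. c M \<noteq> 0 \<and> size M = sum_mset (image_mset fst L)"
proof (rule ccontr)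
  assume "\<not> ?thesis"
  then have "\<forall>M\<in>keys (qprod L). c M = 0"
    using keys_qprod by blast
  then show False using assms by (simp add: functional_def pm_sum_def)
qed

section \<open>Admissible monomials span\<close>

abbreviation qtype :: "nat \<Rightarrow> (nat \<Rightarrow> nat) \<Rightarrow> nat multiset" where
  "qtype r m \<equiv> image_mset m (mset_set {..<r})"

text \<open>
  Moving one unit from a cluster to one that is at least as large increases the type, whatever
  becomes of the rest of the smaller cluster. This is why the multiset order is the right one.
\<close>

lemma merge_type_less:
  assumes "b \<le> (a :: nat)"
  shows "T + {#a, b#} < T + ({#Suc a#} + E)"
proof -
  have "multp (<) (T + {#a, b#}) (T + ({#Suc a#} + E))"
    by (rule one_step_implies_multp) (use assms in auto)
  then show ?thesis by (simp add: less_multiset_def)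
qed

lemma finite_charge_types: "finite {\<mu>. (0::nat) \<notin># \<mu> \<and> sum_mset \<mu> = k}"
proof (rule finite_surj)
  show "finite {xs. set xs \<subseteq> {..k} \<and> length xs \<le> k}"
    by (rule finite_lists_length_le) simp
  show "{\<mu>. 0 \<notin># \<mu> \<and> sum_mset \<mu> = k} \<subseteq> mset ` {xs. set xs \<subseteq> {..k} \<and> length xs \<le> k}"
  proof
    fix \<mu> :: "nat multiset" assume \<mu>: "\<mu> \<in> {\<mu>. 0 \<notin># \<mu> \<and> sum_mset \<mu> = k}"
    obtain xs where xs: "mset xs = \<mu>" using ex_mset by blast
    then have z: "0 \<notin> set xs" and s: "sum_list xs = k"
      using \<mu> by (auto simp: sum_mset_sum_list)
    have "length xs \<le> sum_list xs" using z by (induction xs) auto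
    moreover have "set xs \<subseteq> {..k}" using s member_le_sum_list by auto
    ultimately show "\<mu> \<in> mset ` {xs. set xs \<subseteq> {..k} \<and> length xs \<le> k}"
      using xs s by auto
  qed
qed

text \<open>
  A functional together with a type, written in descending order, such that all larger types are killed.
\<close>

locale top_type_functional =
  fixes c :: "nat multiset \<Rightarrow> complex" and r :: nat and m :: "nat \<Rightarrow> nat"
  assumes pos: "\<And>p. p < r \<Longrightarrow> m p \<ge> 1"
    and desc: "\<And>i s. i < s \<Longrightarrow> s < r \<Longrightarrow> m s \<le> m i"
    and kill: "\<And>L. qtype r m < image_mset fst L \<Longrightarrow> 0 \<notin># image_mset fst L \<Longrightarrow> functional c (qprod L) = 0"
begin

lemma qmono_split:
  assumes "i < s" "s < r"
  shows "qmono r m j = (\<Prod>p\<in>{..<r} - {i, s}. qcoeff (m p) (j p)) * (qcoeff (m i) (j i) * qcoeff (m s) (j s))"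
proof -
  have "{..<r} = insert i (insert s ({..<r} - {i, s}))" using assms by auto
  then have "qmono r m j = (\<Prod>p\<in>insert i (insert s ({..<r} - {i, s})). qcoeff (m p) (j p))"
    by (simp add: qmono_def)
  then show ?thesis using assms by (simp add: mult_ac)
qed

lemma kill_merged:
  assumes "i < s" "s < r"
  shows "functional c ((\<Prod>p\<in>{..<r} - {i, s}. qcoeff (m p) (j p)) * (fps_nth (var_series ^ Suc (m i)) n * y)) = 0"
proof (induction y rule: poly_mapping_induct)
  case (single N w)
  define A where "A = {..<r} - {i, s}"
  define L where "L = image_mset (\<lambda>p. (m p, j p)) (mset_set A) + ({#(Suc (m i), int n)#} + image_mset (\<lambda>k. (1, int k)) N)"
  have A: "finite A" "i \<notin> A" "s \<notin> A" "{..<r} = insert i (insert s A)"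
    using assms by (auto simp: A_def)
  have "qtype r m = image_mset m (mset_set A) + {#m i, m s#}"
    unfolding A(4) using A(1-3) assms(1) by simp
  also have "\<dots> < image_mset m (mset_set A) + ({#Suc (m i)#} + image_mset (\<lambda>k. 1) N)"
    by (rule merge_type_less) (rule desc[OF assms])
  also have "\<dots> = image_mset fst L"
    by (simp add: L_def image_mset.compositionality o_def)
  finally have "qtype r m < image_mset fst L" .
  moreover have "0 \<notin># image_mset fst L"
    using pos A(1) by (force simp: L_def A_def)
  ultimately have "functional c (qprod L) = 0" by (rule kill)
  moreover have "qprod L = (\<Prod>p\<in>A. qcoeff (m p) (j p)) * (fps_nth (var_series ^ Suc (m i)) n * single N 1)"
    unfolding L_def qprod_add qprod_mset_set[OF A(1)] qprod_vars by (simp add: qcoeff_def del: power_Suc)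
  moreover have "single N w = single 0 w * single N 1"
    by (simp add: mult_single)
  ultimately show ?case
    using functional_scale[of c w "qprod L"]
    by (simp add: A_def[symmetric] mult_ac del: power_Suc)
qed (simp_all add: distrib_left functional_add)

text \<open>
  Clusters \<open>i\<close> and \<open>s\<close> contribute a factor $(u_i - u_s)^{2 m_s}$. At
  the lowest exponent \<open>D\<close> of $u_i$, this factor raises the lower bound for the exponent of
  $u_s$ by $2 m_s$.
\<close>

lemma lowest_exponent_shift:
  assumes "i < s" "s < r"
    and low_s: "\<And>n k. n < A \<Longrightarrow> functional c (qmono r m (j(i := int k, s := int n))) = 0"
    and low_i: "\<And>n k. k < D \<Longrightarrow> functional c (qmono r m (j(i := int k, s := int n))) = 0"
    and "n < A + 2 * m s"
  shows "functional c (qmono r m (j(i := int D, s := int n))) = 0"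
proof -
  define Z where "Z = (\<Prod>p\<in>{..<r} - {i, s}. qcoeff (m p) (j p))"
  define G where "G = Abs_fps (\<lambda>n. Abs_fps (\<lambda>k. functional c
             (Z * (fps_nth (var_series ^ m i) k * fps_nth (var_series ^ m s) n))))"
  have G: "fps_nth (fps_nth G n) k = functional c (qmono r m (j(i := int k, s := int n)))" for n k
  proof -
    have "(\<Prod>p\<in>{..<r} - {i, s}. qcoeff (m p) ((j(i := int k, s := int n)) p)) = Z"
      unfolding Z_def by (intro prod.cong) auto
    then show ?thesis
      unfolding qmono_split[OF assms(1,2)] using assms(1) by (simp add: G_def qcoeff_def)
  qed
  obtain H where H: "G = vdiff ^ (2 * m s) * H"
    unfolding G_def Z_def using quasi_product_divisible[OF kill_merged[OF assms(1,2)]] by blast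
  show ?thesis
    unfolding G[symmetric] H
    by (rule vdiff_order[where A = A and D = D]) (use low_s low_i assms(5) in \<open>auto simp: H[symmetric] G\<close>)
qed

lemma qmono_negative: "p < r \<Longrightarrow> j p < 0 \<Longrightarrow> qmono r m j = 0"
  by (auto simp: qmono_def qcoeff_def intro!: prod_zero)

lemma lex_minimal_nonzero:
  assumes "functional c (qmono r m j0) \<noteq> 0"
  shows "\<exists>J. functional c (qmono r m J) \<noteq> 0 \<and>
    (\<forall>i<r. \<forall>j. (\<forall>p<i. j p = J p) \<longrightarrow> j i < J i \<longrightarrow> functional c (qmono r m j) = 0)"
proof -
  have "\<exists>J. functional c (qmono r m J) \<noteq> 0 \<and> (\<forall>i<k. \<forall>j. (\<forall>p<i. j p = J p) \<longrightarrow> j i < J i \<longrightarrow> functional c (qmono r m j) = 0)"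
    if "k \<le> r" for k
    using that
  proof (induction k)
    case 0
    then show ?case using assms by auto
  next
    case (Suc k)
    then obtain J where J: "functional c (qmono r m J) \<noteq> 0"
      "\<And>i j. i < k \<Longrightarrow> (\<And>p. p < i \<Longrightarrow> j p = J p) \<Longrightarrow> j i < J i \<Longrightarrow> functional c (qmono r m j) = 0"
      by auto
    define good where "good = (\<lambda>j. functional c (qmono r m j) \<noteq> 0 \<and> (\<forall>p<k. j p = J p))"
    have "good J" using J by (simp add: good_def)
    then obtain J' where J': "good J'" "\<And>j. good j \<Longrightarrow> nat (J' k) \<le> nat (j k)"
      using ex_has_least_nat[of good J "\<lambda>j. nat (j k)"] by blast
    have "functional c (qmono r m j) = 0"
      if i: "i < Suc k" and eq: "\<And>p. p < i \<Longrightarrow> j p = J' p" and l: "j i < J' i" for i j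
    proof (cases "i = k")
      case False
      with i have "i < k" by simp
      moreover have "\<And>p. p \<le> i \<Longrightarrow> J' p = J p" using J'(1) \<open>i < k\<close> by (simp add: good_def)
      ultimately show ?thesis using J(2)[of i j] eq l by simp
    next
      case True
      show ?thesis
      proof (rule ccontr)
        assume nz: "\<not> ?thesis"
        then have "j k \<ge> 0" using qmono_negative[of k j] Suc.prems by (cases "j k < 0") auto
        moreover have "good j" using nz eq J'(1) True by (auto simp: good_def)
        ultimately show False using J'(2)[of j] l True by simp
      qed
    qed
    then show ?case using J'(1) by (intro exI[of _ J']) (auto simp: good_def)
  qed
  from this[of r] show ?thesis by simp
qed

text \<open>
  The lexicographically lowest exponents are admissible. Cluster \<open>s\<close> meets the clusters
  \<open>0, ..., s - 1\<close> one after the other, and each raises its exponent by $2 m_s$. If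
  clusters \<open>p\<close> and \<open>p + 1\<close> have equal charges, then by symmetry the exponent of the
  second is at least that of the first, before their mutual factor raises it by $2 m_p$.
\<close>

lemma ex_admissible:
  assumes "functional c (qmono r m j0) \<noteq> 0"
  shows "\<exists>J. admissible r m J \<and> functional c (qmono r m J) \<noteq> 0"
proof -
  obtain J where J: "functional c (qmono r m J) \<noteq> 0 \<and>
    (\<forall>i<r. \<forall>j. (\<forall>p<i. j p = J p) \<longrightarrow> j i < J i \<longrightarrow> functional c (qmono r m j) = 0)"
    using lex_minimal_nonzero[OF assms] by (rule exE)
  note nz = conjunct1[OF J] and min' = conjunct2[OF J]
  have min: "functional c (qmono r m j) = 0"
    if "i < r" "\<And>p. p < i \<Longrightarrow> j p = J p" "j i < J i" for i j
    by (rule min'[rule_format, of i j]) (use that in auto)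
  have J0: "J p \<ge> 0" if "p < r" for p
    using nz qmono_negative[OF that, of J] by (cases "J p < 0") auto
  have step: "functional c (qmono r m j) = 0"
    if "i < s" "s < r" "\<And>p. p \<le> i \<Longrightarrow> j p = J p"
      "\<And>j. (\<And>p. p < i \<Longrightarrow> j p = J p) \<Longrightarrow> j s < int A \<Longrightarrow> functional c (qmono r m j) = 0"
      "j s < int (A + 2 * m s)" for i s j A
  proof (cases "j s < 0")
    case False
    have "functional c (qmono r m (j(i := int (nat (J i)), s := int (nat (j s))))) = 0"
    proof (rule lowest_exponent_shift[OF that(1,2), of A])
      fix n k
      show "functional c (qmono r m (j(i := int k, s := int n))) = 0" if "n < A"
        by (rule \<open>\<And>j. (\<And>p. p < i \<Longrightarrow> j p = J p) \<Longrightarrow> j s < int A \<Longrightarrow> functional c (qmono r m j) = 0\<close>)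
          (use \<open>i < s\<close> \<open>\<And>p. p \<le> i \<Longrightarrow> j p = J p\<close> that in auto)
      show "functional c (qmono r m (j(i := int k, s := int n))) = 0" if "k < nat (J i)"
        by (rule min[of i]) (use \<open>i < s\<close> \<open>s < r\<close> \<open>\<And>p. p \<le> i \<Longrightarrow> j p = J p\<close> that in auto)
    next
      show "nat (j s) < A + 2 * m s" using that(5) False by linarith
    qed
    moreover have "j(i := int (nat (J i)), s := int (nat (j s))) = j"
      using False that(1-3) J0[of i] by (auto simp: fun_eq_iff)
    ultimately show ?thesis by simp
  qed (use that qmono_negative in auto)
  have low: "functional c (qmono r m j) = 0"
    if "i \<le> s" "s < r" "\<And>p. p < i \<Longrightarrow> j p = J p" "j s < int (2 * i * m s)" for i s j
    using that
  proof (induction i arbitrary: j)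
    case 0
    then show ?case using qmono_negative[of s j] by simp
  next
    case (Suc i)
    show ?case
      by (rule step[of i s _ "2 * i * m s"]) (use Suc in \<open>auto simp: algebra_simps\<close>)
  qed
  have "J p \<ge> 2 * int p * int (m p)" if "p < r" for p
    using low[of p p J] nz that by (cases "J p < int (2 * p * m p)") auto
  moreover have "J (Suc p) \<ge> J p + 2 * int (m p)" if p: "Suc p < r" "m (Suc p) = m p" for p
  proof (rule ccontr)
    assume l: "\<not> ?thesis"
    have "functional c (qmono r m (J(p := int (nat (J p)), Suc p := int (nat (J (Suc p)))))) = 0"
    proof (rule lowest_exponent_shift[of p "Suc p" "nat (J p)"])
      fix n k
      show low_p: "functional c (qmono r m (J(p := int k, Suc p := int n))) = 0" if "k < nat (J p)" for n k
        by (rule min[of p]) (use p that in auto)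
      show "functional c (qmono r m (J(p := int k, Suc p := int n))) = 0" if "n < nat (J p)"
      proof -
        have "qmono r m (J(p := int k, Suc p := int n)) = qmono r m (J(p := int n, Suc p := int k))"
        proof -
          have "(\<Prod>q\<in>{..<r} - {p, Suc p}. qcoeff (m q) ((J(p := int k, Suc p := int n)) q))
              = (\<Prod>q\<in>{..<r} - {p, Suc p}. qcoeff (m q) ((J(p := int n, Suc p := int k)) q))"
            by (intro prod.cong) auto
          then show ?thesis
            unfolding qmono_split[OF lessI p(1)] by (simp add: p(2) mult.commute)
        qed
        then show ?thesis using low_p[OF that] by simp
      qed
    next
      show "nat (J (Suc p)) < nat (J p) + 2 * m (Suc p)"
        using l p J0[of p] J0[of "Suc p"] by linarith
    qed (use p in auto)
    moreover have "J(p := int (nat (J p)), Suc p := int (nat (J (Suc p)))) = J"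
      using p J0[of p] J0[of "Suc p"] by (auto simp: fun_eq_iff)
    ultimately show False using nz by simp
  qed
  ultimately show ?thesis
    using nz pos desc by (intro exI[of _ J]) (auto simp: admissible_def)
qed

end

text \<open>
  In a fixed charge there are only finitely many types, hence a largest one that is not killed.
\<close>

lemma functional_zero_of_admissible_homogeneous:
  assumes supp: "\<And>M. size M \<noteq> k \<Longrightarrow> c M = 0"
    and adm: "\<And>r m j. admissible r m j \<Longrightarrow> functional c (qmono r m j) = 0"
  shows "c M0 = 0"
proof (rule ccontr)
  assume M0: "c M0 \<noteq> 0"
  define alive where "alive = {\<mu>. \<exists>L. image_mset fst L = \<mu> \<and> 0 \<notin># \<mu> \<and> functional c (qprod L) \<noteq> 0}"
  have fin: "finite alive"
  proof (rule finite_subset[OF _ finite_charge_types[of k]])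
    show "alive \<subseteq> {\<mu>. 0 \<notin># \<mu> \<and> sum_mset \<mu> = k}"
    proof
      fix \<mu> assume "\<mu> \<in> alive"
      then obtain L where L: "image_mset fst L = \<mu>" "0 \<notin># \<mu>" "functional c (qprod L) \<noteq> 0"
        by (auto simp: alive_def)
      obtain M where M: "c M \<noteq> 0 \<and> size M = sum_mset (image_mset fst L)"
        using functional_qprod_charge[OF L(3)] by (rule exE)
      have "size M = k"
      proof (rule ccontr)
        assume "size M \<noteq> k"
        then have "c M = 0" by (rule supp)
        with conjunct1[OF M] show False by (rule notE)
      qed
      with conjunct2[OF M] L(1) have "sum_mset \<mu> = k"
        by (simp only:)
      with L(2) show "\<mu> \<in> {\<mu>. 0 \<notin># \<mu> \<and> sum_mset \<mu> = k}"
        by (intro CollectI conjI)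
    qed
  qed
  define L0 where "L0 = image_mset (\<lambda>k. (1 :: nat, int k)) M0"
  have "0 \<notin># image_mset fst L0" "functional c (qprod L0) \<noteq> 0"
    using M0 unfolding L0_def qprod_vars by auto
  then have "image_mset fst L0 \<in> alive"
    unfolding alive_def by (intro CollectI exI[of _ L0] conjI refl)
  then have "alive \<noteq> {}" by blast
  define \<mu> where "\<mu> = Max alive"
  have "\<mu> \<in> alive"
    unfolding \<mu>_def by (rule Max_in[OF fin \<open>alive \<noteq> {}\<close>])
  then obtain L where L: "image_mset fst L = \<mu>" "0 \<notin># \<mu>" "functional c (qprod L) \<noteq> 0"
    by (auto simp: alive_def)
  obtain ys where ys: "mset ys = L" using ex_mset by blast
  define xs where "xs = rev (sort_key fst ys)"
  define m j where "m = (\<lambda>p. fst (xs ! p))" and "j = (\<lambda>p. snd (xs ! p))"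
  have xs: "mset xs = L" by (simp add: xs_def ys)
  have srt: "sorted (rev (map fst xs))"
    by (simp add: xs_def rev_map)
  have Lj: "image_mset (\<lambda>p. (m p, j p)) (mset_set {..<length xs}) = L"
  proof -
    have "image_mset (\<lambda>p. (m p, j p)) (mset_set {..<length xs}) = image_mset ((!) xs) (mset [0..<length xs])"
      by (simp add: m_def j_def atLeast0LessThan)
    also have "\<dots> = mset xs" by (simp only: map_nth flip: mset_map)
    finally show ?thesis using xs by simp
  qed
  have type: "qtype (length xs) m = \<mu>"
    using arg_cong[OF Lj, of "image_mset fst"] by (simp add: image_mset.compositionality o_def L(1))
  interpret top_type_functional c "length xs" m
  proof
    fix p assume "p < length xs"
    then have "xs ! p \<in> set xs" by (rule nth_mem)
    also have "set xs = set_mset L" by (simp flip: xs)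
    finally have "m p \<in># image_mset fst L" by (simp add: m_def)
    with L(1,2) have "m p \<noteq> 0" by metis
    then show "m p \<ge> 1" by simp
  next
    fix i s assume "i < s" "s < length xs"
    then show "m s \<le> m i"
      using srt by (simp add: sorted_rev_iff_nth_mono m_def)
  next
    fix L' :: "(nat \<times> int) multiset" assume L': "qtype (length xs) m < image_mset fst L'" "0 \<notin># image_mset fst L'"
    show "functional c (qprod L') = 0"
    proof (rule ccontr)
      assume "functional c (qprod L') \<noteq> 0"
      then have "image_mset fst L' \<in> alive" using L'(2) by (auto simp: alive_def)
      then have "image_mset fst L' \<le> \<mu>" unfolding \<mu>_def by (rule Max_ge[OF fin])
      then show False using L'(1)[unfolded type] by (rule leD[THEN notE])
    qed
  qed
  have nz: "functional c (qmono (length xs) m j) \<noteq> 0"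
    using L(3) by (simp add: qmono_qprod Lj)
  obtain J where J: "admissible (length xs) m J \<and> functional c (qmono (length xs) m J) \<noteq> 0"
    using ex_admissible[OF nz] by (rule exE)
  with adm[OF conjunct1[OF J]] show False by simp
qed

theorem functional_zero_of_admissible:
  assumes "\<And>r m j. admissible r m j \<Longrightarrow> functional c (qmono r m j) = 0"
  shows "c = (\<lambda>M. 0)"
proof
  fix M :: "nat multiset"
  define k where "k = size M"
  define c' where "c' = (\<lambda>N. if size N = k then c N else 0)"
  have "functional c' (qmono r m j) = 0" if adm: "admissible r m j" for r m j
  proof -
    have "functional c' (qmono r m j) = (if (\<Sum>p<r. m p) = k then functional c (qmono r m j) else 0)"
      unfolding functional_def pm_sum_def c'_def using keys_qmono[of _ r m j] by simp
    then show ?thesis using assms[OF adm] by simp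
  qed
  note c'_adm = this
  have c'_supp: "c' N = 0" if "size N \<noteq> k" for N
    using that by (simp add: c'_def)
  have "c' M = 0"
    by (rule functional_zero_of_admissible_homogeneous[OF c'_supp c'_adm])
  then show "c M = 0" by (simp add: c'_def k_def)
qed

section \<open>Constant-coefficient differential operators\<close>

definition der :: "nat \<Rightarrow> poly_ring \<Rightarrow> poly_ring" where
  "der k = pm_sum (\<lambda>M a. single (M - {#k#}) (a * of_nat (count M k)))"

lemma der_0 [simp]: "der k 0 = 0"
  by (simp add: der_def)

lemma der_single: "der k (single M a) = single (M - {#k#}) (a * of_nat (count M k))"
  by (simp add: der_def pm_sum_single)

lemma der_add: "der k (p + q) = der k p + der k q"
  unfolding der_def by (intro pm_sum_add) (simp_all add: distrib_right single_add)

lemma der_sum: "der k (\<Sum>i\<in>A. f i) = (\<Sum>i\<in>A. der k (f i))"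
  by (induction A rule: infinite_finite_induct) (simp_all add: der_add)

lemma der_mult: "der k (p * q) = der k p * q + p * der k q"
proof (induction p rule: poly_mapping_induct)
  case (single M a)
  show ?case
  proof (induction q rule: poly_mapping_induct)
    case (single N b)
    have 1: "single (M - {#k#} + N) (a * of_nat (count M k) * b)
        = single (M + N - {#k#}) (a * of_nat (count M k) * b)"
      by (cases "k \<in># M") (simp_all add: not_in_iff)
    have 2: "single (M + (N - {#k#})) (a * (b * of_nat (count N k)))
        = single (M + N - {#k#}) (a * (b * of_nat (count N k)))"
      by (cases "k \<in># N") (simp_all add: not_in_iff)
    show ?case
      unfolding mult_single der_single 1 2 single_add[symmetric]
      by (simp add: algebra_simps)
  qed (simp_all add: der_add distrib_left)
qed (simp_all add: der_add distrib_right)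

lemma der_const [simp]: "der k (single 0 a) = 0"
  by (simp add: der_single)

lemma der_scale: "der k (single 0 a * p) = single 0 a * der k p"
  by (simp add: der_mult)

lemma der_1 [simp]: "der k 1 = 0"
  using der_const[of k 1] by simp

lemma der_of_nat [simp]: "der k (of_nat n) = 0"
  by (induction n) (simp_all add: der_add)

lemma der_var: "der k (var i) = of_bool (i = k)"
  by (simp add: var_def der_single)

lemma der_var_series_power:
  "der k (fps_nth (var_series ^ a) n) = of_nat a * (if n < k then 0 else fps_nth (var_series ^ (a - 1)) (n - k))"
proof -
  define D where "D = (\<lambda>f. Abs_fps (\<lambda>n. der k (fps_nth f n)))"
  have D_mult: "D (f * g) = D f * g + f * D g" for f g
    by (rule fps_ext) (simp add: D_def fps_mult_nth der_sum der_mult sum.distrib)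
  have D_X: "D var_series = fps_X ^ k"
    by (rule fps_ext) (auto simp: D_def var_series_def der_var fps_X_power_nth)
  have "D (var_series ^ a) = of_nat a * (fps_X ^ k * var_series ^ (a - 1))"
  proof (induction a)
    case 0
    show ?case by (rule fps_ext) (simp add: D_def fps_one_nth)
  next
    case (Suc a)
    have "D (var_series ^ Suc a) = fps_X ^ k * var_series ^ a + var_series * (of_nat a * (fps_X ^ k * var_series ^ (a - 1)))"
      by (simp add: D_mult D_X Suc.IH)
    also have "\<dots> = of_nat (Suc a) * (fps_X ^ k * var_series ^ a)"
      by (cases a) (simp_all add: algebra_simps)
    finally show ?case by simp
  qed
  then have "fps_nth (D (var_series ^ a)) n = fps_nth (of_nat a * (fps_X ^ k * var_series ^ (a - 1))) n"
    by simp
  also have "of_nat a = fps_const (of_nat a :: poly_ring)"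
    by (simp add: fps_of_nat)
  finally show ?thesis
    by (simp add: D_def fps_X_power_mult_nth)
qed

lemma der_qcoeff: "der k (qcoeff a j) = of_nat a * qcoeff (a - 1) (j - int k)"
  by (simp add: qcoeff_def der_var_series_power nat_diff_distrib) (smt (verit) nat_less_iff nat_minus_as_int)

lemma der_prod:
  "finite A \<Longrightarrow> der k (\<Prod>p\<in>A. f p) = (\<Sum>P\<in>A. der k (f P) * (\<Prod>p\<in>A - {P}. f p))"
proof (induction A rule: finite_induct)
  case (insert x A)
  have "f x * (\<Sum>P\<in>A. der k (f P) * (\<Prod>p\<in>A - {P}. f p))
      = (\<Sum>P\<in>A. der k (f P) * (\<Prod>p\<in>insert x A - {P}. f p))"
    unfolding sum_distrib_left
  proof (rule sum.cong[OF refl])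
    fix P assume "P \<in> A"
    then have "insert x A - {P} = insert x (A - {P})" "x \<notin> A - {P}" using insert by auto
    then show "f x * (der k (f P) * (\<Prod>p\<in>A - {P}. f p)) = der k (f P) * (\<Prod>p\<in>insert x A - {P}. f p)"
      using insert by (simp add: mult_ac)
  qed
  then show ?case
    using insert by (simp add: der_mult)
qed simp

lemma der_qmono:
  "der k (qmono n m j) = (\<Sum>P<n. of_nat (m P) * qmono n (m(P := m P - 1)) (j(P := j P - int k)))"
proof -
  have "der k (qcoeff (m P) (j P)) * (\<Prod>p\<in>{..<n} - {P}. qcoeff (m p) (j p))
      = of_nat (m P) * qmono n (m(P := m P - 1)) (j(P := j P - int k))" if "P < n" for P
  proof -
    have "qmono n (m(P := m P - 1)) (j(P := j P - int k)) = qcoeff (m P - 1) (j P - int k) *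
       (\<Prod>p\<in>{..<n} - {P}. qcoeff ((m(P := m P - 1)) p) ((j(P := j P - int k)) p))"
      unfolding qmono_def using that by (subst prod.remove[of _ P]) simp_all
    also have "(\<Prod>p\<in>{..<n} - {P}. qcoeff ((m(P := m P - 1)) p) ((j(P := j P - int k)) p))
       = (\<Prod>p\<in>{..<n} - {P}. qcoeff (m p) (j p))"
      by (intro prod.cong) auto
    finally show ?thesis by (simp only: der_qcoeff mult.assoc)
  qed
  then show ?thesis
    by (simp add: qmono_def der_prod)
qed

fun ders :: "nat \<Rightarrow> (nat \<Rightarrow> nat) \<Rightarrow> poly_ring \<Rightarrow> poly_ring" where
  "ders 0 \<kappa> y = y"
| "ders (Suc R) \<kappa> y = der (\<kappa> R) (ders R \<kappa> y)"

lemma ders_add: "ders R \<kappa> (p + q) = ders R \<kappa> p + ders R \<kappa> q"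
  by (induction R) (simp_all add: der_add)

lemma ders_scale: "ders R \<kappa> (single 0 a * p) = single 0 a * ders R \<kappa> p"
  by (induction R) (simp_all add: der_scale)

definition hits :: "nat \<Rightarrow> (nat \<Rightarrow> nat) \<Rightarrow> nat \<Rightarrow> nat" where
  "hits R \<pi> P = card {q. q < R \<and> \<pi> q = P}"

definition hit_sum :: "nat \<Rightarrow> (nat \<Rightarrow> nat) \<Rightarrow> (nat \<Rightarrow> nat) \<Rightarrow> nat \<Rightarrow> nat" where
  "hit_sum R \<kappa> \<pi> P = (\<Sum>q | q < R \<and> \<pi> q = P. \<kappa> q)"

abbreviation col_shift :: "nat \<Rightarrow> (nat \<Rightarrow> nat) \<Rightarrow> (nat \<Rightarrow> nat) \<Rightarrow> (nat \<Rightarrow> nat) \<Rightarrow> nat \<Rightarrow> nat" where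
  "col_shift R l \<tau> \<pi> \<equiv> hit_sum R (\<lambda>q. q + l (\<tau> q)) \<pi>"

definition hit_weight :: "nat \<Rightarrow> (nat \<Rightarrow> nat) \<Rightarrow> (nat \<Rightarrow> nat) \<Rightarrow> nat" where
  "hit_weight R m \<pi> = (\<Prod>q<R. m (\<pi> q) - hits q \<pi> (\<pi> q))"

lemma hits_Suc: "hits (Suc R) \<pi> P = hits R \<pi> P + of_bool (\<pi> R = P)"
proof -
  have "{q. q < Suc R \<and> \<pi> q = P} = (if \<pi> R = P then insert R {q. q < R \<and> \<pi> q = P} else {q. q < R \<and> \<pi> q = P})"
    by (auto simp: less_Suc_eq)
  then show ?thesis by (simp add: hits_def)
qed

lemma hit_sum_Suc: "hit_sum (Suc R) \<kappa> \<pi> P = hit_sum R \<kappa> \<pi> P + (if \<pi> R = P then \<kappa> R else 0)"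
proof -
  have "{q. q < Suc R \<and> \<pi> q = P} = (if \<pi> R = P then insert R {q. q < R \<and> \<pi> q = P} else {q. q < R \<and> \<pi> q = P})"
    by (auto simp: less_Suc_eq)
  then show ?thesis by (simp add: hit_sum_def)
qed

text \<open>
  Each of the \<open>R\<close> derivatives hits one cluster, and \<open>\<pi>\<close> records which. The weight is
  the product of the falling factorials that arise and does not depend on the orders
  \<open>\<kappa>\<close> of the derivatives.
\<close>

lemma ders_qmono:
  "ders R \<kappa> (qmono n m j) = (\<Sum>\<pi>\<in>{..<R} \<rightarrow>\<^sub>E {..<n}. of_nat (hit_weight R m \<pi>)
     * qmono n (\<lambda>P. m P - hits R \<pi> P) (\<lambda>P. j P - int (hit_sum R \<kappa> \<pi> P)))"
proof (induction R)
  case 0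
  show ?case by (simp add: hit_weight_def hits_def hit_sum_def)
next
  case (Suc R)
  define t where "t = (\<lambda>\<pi>. of_nat (hit_weight R m \<pi>)
     * qmono n (\<lambda>P. m P - hits R \<pi> P) (\<lambda>P. j P - int (hit_sum R \<kappa> \<pi> P)))"
  define t' where "t' = (\<lambda>\<pi>. of_nat (hit_weight (Suc R) m \<pi>)
     * qmono n (\<lambda>P. m P - hits (Suc R) \<pi> P) (\<lambda>P. j P - int (hit_sum (Suc R) \<kappa> \<pi> P)))"
  have t': "t' (\<pi>(R := P)) = of_nat (hit_weight R m \<pi>) * (of_nat (m P - hits R \<pi> P) *
      qmono n ((\<lambda>P. m P - hits R \<pi> P)(P := m P - hits R \<pi> P - 1))
        ((\<lambda>P. j P - int (hit_sum R \<kappa> \<pi> P))(P := j P - int (hit_sum R \<kappa> \<pi> P) - int (\<kappa> R))))" for \<pi> P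
  proof -
    have h: "hits q (\<pi>(R := P)) = hits q \<pi>" if "q \<le> R" for q
    proof
      fix Q
      have "{q'. q' < q \<and> (\<pi>(R := P)) q' = Q} = {q'. q' < q \<and> \<pi> q' = Q}" using that by auto
      then show "hits q (\<pi>(R := P)) Q = hits q \<pi> Q" by (simp only: hits_def)
    qed
    have hs: "hit_sum R \<kappa> (\<pi>(R := P)) Q = hit_sum R \<kappa> \<pi> Q" for Q
    proof -
      have "{q'. q' < R \<and> (\<pi>(R := P)) q' = Q} = {q'. q' < R \<and> \<pi> q' = Q}" by auto
      then show ?thesis by (simp only: hit_sum_def)
    qed
    have w: "hit_weight (Suc R) m (\<pi>(R := P)) = hit_weight R m \<pi> * (m P - hits R \<pi> P)"
      by (simp add: hit_weight_def h)
    have e1: "(\<lambda>Q. m Q - hits (Suc R) (\<pi>(R := P)) Q) = (\<lambda>P. m P - hits R \<pi> P)(P := m P - hits R \<pi> P - 1)"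
      by (auto simp: fun_eq_iff hits_Suc h)
    have e2: "(\<lambda>Q. j Q - int (hit_sum (Suc R) \<kappa> (\<pi>(R := P)) Q))
       = (\<lambda>P. j P - int (hit_sum R \<kappa> \<pi> P))(P := j P - int (hit_sum R \<kappa> \<pi> P) - int (\<kappa> R))"
      by (auto simp: fun_eq_iff hit_sum_Suc hs)
    show ?thesis
      unfolding t'_def e1 e2 w by (simp add: mult.assoc)
  qed
  have "ders (Suc R) \<kappa> (qmono n m j) = (\<Sum>\<pi>\<in>{..<R} \<rightarrow>\<^sub>E {..<n}. der (\<kappa> R) (t \<pi>))"
    by (simp add: Suc.IH der_sum t_def)
  also have "\<dots> = (\<Sum>\<pi>\<in>{..<R} \<rightarrow>\<^sub>E {..<n}. \<Sum>P<n. t' (\<pi>(R := P)))"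
    unfolding t' by (simp add: t_def der_mult der_qmono sum_distrib_left)
  also have "\<dots> = (\<Sum>P<n. \<Sum>\<pi>\<in>{..<R} \<rightarrow>\<^sub>E {..<n}. t' (\<pi>(R := P)))"
    by (rule sum.swap)
  also have "\<dots> = (\<Sum>(P, \<pi>)\<in>{..<n} \<times> ({..<R} \<rightarrow>\<^sub>E {..<n}). t' (\<pi>(R := P)))"
    by (rule sum.cartesian_product)
  also have "\<dots> = sum t' ((\<lambda>(P, \<pi>). \<pi>(R := P)) ` ({..<n} \<times> ({..<R} \<rightarrow>\<^sub>E {..<n})))"
    using inj_combinator[of R "{..<R}" "\<lambda>_. {..<n}"]
    by (subst sum.reindex) (simp_all add: case_prod_unfold)
  also have "(\<lambda>(P, \<pi>). \<pi>(R := P)) ` ({..<n} \<times> ({..<R} \<rightarrow>\<^sub>E {..<n})) = {..<Suc R} \<rightarrow>\<^sub>E {..<n}"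
    by (simp add: lessThan_Suc PiE_insert_eq)
  finally show ?case by (simp add: t'_def)
qed

lemma sum_sign_invariant_eq_0:
  fixes G :: "(nat \<Rightarrow> nat) \<Rightarrow> complex"
  assumes "a \<in> S" "b \<in> S" "a \<noteq> b" "finite S" and inv: "\<And>\<tau>. G (\<tau> \<circ> Transposition.transpose a b) = G \<tau>"
  shows "(\<Sum>\<tau> | \<tau> permutes S. of_int (sign \<tau>) * G \<tau>) = 0"
proof -
  define T where "T = Transposition.transpose a b"
  have T: "T permutes S" using assms by (simp add: T_def permutes_swap_id)
  have "(\<Sum>\<tau> | \<tau> permutes S. of_int (sign \<tau>) * G \<tau>)
      = (\<Sum>\<tau> | \<tau> permutes S. of_int (sign (\<tau> \<circ> T)) * G (\<tau> \<circ> T))"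
    by (rule sum_permutations_compose_right[OF T])
  also have "\<dots> = (\<Sum>\<tau> | \<tau> permutes S. - (of_int (sign \<tau>) * G \<tau>))"
  proof (rule sum.cong[OF refl])
    fix \<tau> assume "\<tau> \<in> {\<tau>. \<tau> permutes S}"
    then have "permutation \<tau>" "permutation T"
      using assms(4) T by (auto simp: permutation_permutes)
    then have "sign (\<tau> \<circ> T) = - sign \<tau>"
      using assms(3) by (simp add: sign_compose T_def sign_swap_id)
    then show "of_int (sign (\<tau> \<circ> T)) * G (\<tau> \<circ> T) = - (of_int (sign \<tau>) * G \<tau>)"
      using inv by (simp add: T_def)
  qed
  also have "\<dots> = - (\<Sum>\<tau> | \<tau> permutes S. of_int (sign \<tau>) * G \<tau>)"
    by (rule sum_negf)
  finally show ?thesis by simp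
qed

section \<open>Admissible monomials are independent\<close>

definition linear_functional :: "(poly_ring \<Rightarrow> complex) \<Rightarrow> bool" where
  "linear_functional f \<longleftrightarrow> (\<forall>p q. f (p + q) = f p + f q) \<and> (\<forall>a p. f (single 0 a * p) = a * f p)"

lemma linear_functional_functional: "linear_functional (functional c)"
  by (simp add: linear_functional_def functional_add functional_scale)

lemma linear_functional_eq_functional:
  assumes "linear_functional f"
  shows "f = functional (\<lambda>M. f (single M 1))"
proof
  fix p
  have add: "f (p + q) = f p + f q" for p q using assms by (simp add: linear_functional_def)
  have f0: "f 0 = 0" using add[of 0 0] by simp
  have fs: "f (single M a) = a * f (single M 1)" for M a
  proof -
    have "f (single 0 a * single M 1) = a * f (single M 1)"
      using assms by (simp only: linear_functional_def)
    then show ?thesis by (simp add: mult_single)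
  qed
  show "f p = functional (\<lambda>M. f (single M 1)) p"
  proof (induction p rule: poly_mapping_induct)
    case (single M a)
    show ?case unfolding functional_single by (rule fs)
  qed (simp_all add: f0 add functional_add)
qed

text \<open>
  The functional \<open>f\<close> composed with the determinant of the matrix of commuting operators
  $\partial_{q + l(q')}$, for \<open>q\<close> and \<open>q'\<close> below \<open>R\<close>.
\<close>

definition det_functional :: "nat \<Rightarrow> (nat \<Rightarrow> nat) \<Rightarrow> (poly_ring \<Rightarrow> complex) \<Rightarrow> poly_ring \<Rightarrow> complex" where
  "det_functional R l f y = (\<Sum>\<tau> | \<tau> permutes {..<R}. of_int (sign \<tau>) * f (ders R (\<lambda>q. q + l (\<tau> q)) y))"

lemma linear_functional_det_functional:
  "linear_functional f \<Longrightarrow> linear_functional (det_functional R l f)"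
  by (simp add: linear_functional_def det_functional_def ders_add ders_scale sum.distrib
      distrib_left sum_distrib_left mult.left_commute)

text \<open>
  If two derivatives hit the same cluster, exchanging their values of \<open>l\<close> does not change the
  total by which the exponent of that cluster is lowered.
\<close>

lemma hit_sum_transpose:
  assumes "\<pi> a = \<pi> b" "a < R" "b < R"
  shows "hit_sum R (\<lambda>q. q + l ((\<tau> \<circ> Transposition.transpose a b) q)) \<pi> = col_shift R l \<tau> \<pi>"
proof
  fix P
  define A where "A = {q. q < R \<and> \<pi> q = P}"
  have "(\<Sum>q\<in>A. l (\<tau> (Transposition.transpose a b q))) = (\<Sum>q\<in>A. l (\<tau> q))"
  proof (cases "a \<in> A")
    case True
    then have "Transposition.transpose a b permutes A"
      using assms by (intro permutes_swap_id) (auto simp: A_def)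
    from sum.permute[OF this, of "\<lambda>q. l (\<tau> q)"] show ?thesis by (simp add: o_def)
  next
    case False
    then have "Transposition.transpose a b q = q" if "q \<in> A" for q
      using assms that by (intro transpose_apply_other) (auto simp: A_def)
    then show ?thesis by simp
  qed
  then show "hit_sum R (\<lambda>q. q + l ((\<tau> \<circ> Transposition.transpose a b) q)) \<pi> P = col_shift R l \<tau> \<pi> P"
    by (simp add: hit_sum_def sum.distrib flip: A_def)
qed

text \<open>
  The terms in which two derivatives hit the same cluster cancel in pairs of opposite sign.
\<close>

lemma det_functional_qmono:
  assumes f: "linear_functional f"
  shows "det_functional R l f (qmono n m j) =
    (\<Sum>\<pi> | \<pi> \<in> {..<R} \<rightarrow>\<^sub>E {..<n} \<and> inj_on \<pi> {..<R}. of_nat (hit_weight R m \<pi>) *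
      (\<Sum>\<tau> | \<tau> permutes {..<R}. of_int (sign \<tau>) *
        f (qmono n (\<lambda>P. m P - hits R \<pi> P) (\<lambda>P. j P - int (col_shift R l \<tau> \<pi> P)))))"
proof -
  note fc = linear_functional_eq_functional[OF f]
  define E where "E = (\<lambda>\<pi> \<tau>. f (qmono n (\<lambda>P. m P - hits R \<pi> P) (\<lambda>P. j P - int (col_shift R l \<tau> \<pi> P))))"
  have sum: "f (\<Sum>i\<in>A. of_nat (w i) * g i) = (\<Sum>i\<in>A. of_nat (w i) * f (g i))" for A :: "(nat \<Rightarrow> nat) set" and w g
    by (subst (1 2) fc) (simp only: functional_sum functional_of_nat)
  have "det_functional R l f (qmono n m j) = (\<Sum>\<tau> | \<tau> permutes {..<R}. of_int (sign \<tau>) *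
      (\<Sum>\<pi>\<in>{..<R} \<rightarrow>\<^sub>E {..<n}. of_nat (hit_weight R m \<pi>) * E \<pi> \<tau>))"
    by (simp only: det_functional_def ders_qmono sum E_def)
  also have "\<dots> = (\<Sum>\<pi>\<in>{..<R} \<rightarrow>\<^sub>E {..<n}. of_nat (hit_weight R m \<pi>) *
      (\<Sum>\<tau> | \<tau> permutes {..<R}. of_int (sign \<tau>) * E \<pi> \<tau>))"
    unfolding sum_distrib_left by (subst sum.swap) (simp only: mult.left_commute)
  also have "\<dots> = (\<Sum>\<pi> | \<pi> \<in> {..<R} \<rightarrow>\<^sub>E {..<n} \<and> inj_on \<pi> {..<R}. of_nat (hit_weight R m \<pi>) *
      (\<Sum>\<tau> | \<tau> permutes {..<R}. of_int (sign \<tau>) * E \<pi> \<tau>))"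
  proof (intro sum.mono_neutral_right ballI)
    show "finite ({..<R} \<rightarrow>\<^sub>E {..<n})" by (intro finite_PiE) auto
  next
    fix \<pi> assume "\<pi> \<in> ({..<R} \<rightarrow>\<^sub>E {..<n}) - {\<pi>. \<pi> \<in> {..<R} \<rightarrow>\<^sub>E {..<n} \<and> inj_on \<pi> {..<R}}"
    then obtain a b where ab: "a < R" "b < R" "a \<noteq> b" "\<pi> a = \<pi> b" by (auto simp: inj_on_def)
    have "(\<Sum>\<tau> | \<tau> permutes {..<R}. of_int (sign \<tau>) * E \<pi> \<tau>) = 0"
    proof (rule sum_sign_invariant_eq_0)
      show "E \<pi> (\<tau> \<circ> Transposition.transpose a b) = E \<pi> \<tau>" for \<tau>
        unfolding E_def hit_sum_transpose[OF ab(4,1,2)] ..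
    qed (use ab in auto)
    then show "of_nat (hit_weight R m \<pi>) * (\<Sum>\<tau> | \<tau> permutes {..<R}. of_int (sign \<tau>) * E \<pi> \<tau>) = 0"
      by simp
  qed auto
  finally show ?thesis by (simp only: E_def)
qed

lemma less_multiset_iff_top_difference:
  fixes M N :: "'a::linorder multiset"
  shows "M < N \<longleftrightarrow> (\<exists>v. count M v < count N v \<and> (\<forall>w>v. count M w = count N w))"
proof
  assume "M < N"
  then have ne: "M \<noteq> N" and ho: "\<And>y. count N y < count M y \<Longrightarrow> \<exists>x>y. count M x < count N x"
    by (auto simp: less_multiset\<^sub>H\<^sub>O)
  define D where "D = {v. count M v \<noteq> count N v}"
  have "D \<subseteq> set_mset M \<union> set_mset N"
  proof
    fix v assume "v \<in> D"
    show "v \<in> set_mset M \<union> set_mset N"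
    proof (rule ccontr)
      assume "v \<notin> set_mset M \<union> set_mset N"
      then have "count M v = 0" "count N v = 0" by (simp_all add: count_eq_zero_iff)
      then show False using \<open>v \<in> D\<close> by (simp add: D_def)
    qed
  qed
  then have fin: "finite D" by (rule finite_subset) simp
  have "D \<noteq> {}" using ne by (auto simp: D_def multiset_eq_iff)
  define v where "v = Max D"
  have "v \<in> D" unfolding v_def by (rule Max_in[OF fin \<open>D \<noteq> {}\<close>])
  have top: "count M w = count N w" if "w > v" for w
  proof (rule ccontr)
    assume "count M w \<noteq> count N w"
    then have "w \<le> v" unfolding v_def by (intro Max_ge[OF fin]) (simp add: D_def)
    then show False using that by (simp add: not_le[symmetric])
  qed
  have "\<not> count N v < count M v"
  proof
    assume "count N v < count M v"
    then obtain x where "x > v" "count M x < count N x" using ho by blast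
    then show False using top by simp
  qed
  then have "count M v < count N v" using \<open>v \<in> D\<close> by (simp add: D_def)
  then show "\<exists>v. count M v < count N v \<and> (\<forall>w>v. count M w = count N w)"
    using top by blast
next
  assume "\<exists>v. count M v < count N v \<and> (\<forall>w>v. count M w = count N w)"
  then obtain v where v: "count M v < count N v" "\<And>w. w > v \<Longrightarrow> count M w = count N w" by blast
  show "M < N"
    unfolding less_multiset\<^sub>H\<^sub>O
  proof (intro conjI allI impI)
    show "M \<noteq> N" using v(1) by auto
    fix y assume y: "count N y < count M y"
    have "y < v"
    proof (rule ccontr)
      assume "\<not> y < v"
      then have "y = v \<or> v < y" by (auto simp: le_less not_less)
      then show False using v y by auto
    qed
    then show "\<exists>x>y. count M x < count N x" using v(1) by blast
  qed
qed

definition drop_column :: "nat multiset \<Rightarrow> nat multiset" where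
  "drop_column A = filter_mset ((<) 0) (image_mset (\<lambda>x. x - 1) A)"

lemma count_drop_column: "count (drop_column A) w = (if w = 0 then 0 else count A (Suc w))"
  by (induction A) (auto simp: drop_column_def)

text \<open>
  Removing one unit from each part of \<open>A\<close>, and from equally many parts of a
  larger multiset, preserves the order. The top difference moves down by one unless an
  untouched part at least as large exists; then the largest untouched part becomes the top difference.
  The equality of sizes excludes that the difference disappears among parts of size one.
\<close>

lemma drop_column_less:
  assumes "A < B1 + B2" and size: "size B1 = size A" and pos: "0 \<notin># A" "0 \<notin># B1" "0 \<notin># B2"
  shows "drop_column A < drop_column B1 + B2"
proof -
  obtain v where v: "count A v < count (B1 + B2) v" "\<And>w. w > v \<Longrightarrow> count A w = count (B1 + B2) w"
    using assms(1) unfolding less_multiset_iff_top_difference by blast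
  have "v \<in># B1 + B2" using v(1) by (metis count_greater_zero_iff gr_zeroI not_less0)
  then have "v \<noteq> 0" using pos by (intro notI) simp
  show ?thesis
  proof (cases "\<exists>z\<in>#B2. z \<ge> v")
    case True
    define z where "z = Max (set_mset B2)"
    have "B2 \<noteq> {#}" using True by auto
    then have z: "z \<in># B2" "\<And>w. w > z \<Longrightarrow> count B2 w = 0"
      unfolding z_def by (auto simp: count_eq_zero_iff)
    have "z \<ge> v" using True unfolding z_def by (meson Max_ge finite_set_mset le_trans)
    then have "count A (Suc z) = count B1 (Suc z)" using v(2)[of "Suc z"] z(2)[of "Suc z"] by simp
    moreover have "count B2 z > 0" using z(1) by simp
    moreover have "count A (Suc w) = count B1 (Suc w) + count B2 w" if "w > z" for w
      using v(2)[of "Suc w"] z(2)[of "Suc w"] z(2)[of w] that \<open>z \<ge> v\<close> by simp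
    ultimately show ?thesis
      using \<open>z \<ge> v\<close> \<open>v \<noteq> 0\<close> unfolding less_multiset_iff_top_difference
      by (intro exI[of _ z]) (auto simp: count_drop_column)
  next
    case False
    then have B2: "count B2 w = 0" if "w \<ge> v" for w
      using that by (meson count_eq_zero_iff)
    have v1: "count A v < count B1 v" "\<And>w. w > v \<Longrightarrow> count A w = count B1 w"
      using v B2 by simp_all
    have "v \<noteq> 1"
    proof
      assume "v = 1"
      have "size A = (\<Sum>w\<in>set_mset A \<union> set_mset B1. count A w)" "size B1 = (\<Sum>w\<in>set_mset A \<union> set_mset B1. count B1 w)"
        unfolding size_multiset_overloaded_eq by (auto intro!: sum.mono_neutral_left simp: not_in_iff)
      moreover have "(\<Sum>w\<in>set_mset A \<union> set_mset B1. count A w) < (\<Sum>w\<in>set_mset A \<union> set_mset B1. count B1 w)"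
      proof (rule sum_strict_mono_ex1)
        show "\<forall>w\<in>set_mset A \<union> set_mset B1. count A w \<le> count B1 w"
        proof
          fix w assume "w \<in> set_mset A \<union> set_mset B1"
          then have "w \<noteq> 0" using pos by (intro notI) simp
          then show "count A w \<le> count B1 w"
            using v1 \<open>v = 1\<close> by (cases "w = 1") (auto intro: less_imp_le)
        qed
        show "\<exists>w\<in>set_mset A \<union> set_mset B1. count A w < count B1 w"
          using v1(1) by (intro bexI[of _ v]) (auto simp flip: count_greater_zero_iff)
      qed simp
      ultimately show False using size by simp
    qed
    with \<open>v \<noteq> 0\<close> obtain u where u: "v = Suc u" "u > 0" by (cases v) auto
    show ?thesis
      unfolding less_multiset_iff_top_difference
      using v1 u B2 by (intro exI[of _ u]) (auto simp: count_drop_column)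
  qed
qed

text \<open>
  The type with empty clusters ignored. They appear when a column is removed.
\<close>

definition ptype :: "nat \<Rightarrow> (nat \<Rightarrow> nat) \<Rightarrow> nat multiset" where
  "ptype n m = filter_mset ((<) 0) (image_mset m (mset_set {..<n}))"

lemma hits_inj: "inj_on \<pi> {..<R} \<Longrightarrow> hits R \<pi> P = of_bool (P \<in> \<pi> ` {..<R})"
proof (cases "P \<in> \<pi> ` {..<R}")
  case True
  assume inj: "inj_on \<pi> {..<R}"
  from True obtain q where q: "q < R" "P = \<pi> q" by auto
  then have "{q'. q' < R \<and> \<pi> q' = P} = {q}" using inj by (auto simp: inj_on_def)
  then show ?thesis using True by (simp add: hits_def)
next
  case False
  then have "{q'. q' < R \<and> \<pi> q' = P} = {}" by auto
  then show ?thesis using False by (simp add: hits_def)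
qed

lemma hit_sum_inj: "inj_on \<pi> {..<R} \<Longrightarrow> q < R \<Longrightarrow> hit_sum R \<kappa> \<pi> (\<pi> q) = \<kappa> q"
proof -
  assume inj: "inj_on \<pi> {..<R}" and q: "q < R"
  then have "{q'. q' < R \<and> \<pi> q' = \<pi> q} = {q}" by (auto simp: inj_on_def)
  then show ?thesis by (simp add: hit_sum_def)
qed

lemma hit_weight_pos: "hit_weight R m \<pi> \<noteq> 0 \<Longrightarrow> q < R \<Longrightarrow> m (\<pi> q) > 0"
proof -
  assume "hit_weight R m \<pi> \<noteq> 0" "q < R"
  then have "m (\<pi> q) - hits q \<pi> (\<pi> q) \<noteq> 0" by (auto simp: hit_weight_def)
  then show ?thesis by simp
qed

lemma ptype_hit_greater:
  assumes \<pi>: "\<pi> \<in> {..<R} \<rightarrow>\<^sub>E {..<n}" "inj_on \<pi> {..<R}" and w: "hit_weight R m \<pi> \<noteq> 0"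
    and A: "A < ptype n m" "size A = R" "0 \<notin># A"
  shows "drop_column A < ptype n (\<lambda>P. m P - hits R \<pi> P)"
proof -
  define S where "S = \<pi> ` {..<R}"
  define B1 where "B1 = image_mset m (mset_set S)"
  define B2 where "B2 = filter_mset ((<) 0) (image_mset m (mset_set ({..<n} - S)))"
  have S: "S \<subseteq> {..<n}" "card S = R" "finite S"
    using \<pi> by (auto simp: S_def card_image)
  have pos: "m P > 0" if "P \<in> S" for P
    using that hit_weight_pos[OF w] by (auto simp: S_def)
  have split: "mset_set {..<n} = mset_set S + mset_set ({..<n} - S)"
    using S by (subst mset_set_Union[symmetric]) (auto simp: Un_absorb1)
  have "filter_mset ((<) 0) (image_mset m (mset_set S)) = B1"
    unfolding B1_def using pos S(3)
    by (subst filter_mset_cong[OF refl, of _ _ "\<lambda>_. True"]) auto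
  then have "ptype n m = B1 + B2"
    by (simp add: ptype_def split B2_def)
  have "image_mset (\<lambda>P. m P - hits R \<pi> P) (mset_set S) = image_mset (\<lambda>x. x - 1) B1"
    unfolding B1_def image_mset.compositionality o_def
    using S(3) by (intro image_mset_cong) (auto simp: hits_inj[OF \<pi>(2)] simp flip: S_def)
  moreover have "image_mset (\<lambda>P. m P - hits R \<pi> P) (mset_set ({..<n} - S)) = image_mset m (mset_set ({..<n} - S))"
    by (intro image_mset_cong) (auto simp: hits_inj[OF \<pi>(2)] simp flip: S_def)
  ultimately have "ptype n (\<lambda>P. m P - hits R \<pi> P) = drop_column B1 + B2"
    by (simp add: ptype_def split B2_def drop_column_def)
  moreover have "drop_column A < drop_column B1 + B2"
  proof (rule drop_column_less)
    show "A < B1 + B2" using A(1) \<open>ptype n m = B1 + B2\<close> by simp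
    show "size B1 = size A" using A(2) S by (simp add: B1_def)
    show "0 \<notin># B1" using S(3) pos by (force simp: B1_def)
    show "0 \<notin># B2" by (simp add: B2_def)
  qed (rule A(3))
  ultimately show ?thesis by simp
qed

definition lexless :: "nat \<Rightarrow> (nat \<Rightarrow> int) \<Rightarrow> (nat \<Rightarrow> int) \<Rightarrow> bool" where
  "lexless r j' j \<longleftrightarrow> (\<exists>i<r. (\<forall>p<i. j' p = j p) \<and> j' i < j i)"

text \<open>
  A surviving term of the determinant: \<open>\<pi>\<close> says which cluster is hit by which derivative,
  \<open>\<tau>\<close> is the permutation of the determinant, and \<open>\<kappa>\<close> is the amount by which exponents
  drop. The drops are lexicographically smallest, with $\kappa_P = P + l_P$, exactly when both are
  the identity.
\<close>

locale column_data =
  fixes R :: nat and l \<pi> \<tau> :: "nat \<Rightarrow> nat" and \<kappa> :: "nat \<Rightarrow> nat"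
  assumes l: "\<And>p q. p < q \<Longrightarrow> q < R \<Longrightarrow> l p < l q"
    and inj: "inj_on \<pi> {..<R}" and ran: "\<pi> ` {..<R} = {..<R}"
    and \<tau>: "\<tau> permutes {..<R}"
    and \<kappa>: "\<And>q. q < R \<Longrightarrow> \<kappa> (\<pi> q) = q + l (\<tau> q)"
begin

lemma lower_bound:
  assumes "P < R" and id: "\<And>Q. Q < P \<Longrightarrow> \<pi> Q = Q \<and> \<tau> Q = Q"
  shows "P + l P \<le> \<kappa> P" "\<kappa> P = P + l P \<Longrightarrow> \<pi> P = P \<and> \<tau> P = P"
proof -
  obtain q where q: "q < R" "\<pi> q = P" using ran assms(1) by (metis imageE lessThan_iff)
  have "q \<ge> P" using id[of q] q by force
  have "\<tau> q \<ge> P"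
  proof (rule ccontr)
    assume "\<not> ?thesis"
    then have "\<tau> (\<tau> q) = \<tau> q" using id by simp
    then have "\<tau> q = q" using \<tau> by (metis permutes_inverses(2))
    then show False using \<open>q \<ge> P\<close> \<open>\<not> \<tau> q \<ge> P\<close> by simp
  qed
  have "\<tau> q < R" using permutes_in_image[OF \<tau>, of q] q(1) by simp
  then have le: "l P \<le> l (\<tau> q)" "\<tau> q \<noteq> P \<Longrightarrow> l P < l (\<tau> q)"
    using l[of P "\<tau> q"] \<open>\<tau> q \<ge> P\<close> by (cases "\<tau> q = P"; simp)+
  have k: "\<kappa> P = q + l (\<tau> q)" using \<kappa>[OF q(1)] q(2) by simp
  show "P + l P \<le> \<kappa> P" using k le(1) \<open>q \<ge> P\<close> by simp
  show "\<pi> P = P \<and> \<tau> P = P" if "\<kappa> P = P + l P"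
  proof -
    have "q = P" using that k le(1) \<open>q \<ge> P\<close> by simp
    moreover have "\<tau> q = P" using that k le \<open>q \<ge> P\<close> by fastforce
    ultimately show ?thesis using q(2) by simp
  qed
qed

lemma eq_imp_id:
  "N \<le> R \<Longrightarrow> (\<And>P. P < N \<Longrightarrow> \<kappa> P = P + l P) \<Longrightarrow> P < N \<Longrightarrow> \<pi> P = P \<and> \<tau> P = P"
proof (induction N arbitrary: P)
  case (Suc N)
  have IH: "\<pi> Q = Q \<and> \<tau> Q = Q" if "Q < N" for Q
    using Suc.IH[of Q] Suc.prems(1,2) that by simp
  show ?case
  proof (cases "P = N")
    case True
    show ?thesis
      unfolding True by (rule lower_bound(2)) (use Suc.prems(1,2) IH in auto)
  qed (use IH Suc.prems in auto)
qed simp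

lemma first_difference:
  assumes "P < R" "\<And>Q. Q < P \<Longrightarrow> \<kappa> Q = Q + l Q" "\<kappa> P \<noteq> P + l P"
  shows "\<kappa> P > P + l P"
  using lower_bound(1)[OF assms(1)] eq_imp_id[of P] assms by force

end

text \<open>
  Empty clusters are permitted, with exponent zero, to keep the number of clusters fixed while
  columns are removed.
\<close>

definition weakly_admissible :: "nat \<Rightarrow> (nat \<Rightarrow> nat) \<Rightarrow> (nat \<Rightarrow> int) \<Rightarrow> bool" where
  "weakly_admissible r m j \<longleftrightarrow>
     (\<forall>p<r. (m p = 0 \<longrightarrow> j p = 0) \<and> (m p \<ge> 1 \<longrightarrow> j p \<ge> 2 * int p * int (m p))) \<and>
     (\<forall>p. Suc p < r \<longrightarrow> m (Suc p) \<le> m p \<and>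
        (m (Suc p) = m p \<and> m p \<ge> 1 \<longrightarrow> j (Suc p) \<ge> j p + 2 * int (m p)))"

lemma weakly_descending:
  assumes "weakly_admissible r m j" "p \<le> q" "q < r"
  shows "m q \<le> m p"
  using assms(2,3)
proof (induction q rule: dec_induct)
  case (step q)
  then have "m (Suc q) \<le> m q" using assms(1) by (auto simp: weakly_admissible_def)
  then show ?case using step by simp
qed simp

lemma positive_prefix:
  fixes m :: "nat \<Rightarrow> nat"
  assumes "\<And>p q. p \<le> q \<Longrightarrow> q < r \<Longrightarrow> m q \<le> m p"
  shows "\<exists>R\<le>r. \<forall>p<r. m p > 0 \<longleftrightarrow> p < R"
  using assms
proof (induction r)
  case (Suc r)
  show ?case
  proof (cases "m r > 0")
    case True
    then have "m p > 0" if "p < Suc r" for p using Suc.prems[of p r] that by simp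
    then show ?thesis by (intro exI[of _ "Suc r"]) simp
  next
    case False
    obtain R where "R \<le> r" "\<forall>p<r. m p > 0 \<longleftrightarrow> p < R" using Suc.IH Suc.prems by force
    then show ?thesis using False by (intro exI[of _ R]) (auto simp: less_Suc_eq)
  qed
qed simp

lemma qmono_cong: "(\<And>p. p < r \<Longrightarrow> m p = m' p \<and> j p = j' p) \<Longrightarrow> qmono r m j = qmono r m' j'"
  by (simp add: qmono_def)

text \<open>
  The first column of the Young diagram has \<open>R\<close> boxes, one for each nonempty cluster. The
  exponents are split as $j = (j - t_2) + t_2$, where the part $t_2$ is removed by the determinant and the rest
  is left to the functional of the smaller diagram. A cluster of charge one loses its whole exponent; a larger
  one loses $2P$, the amount that its distance to the earlier clusters forces in a single column.
  The admissibility conditions make $l_P = t_2(P) - P$ strictly increasing, so the lowest term of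
  the determinant has coefficient one.
\<close>

lemma dual_functional_step:
  assumes wa: "weakly_admissible r m j" and R: "R \<le> r" "\<And>p. p < r \<Longrightarrow> m p > 0 \<longleftrightarrow> p < R"
    and t2_def: "t2 = (\<lambda>P. if P \<ge> R then 0 else if m P \<ge> 2 then 2 * int P else j P)"
    and f: "linear_functional f"
    and kill: "\<And>n m' j'. ptype r (\<lambda>p. m p - 1) < ptype n m' \<Longrightarrow> f (qmono n m' j') = 0"
    and nz: "f (qmono r (\<lambda>p. m p - 1) (\<lambda>p. j p - t2 p)) \<noteq> 0"
    and low: "\<And>j'. lexless r j' (\<lambda>p. j p - t2 p) \<Longrightarrow> f (qmono r (\<lambda>p. m p - 1) j') = 0"
  shows "\<exists>f. linear_functional f \<and> (\<forall>n m' j'. ptype r m < ptype n m' \<longrightarrow> f (qmono n m' j') = 0) \<and>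
    f (qmono r m j) \<noteq> 0 \<and> (\<forall>j'. lexless r j' j \<longrightarrow> f (qmono r m j') = 0)"
proof -
  define l where "l = (\<lambda>P. nat (t2 P) - P)"
  have jlow: "j p \<ge> 2 * int p * int (m p)" if "p < R" for p
    using wa R that unfolding weakly_admissible_def by (metis One_nat_def Suc_leI order_less_le_trans)
  have t2: "t2 P = int (P + l P)" if "P < R" for P
  proof (cases "m P \<ge> 2")
    case True
    then show ?thesis using that by (simp add: t2_def l_def)
  next
    case False
    then have "m P = 1" using R that by (metis One_nat_def Suc_1 Suc_leI le_antisym not_less_eq_eq order_less_le_trans)
    then show ?thesis using that jlow[OF that] by (simp add: t2_def l_def)
  qed
  have l_Suc: "l P < l (Suc P)" if "Suc P < R" for P
  proof -
    have "t2 (Suc P) \<ge> t2 P + 2"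
    proof (cases "m (Suc P) \<ge> 2")
      case True
      have "m (Suc P) \<le> m P" using weakly_descending[OF wa, of P "Suc P"] that R(1) by simp
      then show ?thesis using True that by (simp add: t2_def)
    next
      case False
      have "m (Suc P) > 0" using R that by (metis order_less_le_trans)
      with False have 1: "m (Suc P) = 1" by simp
      show ?thesis
      proof (cases "m P \<ge> 2")
        case True
        then show ?thesis using 1 that jlow[OF that] by (simp add: t2_def)
      next
        case False
        have "m P > 0" using R that by (metis Suc_lessD order_less_le_trans)
        with False have "m P = 1" by simp
        then show ?thesis using 1 that wa R(1) unfolding weakly_admissible_def t2_def
          by (auto dest!: spec[of _ P])
      qed
    qed
    then show ?thesis using t2[of P] t2[of "Suc P"] that by simp
  qed
  have l: "l p < l q" if "p < q" "q < R" for p q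
    using that
  proof (induction q)
    case (Suc q)
    then show ?case using l_Suc[of q] by (cases "p = q") auto
  qed simp
  define F where "F = det_functional R l f"
  define E where "E = (\<lambda>n m' j' \<pi> \<tau>. f (qmono n (\<lambda>P. m' P - hits R \<pi> P) (\<lambda>P. j' P - int (col_shift R l \<tau> \<pi> P))))"
  define PP where "PP = (\<lambda>n :: nat. {\<pi>. \<pi> \<in> {..<R} \<rightarrow>\<^sub>E {..<n} \<and> inj_on \<pi> {..<R}})"
  have F: "F (qmono n m' j') = (\<Sum>\<pi>\<in>PP n. of_nat (hit_weight R m' \<pi>) *
      (\<Sum>\<tau> | \<tau> permutes {..<R}. of_int (sign \<tau>) * E n m' j' \<pi> \<tau>))" for n m' j'
    unfolding F_def E_def PP_def by (rule det_functional_qmono[OF f])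
  have type_m: "drop_column (ptype r m) = ptype r (\<lambda>p. m p - 1)"
    by (simp add: drop_column_def ptype_def filter_mset_image_mset image_mset.compositionality o_def filter_filter_mset)
      (intro arg_cong[where f = "image_mset _"] filter_mset_cong refl, auto)
  have size_m: "size (ptype r m) = R"
  proof -
    have "{p. p < r \<and> 0 < m p} = {..<R}" using R by auto
    then show ?thesis by (simp add: ptype_def filter_mset_image_mset)
  qed
  have F_kill: "F (qmono n m' j') = 0" if "ptype r m < ptype n m'" for n m' j'
    unfolding F
  proof (intro sum.neutral ballI)
    fix \<pi> assume \<pi>: "\<pi> \<in> PP n"
    show "of_nat (hit_weight R m' \<pi>) * (\<Sum>\<tau> | \<tau> permutes {..<R}. of_int (sign \<tau>) * E n m' j' \<pi> \<tau>) = 0"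
    proof (cases "hit_weight R m' \<pi> = 0")
      case False
      have "drop_column (ptype r m) < ptype n (\<lambda>P. m' P - hits R \<pi> P)"
      proof (rule ptype_hit_greater)
        show "\<pi> \<in> {..<R} \<rightarrow>\<^sub>E {..<n}" "inj_on \<pi> {..<R}" using \<pi> by (simp_all add: PP_def)
        show "0 \<notin># ptype r m" by (simp add: ptype_def)
      qed (fact that size_m False)+
      then have "E n m' j' \<pi> \<tau> = 0" for \<tau>
        unfolding E_def type_m by (rule kill)
      then show ?thesis by simp
    qed simp
  qed
  have col: "\<pi> ` {..<R} = {..<R}" if "\<pi> \<in> PP r" "hit_weight R m \<pi> \<noteq> 0" for \<pi>
  proof (rule card_subset_eq)
    show "\<pi> ` {..<R} \<subseteq> {..<R}"
      using that hit_weight_pos[OF that(2)] R by (auto simp: PP_def)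
    show "card (\<pi> ` {..<R}) = card {..<R}"
      using that by (simp add: PP_def card_image)
  qed simp
  have E_r: "E r m j' \<pi> \<tau> = f (qmono r (\<lambda>p. m p - 1) (\<lambda>P. j' P - int (col_shift R l \<tau> \<pi> P)))"
    if "\<pi> \<in> PP r" "hit_weight R m \<pi> \<noteq> 0" for \<pi> \<tau> j'
  proof -
    have "m P - hits R \<pi> P = m P - 1" if "P < r" for P
      using R(2)[OF that] hits_inj[of \<pi> R P] \<open>\<pi> \<in> PP r\<close> col[OF \<open>\<pi> \<in> PP r\<close> \<open>hit_weight R m \<pi> \<noteq> 0\<close>]
      by (cases "P < R") (auto simp: PP_def)
    then show ?thesis
      unfolding E_def by (intro arg_cong[where f = f] qmono_cong) simp
  qed
  have outside: "hit_sum R \<kappa> \<pi> P = 0" if "\<pi> ` {..<R} = {..<R}" "P \<ge> R" for \<kappa> \<pi> P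
  proof -
    have "{q. q < R \<and> \<pi> q = P} = {}"
    proof (intro equals0I)
      fix q assume "q \<in> {q. q < R \<and> \<pi> q = P}"
      then have "P \<in> \<pi> ` {..<R}" by blast
      then show False using that by simp
    qed
    then show ?thesis by (simp only: hit_sum_def sum.empty)
  qed
  \<comment> \<open>Away from the identity, the first cluster that does not drop by $t_2$ drops by more.\<close>
  have diff: "\<exists>P<R. (\<forall>Q<P. int (col_shift R l \<tau> \<pi> Q) = t2 Q) \<and>
      int (col_shift R l \<tau> \<pi> P) > t2 P"
    if "\<pi> \<in> PP r" "hit_weight R m \<pi> \<noteq> 0" "\<tau> permutes {..<R}"
      "P < R" "int (col_shift R l \<tau> \<pi> P) \<noteq> t2 P" for \<pi> \<tau> P
  proof -
    interpret column_data R l \<pi> \<tau> "col_shift R l \<tau> \<pi>"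
      using that col l by unfold_locales (auto simp: PP_def hit_sum_inj)
    define P0 where "P0 = (LEAST P. P < R \<and> int (col_shift R l \<tau> \<pi> P) \<noteq> t2 P)"
    have P0: "P0 < R \<and> int (col_shift R l \<tau> \<pi> P0) \<noteq> t2 P0"
      unfolding P0_def by (rule LeastI[of _ P]) (use that in simp)
    have min: "int (col_shift R l \<tau> \<pi> Q) = t2 Q" if "Q < P0" for Q
      using not_less_Least[OF that[unfolded P0_def]] that P0 by auto
    have "col_shift R l \<tau> \<pi> P0 > P0 + l P0"
    proof (rule first_difference)
      show "P0 < R" using P0 by (rule conjunct1)
      fix Q assume Q: "Q < P0"
      then have "Q < R" using P0 by simp
      have "int (col_shift R l \<tau> \<pi> Q) = int (Q + l Q)"
        using min[OF Q] t2[OF \<open>Q < R\<close>] by (rule trans)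
      then show "col_shift R l \<tau> \<pi> Q = Q + l Q" by (simp only: of_nat_eq_iff)
    next
      show "col_shift R l \<tau> \<pi> P0 \<noteq> P0 + l P0"
        using P0 t2[of P0] by auto
    qed
    then show ?thesis using P0 min t2 by (intro exI[of _ P0]) auto
  qed
  have F_low: "F (qmono r m j') = 0" if lx: "lexless r j' j" for j'
    unfolding F
  proof (intro sum.neutral ballI)
    fix \<pi> assume \<pi>: "\<pi> \<in> PP r"
    show "of_nat (hit_weight R m \<pi>) * (\<Sum>\<tau> | \<tau> permutes {..<R}. of_int (sign \<tau>) * E r m j' \<pi> \<tau>) = 0"
    proof (cases "hit_weight R m \<pi> = 0")
      case False
      have "E r m j' \<pi> \<tau> = 0" if \<tau>: "\<tau> permutes {..<R}" for \<tau>
        unfolding E_r[OF \<pi> False]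
      proof (rule low)
        define k where "k = (\<lambda>P. int (col_shift R l \<tau> \<pi> P))"
        obtain i where i: "i < r" "\<forall>p<i. j' p = j p" "j' i < j i"
          using lx by (auto simp: lexless_def)
        have out: "k P = t2 P" if "P \<ge> R" for P
          using outside[OF col[OF \<pi> False] that] that by (simp add: k_def t2_def)
        have "lexless r (\<lambda>P. j' P - k P) (\<lambda>p. j p - t2 p)"
        proof (cases "\<exists>P\<le>i. k P \<noteq> t2 P")
          case True
          then obtain P where P: "P \<le> i" "k P \<noteq> t2 P" by blast
          then have "P < R" using out by (meson not_le)
          obtain Q where Q: "Q < R" "\<forall>Q'<Q. k Q' = t2 Q'" "k Q > t2 Q"
            using diff[OF \<pi> False \<tau> \<open>P < R\<close>] P(2) unfolding k_def by blast
          have "Q \<le> P" using Q(2) P(2) by (meson not_le)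
          then have "Q \<le> i" using P(1) by simp
          then have "j' Q \<le> j Q" using i by (cases "Q = i") auto
          then show ?thesis
            unfolding lexless_def using Q R(1) i(2) \<open>Q \<le> i\<close> by (intro exI[of _ Q]) auto
        next
          case False
          then show ?thesis
            unfolding lexless_def using i by (intro exI[of _ i]) auto
        qed
        then show "lexless r (\<lambda>P. j' P - int (col_shift R l \<tau> \<pi> P)) (\<lambda>p. j p - t2 p)"
          by (simp only: k_def)
      qed
      then show ?thesis by simp
    qed simp
  qed
  have F_nz: "F (qmono r m j) \<noteq> 0"
  proof -
    define i0 where "i0 = restrict id {..<R}"
    have i0: "i0 \<in> PP r" using R(1) by (auto simp: i0_def PP_def inj_on_def)
    have hs0: "col_shift R l id i0 P = P + l P" if "P < R" for P
      using hit_sum_inj[of i0 R P "\<lambda>q. q + l (id q)"] i0 that by (simp add: PP_def) (simp add: i0_def)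
    have w0: "hit_weight R m i0 \<noteq> 0"
    proof -
      have "hits q i0 (i0 q) = 0" if "q < R" for q
      proof -
        have "{q'. q' < q \<and> i0 q' = i0 q} = {}" using that by (auto simp: i0_def)
        then show ?thesis by (simp only: hits_def card.empty)
      qed
      then show ?thesis using R by (auto simp: hit_weight_def i0_def)
    qed
    have vanish: "E r m j \<pi> \<tau> = 0"
      if \<pi>: "\<pi> \<in> PP r" "hit_weight R m \<pi> \<noteq> 0" and \<tau>: "\<tau> permutes {..<R}" and ne: "\<pi> \<noteq> i0 \<or> \<tau> \<noteq> id" for \<pi> \<tau>
      unfolding E_r[OF \<pi>]
    proof (rule low)
      interpret column_data R l \<pi> \<tau> "col_shift R l \<tau> \<pi>"
        using that col l by unfold_locales (auto simp: PP_def hit_sum_inj)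
      have "\<exists>P<R. int (col_shift R l \<tau> \<pi> P) \<noteq> t2 P"
      proof (rule ccontr)
        assume "\<not> ?thesis"
        then have "col_shift R l \<tau> \<pi> P = P + l P" if "P < R" for P
          using t2 that by (metis of_nat_eq_iff)
        then have id: "\<pi> P = P \<and> \<tau> P = P" if "P < R" for P
          using eq_imp_id[of R P] that by blast
        have "\<tau> P = P" for P
          using id[of P] permutes_not_in[OF \<tau>, of P] by (cases "P < R") auto
        moreover have "\<pi> P = i0 P" for P
          using id[of P] \<pi>(1) by (cases "P < R") (auto simp: i0_def PP_def PiE_def extensional_def)
        ultimately show False using ne by auto
      qed
      then obtain Q where Q: "Q < R" "\<forall>Q'<Q. int (col_shift R l \<tau> \<pi> Q') = t2 Q'"
          "int (col_shift R l \<tau> \<pi> Q) > t2 Q"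
        using diff[OF \<pi> \<tau>] by blast
      then show "lexless r (\<lambda>P. j P - int (col_shift R l \<tau> \<pi> P)) (\<lambda>p. j p - t2 p)"
        unfolding lexless_def using R(1) by (intro exI[of _ Q]) auto
    qed
    have fin: "finite (PP r)"
      unfolding PP_def by (rule finite_subset[of _ "{..<R} \<rightarrow>\<^sub>E {..<r}"]) (auto intro: finite_PiE)
    have fin_perm: "finite {\<tau>. \<tau> permutes {..<R}}" by (simp add: finite_permutations)
    have id_perm: "id \<in> {\<tau>. \<tau> permutes {..<R}}" by (simp add: permutes_id)
    have "F (qmono r m j) = of_nat (hit_weight R m i0) *
      (\<Sum>\<tau> | \<tau> permutes {..<R}. of_int (sign \<tau>) * E r m j i0 \<tau>)"
    proof -
      have "(\<Sum>\<pi>\<in>PP r - {i0}. of_nat (hit_weight R m \<pi>) *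
          (\<Sum>\<tau> | \<tau> permutes {..<R}. of_int (sign \<tau>) * E r m j \<pi> \<tau>)) = 0"
      proof (rule sum.neutral, rule ballI)
        fix \<pi> assume "\<pi> \<in> PP r - {i0}"
        then show "of_nat (hit_weight R m \<pi>) *
          (\<Sum>\<tau> | \<tau> permutes {..<R}. of_int (sign \<tau>) * E r m j \<pi> \<tau>) = 0"
          using vanish[of \<pi>] by (cases "hit_weight R m \<pi> = 0") (auto intro!: sum.neutral)
      qed
      then show ?thesis unfolding F
        by (subst sum.remove[OF fin i0]) simp
    qed
    also have "(\<Sum>\<tau> | \<tau> permutes {..<R}. of_int (sign \<tau>) * E r m j i0 \<tau>) = E r m j i0 id"
    proof -
      have "(\<Sum>\<tau>\<in>{\<tau>. \<tau> permutes {..<R}} - {id}. of_int (sign \<tau>) * E r m j i0 \<tau>) = 0"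
        using vanish[OF i0 w0] by (intro sum.neutral) auto
      then show ?thesis
        by (subst sum.remove[OF fin_perm id_perm]) simp
    qed
    also have "E r m j i0 id = f (qmono r (\<lambda>p. m p - 1) (\<lambda>p. j p - t2 p))"
      unfolding E_r[OF i0 w0]
    proof (intro arg_cong[where f = f] qmono_cong conjI refl)
      fix P assume "P < r"
      show "j P - int (col_shift R l id i0 P) = j P - t2 P"
      proof (cases "P < R")
        case True
        show ?thesis unfolding hs0[OF True] t2[OF True] ..
      next
        case False
        then have "P \<ge> R" by simp
        then show ?thesis using outside[OF col[OF i0 w0] \<open>P \<ge> R\<close>, of "\<lambda>q. q + l (id q)"]
          by (simp add: t2_def)
      qed
    qed
    finally show ?thesis using w0 nz by simp
  qed
  show ?thesis
    using linear_functional_det_functional[OF f, of R l] F_kill F_nz F_low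
    unfolding F_def by blast
qed

text \<open>
  Induction on the number of boxes of the Young diagram, one column at a time. For
  the empty diagram the functional is the constant term.
\<close>

lemma exists_dual_functional:
  assumes "weakly_admissible r m j"
  shows "\<exists>f. linear_functional f \<and> (\<forall>n m' j'. ptype r m < ptype n m' \<longrightarrow> f (qmono n m' j') = 0) \<and>
    f (qmono r m j) \<noteq> 0 \<and> (\<forall>j'. lexless r j' j \<longrightarrow> f (qmono r m j') = 0)"
  using assms
proof (induction "\<Sum>p<r. m p" arbitrary: m j rule: less_induct)
  case less
  obtain R where R: "R \<le> r" "\<And>p. p < r \<Longrightarrow> m p > 0 \<longleftrightarrow> p < R"
    using positive_prefix[of r m] weakly_descending[OF less.prems] by blast
  show ?case
  proof (cases "R = 0")
    case True
    then have m0: "m p = 0" if "p < r" for p using R(2)[OF that] by simp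
    define f where "f = functional (\<lambda>M. of_bool (M = {#}))"
    have "f (qmono r m j) = 1"
    proof -
      have "qmono r m j = (\<Prod>p<r. 1)"
        unfolding qmono_def using m0 less.prems
        by (intro prod.cong) (auto simp: weakly_admissible_def qcoeff_def)
      then show ?thesis
        using functional_single[of "\<lambda>M. of_bool (M = {#})" 0 1] by (simp add: f_def)
    qed
    moreover have "f (qmono r m j') = 0" if lx: "lexless r j' j" for j'
    proof -
      obtain i where i: "i < r" "j' i < j i" using lx by (auto simp: lexless_def)
      then have "j' i < 0" using m0[OF i(1)] less.prems by (auto simp: weakly_admissible_def)
      then have "qmono r m j' = 0" using i(1) by (auto simp: qmono_def qcoeff_def intro!: prod_zero)
      then show ?thesis by (simp add: f_def)
    qed
    moreover have "f (qmono n m' j') = 0" if "ptype r m < ptype n m'" for n m' j'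
    proof -
      have "ptype n m' \<noteq> {#}"
      proof
        assume "ptype n m' = {#}"
        with that show False by simp
      qed
      then obtain x where "x \<in># ptype n m'" by (rule multiset_nonemptyE)
      then have "\<exists>p<n. m' p > 0" unfolding ptype_def by auto
      then obtain p where p: "p < n" "m' p > 0" by blast
      have "\<forall>M\<in>keys (qmono n m' j'). M \<noteq> {#}"
      proof
        fix M assume "M \<in> keys (qmono n m' j')"
        then have "size M = (\<Sum>p<n. m' p)" by (rule keys_qmono)
        moreover have "m' p \<le> (\<Sum>p<n. m' p)" using p(1) by (intro member_le_sum) auto
        ultimately have "size M > 0" using p(2) by linarith
        then show "M \<noteq> {#}" by (simp only: nonempty_has_size)
      qed
      then show ?thesis
        unfolding f_def functional_def pm_sum_def by (intro sum.neutral ballI) simp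
    qed
    moreover have "linear_functional f"
      unfolding f_def by (rule linear_functional_functional)
    ultimately have "linear_functional f \<and> (\<forall>n m' j'. ptype r m < ptype n m' \<longrightarrow> f (qmono n m' j') = 0) \<and>
      f (qmono r m j) \<noteq> 0 \<and> (\<forall>j'. lexless r j' j \<longrightarrow> f (qmono r m j') = 0)"
      by (metis zero_neq_one)
    then show ?thesis by (rule exI[where x = f])
  next
    case False
    define t2 where "t2 = (\<lambda>P. if P \<ge> R then 0 else if m P \<ge> 2 then 2 * int P else j P)"
    have wa: "weakly_admissible r (\<lambda>p. m p - 1) (\<lambda>p. j p - t2 p)"
      unfolding weakly_admissible_def
    proof (intro conjI allI impI)
      fix p assume p: "p < r"
      show "j p - t2 p = 0" if "m p - 1 = 0"
        using that R(2)[OF p] p less.prems by (auto simp: t2_def weakly_admissible_def)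
      show "j p - t2 p \<ge> 2 * int p * int (m p - 1)" if "1 \<le> m p - 1"
      proof -
        have "int (m p - 1) = int (m p) - 1" using that by simp
        moreover have "t2 p = 2 * int p" using that R(2)[OF p] by (auto simp: t2_def)
        moreover have "j p \<ge> 2 * int p * int (m p)"
          using that less.prems p by (auto simp: weakly_admissible_def)
        ultimately show ?thesis by (simp add: algebra_simps)
      qed
    next
      fix p assume p: "Suc p < r"
      have le: "m (Suc p) \<le> m p" using less.prems p by (auto simp: weakly_admissible_def)
      then show "m (Suc p) - 1 \<le> m p - 1" by simp
      assume "m (Suc p) - 1 = m p - 1 \<and> 1 \<le> m p - 1"
      then have eq: "m (Suc p) = m p" "m p \<ge> 2" by auto
      then have "t2 p = 2 * int p" "t2 (Suc p) = 2 * int p + 2"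
        using R(2)[of p] R(2)[of "Suc p"] p by (auto simp: t2_def)
      moreover have "j (Suc p) \<ge> j p + 2 * int (m p)"
        using less.prems p eq by (auto simp: weakly_admissible_def)
      moreover have "int (m p - 1) = int (m p) - 1" using eq by simp
      ultimately show "j p - t2 p + 2 * int (m p - 1) \<le> j (Suc p) - t2 (Suc p)"
        by simp
    qed
    have "(\<Sum>p<r. m p - 1) < (\<Sum>p<r. m p)"
    proof (rule sum_strict_mono_ex1)
      show "\<exists>p\<in>{..<r}. m p - 1 < m p"
        using False R by (intro bexI[of _ 0]) auto
    qed auto
    from less.hyps[OF this wa] obtain f where f: "linear_functional f \<and>
      (\<forall>n m' j'. ptype r (\<lambda>p. m p - 1) < ptype n m' \<longrightarrow> f (qmono n m' j') = 0) \<and>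
      f (qmono r (\<lambda>p. m p - 1) (\<lambda>p. j p - t2 p)) \<noteq> 0 \<and>
      (\<forall>j'. lexless r j' (\<lambda>p. j p - t2 p) \<longrightarrow> f (qmono r (\<lambda>p. m p - 1) j') = 0)"
      by (rule exE)
    show ?thesis
      by (rule dual_functional_step[OF less.prems R t2_def, where f = f]) (use f in simp_all)
  qed
qed

lemma lexless_total:
  assumes "\<not> (\<forall>p<r. j p = j' p)"
  shows "lexless r j j' \<or> lexless r j' j"
proof -
  define i where "i = (LEAST p. p < r \<and> j p \<noteq> j' p)"
  obtain p where "p < r \<and> j p \<noteq> j' p" using assms by blast
  then have i: "i < r \<and> j i \<noteq> j' i" unfolding i_def by (rule LeastI)
  have "j q = j' q" if "q < i" for q
    using not_less_Least[OF that[unfolded i_def]] that i by auto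
  then show ?thesis
    using i unfolding lexless_def by (metis linorder_neqE)
qed

lemma lexless_trans:
  assumes "lexless r j j'" "lexless r j' j''"
  shows "lexless r j j''"
proof -
  obtain i where i: "i < r" "\<And>p. p < i \<Longrightarrow> j p = j' p" "j i < j' i"
    using assms(1) by (auto simp: lexless_def)
  obtain k where k: "k < r" "\<And>p. p < k \<Longrightarrow> j' p = j'' p" "j' k < j'' k"
    using assms(2) by (auto simp: lexless_def)
  show ?thesis
    unfolding lexless_def
    using i k by (intro exI[of _ "min i k"]) (cases i k rule: linorder_cases; auto simp: min_def)
qed

lemma lexless_irrefl: "\<not> lexless r j j"
  by (auto simp: lexless_def)

lemma ptype_admissible: "admissible r m j \<Longrightarrow> ptype r m = image_mset m (mset_set {..<r})"
  unfolding ptype_def by (rule filter_mset_cong[of _ _ _ "\<lambda>_. True", THEN trans, OF refl]) (auto simp: admissible_def)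

lemma admissible_imp_weakly: "admissible r m j \<Longrightarrow> weakly_admissible r m j"
  by (auto simp: admissible_def weakly_admissible_def)

lemma admissible_type_eq:
  assumes "admissible r m j" "admissible r' m' j'" "ptype r m = ptype r' m'"
  shows "r = r'" "p < r \<Longrightarrow> m p = m' p"
proof -
  have eq: "image_mset m (mset_set {..<r}) = image_mset m' (mset_set {..<r'})"
    using assms by (simp add: ptype_admissible)
  from arg_cong[OF this, of size] show r: "r = r'" by simp
  have "sorted (rev (map m [0..<r]))" if "admissible r m j" for m j
    unfolding sorted_rev_iff_nth_mono
    using weakly_descending[OF admissible_imp_weakly[OF that]] by simp
  then have "sorted (rev (map m [0..<r]))" "sorted (rev (map m' [0..<r]))"
    using assms r by blast+
  moreover have "mset (rev (map m [0..<r])) = mset (rev (map m' [0..<r]))"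
    using eq r by (simp add: atLeast0LessThan)
  ultimately have "rev (map m [0..<r]) = rev (map m' [0..<r])"
    by (metis properties_for_sort)
  then have "map m [0..<r] = map m' [0..<r]" by simp
  then show "m p = m' p" if "p < r" using that by (simp add: map_eq_conv)
qed

text \<open>
  In a linear relation take the smallest type that occurs and, within it, lexicographically
  highest exponents. The dual functional of this monomial kills all other terms of the relation.
\<close>

theorem admissible_independent:
  assumes fin: "finite I" and adm: "\<And>i. i \<in> I \<Longrightarrow> admissible (r i) (m i) (j i)"
    and distinct: "\<And>i i'. i \<in> I \<Longrightarrow> i' \<in> I \<Longrightarrow> r i = r i' \<Longrightarrow>
        (\<And>p. p < r i \<Longrightarrow> m i p = m i' p \<and> j i p = j i' p) \<Longrightarrow> i = i'"
    and zero: "\<And>c. (\<Sum>i\<in>I. a i * functional c (qmono (r i) (m i) (j i))) = 0"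
  shows "i \<in> I \<Longrightarrow> a i = 0"
proof (rule ccontr)
  assume "i \<in> I" "a i \<noteq> 0"
  define T where "T = (\<lambda>i. ptype (r i) (m i))"
  define I0 where "I0 = {i\<in>I. a i \<noteq> 0}"
  define v where "v = Min (T ` I0)"
  define I1 where "I1 = {i\<in>I0. T i = v}"
  have I0: "finite I0" "I0 \<noteq> {}" using fin \<open>i \<in> I\<close> \<open>a i \<noteq> 0\<close> by (auto simp: I0_def)
  have "v \<in> T ` I0" unfolding v_def using I0 by (intro Min_in) auto
  then have I1: "finite I1" "I1 \<noteq> {}" using I0 by (auto simp: I1_def)
  have r_eq: "r k = r k'" and m_eq: "\<And>p. p < r k \<Longrightarrow> m k p = m k' p" if "k \<in> I1" "k' \<in> I1" for k k'
    using admissible_type_eq[OF adm adm, of k k'] that by (auto simp: I1_def I0_def T_def)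
  have "\<exists>k\<in>I1. \<forall>x\<in>I1. x \<noteq> k \<longrightarrow> \<not> lexless (r k) (j k) (j x)"
  proof -
    define L where "L = (\<lambda>k x. lexless (r k) (j k) (j x))"
    have "\<exists>k\<in>I1. \<forall>x\<in>I1. x \<noteq> k \<longrightarrow> \<not> L k x"
    proof (rule Finite_Set.bex_max_element[OF I1(1)])
      show "asymp_on I1 L"
        unfolding asymp_on_def L_def using r_eq lexless_trans lexless_irrefl by metis
      show "transp_on I1 L"
        unfolding transp_on_def L_def using r_eq lexless_trans by metis
    qed (rule I1(2))
    then show ?thesis by (simp only: L_def)
  qed
  then obtain k where k: "k \<in> I1" "\<And>x. x \<in> I1 \<Longrightarrow> x \<noteq> k \<Longrightarrow> \<not> lexless (r k) (j k) (j x)" by blast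
  then have kI: "k \<in> I" "a k \<noteq> 0" "T k = v" by (auto simp: I1_def I0_def)
  obtain f where F: "linear_functional f \<and>
    (\<forall>n m' j'. ptype (r k) (m k) < ptype n m' \<longrightarrow> f (qmono n m' j') = 0) \<and>
    f (qmono (r k) (m k) (j k)) \<noteq> 0 \<and>
    (\<forall>j'. lexless (r k) j' (j k) \<longrightarrow> f (qmono (r k) (m k) j') = 0)"
    using exists_dual_functional[OF admissible_imp_weakly[OF adm[OF kI(1)]]] by (rule exE)
  then have f: "linear_functional f"
    "\<And>n m' j'. ptype (r k) (m k) < ptype n m' \<Longrightarrow> f (qmono n m' j') = 0"
    "f (qmono (r k) (m k) (j k)) \<noteq> 0"
    "\<And>j'. lexless (r k) j' (j k) \<Longrightarrow> f (qmono (r k) (m k) j') = 0"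
    by simp_all
  have "a x * f (qmono (r x) (m x) (j x)) = 0" if x: "x \<in> I" "x \<noteq> k" for x
  proof (cases "x \<in> I0")
    case True
    then have "v \<le> T x" unfolding v_def using I0 by simp
    show ?thesis
    proof (cases "x \<in> I1")
      case False
      then have "v < T x" using True \<open>v \<le> T x\<close> by (simp add: I1_def less_le eq_commute)
      then have "f (qmono (r x) (m x) (j x)) = 0"
        using kI(3) by (intro f(2)) (simp add: T_def)
      then show ?thesis by simp
    next
      case True
      have "\<not> (\<forall>p<r k. j k p = j x p)"
        using distinct[OF kI(1) x(1)] r_eq[OF k(1) True] m_eq[OF k(1) True] x(2) by metis
      then have "lexless (r k) (j x) (j k)"
        using lexless_total[of "r k" "j k" "j x"] k(2)[OF True x(2)] by blast
      then have "f (qmono (r k) (m k) (j x)) = 0" by (rule f(4))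
      moreover have "qmono (r x) (m x) (j x) = qmono (r k) (m k) (j x)"
        unfolding r_eq[OF k(1) True, symmetric]
        by (rule qmono_cong) (simp add: m_eq[OF k(1) True])
      ultimately show ?thesis by simp
    qed
  qed (use x in \<open>simp add: I0_def\<close>)
  then have "(\<Sum>i\<in>I - {k}. a i * f (qmono (r i) (m i) (j i))) = 0"
    by (intro sum.neutral) blast
  then have "(\<Sum>i\<in>I. a i * f (qmono (r i) (m i) (j i))) = a k * f (qmono (r k) (m k) (j k))"
    by (subst sum.remove[OF fin kI(1)]) simp
  moreover have "(\<Sum>i\<in>I. a i * f (qmono (r i) (m i) (j i))) = 0"
    by (subst linear_functional_eq_functional[OF f(1)]) (rule zero)
  ultimately show False using kI(2) f(3) by simp
qed

section \<open>Operators on functions of several discrete variables\<close>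

text \<open>
  The representations of the dual Yangian live on all complex functions of $\alpha_0, \alpha_1, \ldots$,
  where each $\alpha_k$ is a natural number.
\<close>

typedef endo = "{f :: ((nat \<Rightarrow> nat) \<Rightarrow> complex) \<Rightarrow> ((nat \<Rightarrow> nat) \<Rightarrow> complex).
    (\<forall>F G. f (\<lambda>\<alpha>. F \<alpha> + G \<alpha>) = (\<lambda>\<alpha>. f F \<alpha> + f G \<alpha>)) \<and>
    (\<forall>c F. f (\<lambda>\<alpha>. c * F \<alpha>) = (\<lambda>\<alpha>. c * f F \<alpha>))}"
  morphisms app Endo
  by (intro exI[of _ "\<lambda>F. F"]) simp

setup_lifting type_definition_endo

lemma endo_eqI: "(\<And>F \<alpha>. app A F \<alpha> = app B F \<alpha>) \<Longrightarrow> A = B"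
  by (simp add: app_inject[symmetric] fun_eq_iff)

lemma app_add: "app A (\<lambda>\<alpha>. F \<alpha> + G \<alpha>) = (\<lambda>\<alpha>. app A F \<alpha> + app A G \<alpha>)"
  and app_scale: "app A (\<lambda>\<alpha>. c * F \<alpha>) = (\<lambda>\<alpha>. c * app A F \<alpha>)"
  using app[of A] by auto

instantiation endo :: ring_1
begin

lift_definition zero_endo :: endo is "\<lambda>F \<alpha>. 0" by simp
lift_definition one_endo :: endo is "\<lambda>F. F" by simp
lift_definition plus_endo :: "endo \<Rightarrow> endo \<Rightarrow> endo" is "\<lambda>f g F \<alpha>. f F \<alpha> + g F \<alpha>"
  by (simp add: algebra_simps)
lift_definition minus_endo :: "endo \<Rightarrow> endo \<Rightarrow> endo" is "\<lambda>f g F \<alpha>. f F \<alpha> - g F \<alpha>"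
  by (simp add: algebra_simps)
lift_definition uminus_endo :: "endo \<Rightarrow> endo" is "\<lambda>f F \<alpha>. - f F \<alpha>"
  by simp
lift_definition times_endo :: "endo \<Rightarrow> endo \<Rightarrow> endo" is "\<lambda>f g F. f (g F)"
  by simp

lemma app_simps [simp]:
  "app 0 F = (\<lambda>\<alpha>. 0)" "app 1 F = F" "app (A + B) F = (\<lambda>\<alpha>. app A F \<alpha> + app B F \<alpha>)"
  "app (A - B) F = (\<lambda>\<alpha>. app A F \<alpha> - app B F \<alpha>)" "app (- A) F = (\<lambda>\<alpha>. - app A F \<alpha>)"
  "app (A * B) F = app A (app B F)"
  by (transfer, simp)+

instance
proof
  have "app 0 (\<lambda>\<alpha>. 1) (\<lambda>k. 0) \<noteq> app 1 (\<lambda>\<alpha>. 1) (\<lambda>k. 0)" by simp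
  then show "(0 :: endo) \<noteq> 1" by metis
qed (intro endo_eqI; simp add: app_add algebra_simps)+

end

lift_definition scal :: "complex \<Rightarrow> endo" is "\<lambda>c F \<alpha>. c * F \<alpha>"
  by (simp add: algebra_simps)

lemma app_scal [simp]: "app (scal c) F = (\<lambda>\<alpha>. c * F \<alpha>)"
  by transfer simp

lemma scal_commute: "scal c * A = A * scal c"
  by (intro endo_eqI) (simp add: app_scale)

lemma app_of_nat [simp]: "app (of_nat n) F = (\<lambda>\<alpha>. of_nat n * F \<alpha>)"
  by (induction n) (simp_all add: algebra_simps)

lemma app_sum: "app (\<Sum>i\<in>A. f i) F \<alpha> = (\<Sum>i\<in>A. app (f i) F \<alpha>)"
  by (induction A rule: infinite_finite_induct) simp_all

section \<open>Power series with noncommuting coefficients\<close>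

lemma fps_X_central: "fps_X * (x :: 'a::ring_1 fps) = x * fps_X"
  by (rule fps_mult_fps_X_commute)

text \<open>
  Identities of series are often proved here by writing both sides as head plus $X$ times the same expression at
  the tail. The difference is then divisible by every power of $X$.
\<close>

lemma fps_X_descent:
  fixes d :: "'b \<Rightarrow> 'a::ring_1 fps"
  assumes "\<And>x. d x = fps_X * d (t x)"
  shows "d x = 0"
proof (rule fps_ext)
  fix n
  show "fps_nth (d x) n = fps_nth 0 n"
  proof (induction n arbitrary: x)
    case 0
    show ?case by (subst assms) simp
  next
    case (Suc n)
    show ?case by (subst assms) (use Suc in simp)
  qed
qed

locale unital_hom =
  fixes h :: "'a::ring_1 \<Rightarrow> 'b::ring_1"
  assumes hom_add: "h (x + y) = h x + h y" and hom_mult: "h (x * y) = h x * h y" and hom_1: "h 1 = 1"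
begin

lemma hom_0: "h 0 = 0" using hom_add[of 0 0] by simp
lemma hom_uminus: "h (- x) = - h x"
  using hom_add[of x "- x"] by (simp add: hom_0 eq_neg_iff_add_eq_0 add.commute)
lemma hom_diff: "h (x - y) = h x - h y"
  using hom_add[of x "- y"] by (simp add: hom_uminus)
lemma hom_sum: "h (\<Sum>i\<in>A. f i) = (\<Sum>i\<in>A. h (f i))"
  by (induction A rule: infinite_finite_induct) (simp_all add: hom_add hom_0)
lemma hom_power: "h (x ^ n) = h x ^ n"
  by (induction n) (simp_all add: hom_mult hom_1)
lemma hom_of_bool: "h (of_bool b) = of_bool b"
  by (simp add: hom_0 hom_1)

end

definition map_coeffs :: "('a::zero \<Rightarrow> 'b) \<Rightarrow> 'a fps \<Rightarrow> 'b fps" where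
  "map_coeffs h f = Abs_fps (\<lambda>n. h (fps_nth f n))"

lemma map_coeffs_nth [simp]: "fps_nth (map_coeffs h f) n = h (fps_nth f n)"
  by (simp add: map_coeffs_def)

lemma unital_hom_map_coeffs: "unital_hom h \<Longrightarrow> unital_hom (map_coeffs h)"
proof -
  assume "unital_hom h"
  then interpret unital_hom h .
  show ?thesis
    by unfold_locales (auto intro!: fps_ext simp: hom_add hom_mult hom_1 hom_0 hom_sum fps_mult_nth fps_one_nth)
qed

section \<open>The substitution of $u - h$ for $u$\<close>

definition shift_down :: "'a::ring_1 fps fps \<Rightarrow> 'a fps fps" where
  "shift_down f = Abs_fps (\<lambda>k. Abs_fps (\<lambda>N. \<Sum>n\<le>N. of_nat ((n + k) choose k) * (- 1) ^ n * fps_nth (fps_nth f (n + k)) (N - n)))"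

text \<open>
The inner variable is $h$ and the outer one is $u$.
\<close>

definition u_minus_h :: "'a::ring_1 fps fps" where
  "u_minus_h = fps_X - fps_const fps_X"

lemma fps_const_X_central: "fps_const fps_X * (x :: 'a::ring_1 fps fps) = x * fps_const fps_X"
  by (rule fps_const_commute_all) (rule fps_X_central)

lemma u_minus_h_central: "u_minus_h * x = x * u_minus_h"
  by (simp add: u_minus_h_def left_diff_distrib right_diff_distrib fps_X_central fps_const_X_central)

lemma u_minus_h_nth: "fps_nth (fps_nth (u_minus_h * g) k) N =
   (if k = 0 then 0 else fps_nth (fps_nth g (k - 1)) N) - (if N = 0 then 0 else fps_nth (fps_nth g k) (N - 1))"
  by (simp add: u_minus_h_def left_diff_distrib)

lemma u_minus_h_descent:
  fixes d :: "'b \<Rightarrow> 'a::ring_1 fps fps"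
  assumes "\<And>x. d x = u_minus_h * d (t x)"
  shows "d x = 0"
proof -
  have "k + N < M \<Longrightarrow> fps_nth (fps_nth (d x) k) N = 0" for k N M
  proof (induction M arbitrary: x k N)
    case (Suc M)
    have "fps_nth (fps_nth (u_minus_h * d (t x)) k) N = 0"
      unfolding u_minus_h_nth using Suc.IH[of "k - 1" N "t x"] Suc.IH[of k "N - 1" "t x"] Suc.prems by auto
    then show ?case by (simp only: assms[symmetric])
  qed simp
  note low = this
  show ?thesis
  proof (rule fps_ext, rule fps_ext)
    fix k N
    show "fps_nth (fps_nth (d x) k) N = fps_nth (fps_nth 0 k) N"
      using low[of k N "Suc (k + N)"] by simp
  qed
qed

lemma fps_head_tail: "f = fps_const (fps_nth f 0) + fps_X * fps_shift 1 f" for f :: "'a::ring_1 fps"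
  by (rule fps_ext) simp

text \<open>
  The recursion $f(u-h) = f_0 + (u-h) g(u-h)$ for $f = f_0 + u g$ is Pascal's rule. It characterises the
  substitution, and multiplicativity follows without any further binomial sums.
\<close>

lemma shift_down_head_tail: "shift_down f = fps_const (fps_nth f 0) + u_minus_h * shift_down (fps_shift 1 f)"
proof (rule fps_ext, rule fps_ext)
  fix k N
  define g where "g = (\<lambda>k N. fps_nth (fps_nth f k) N)"
  define s where "s = (\<lambda>k N. \<Sum>n\<le>N. of_nat ((n + k) choose k) * (- 1) ^ n * g (n + Suc k) (N - n))"
  have s: "fps_nth (fps_nth (shift_down (fps_shift 1 f)) k) N = s k N" for k N
    by (simp add: shift_down_def s_def g_def)
  have l: "fps_nth (fps_nth (shift_down f) k) N = (\<Sum>n\<le>N. of_nat ((n + k) choose k) * (- 1) ^ n * g (n + k) (N - n))"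
    by (simp add: shift_down_def g_def)
  show "fps_nth (fps_nth (shift_down f) k) N
      = fps_nth (fps_nth (fps_const (fps_nth f 0) + u_minus_h * shift_down (fps_shift 1 f)) k) N"
  proof (cases N)
    case 0
    then show ?thesis
      unfolding l fps_add_nth u_minus_h_nth s by (cases k) (simp_all add: s_def g_def)
  next
    case (Suc M)
    have neg: "(- 1) ^ Suc n = - ((- 1) ^ n :: 'a)" for n by simp
    have shift: "- s k M = (\<Sum>n\<le>M. of_nat ((n + k) choose k) * (- 1) ^ Suc n * g (Suc n + k) (M - n))"
      by (simp add: s_def sum_negf)
    show ?thesis
    proof (cases k)
      case 0
      then show ?thesis
        unfolding l fps_add_nth u_minus_h_nth s using shift
        by (simp add: Suc sum.atMost_Suc_shift g_def del: sum.atMost_Suc power_Suc)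
    next
      case (Suc k')
      have pascal: "of_nat ((Suc n + k) choose k) = of_nat ((Suc n + k') choose k') + (of_nat ((n + k) choose k) :: 'a)" for n
        unfolding Suc by simp
      have "(\<Sum>n\<le>N. of_nat ((n + k) choose k) * (- 1) ^ n * g (n + k) (N - n))
         = s k' N - s k M"
      proof -
        have "s k' N = g k N + (\<Sum>n\<le>M. of_nat ((Suc n + k') choose k') * (- 1) ^ Suc n * g (Suc n + k) (M - n))"
          unfolding s_def \<open>N = Suc M\<close> sum.atMost_Suc_shift by (simp add: Suc del: power_Suc binomial_Suc_Suc)
        moreover have "(\<Sum>n\<le>N. of_nat ((n + k) choose k) * (- 1) ^ n * g (n + k) (N - n))
          = g k N + (\<Sum>n\<le>M. of_nat ((Suc n + k) choose k) * (- 1) ^ Suc n * g (Suc n + k) (M - n))"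
          unfolding \<open>N = Suc M\<close> sum.atMost_Suc_shift by (simp del: power_Suc binomial_Suc_Suc)
        ultimately show ?thesis
          using shift unfolding pascal by (simp add: distrib_right sum.distrib del: power_Suc binomial_Suc_Suc) 
      qed
      then show ?thesis
        unfolding l fps_add_nth u_minus_h_nth s by (simp add: Suc \<open>N = Suc M\<close>)
    qed
  qed
qed

lemma shift_down_add: "shift_down (f + g) = shift_down f + shift_down g"
  by (intro fps_ext) (simp add: shift_down_def distrib_left sum.distrib)

lemma shift_down_const: "shift_down (fps_const c) = fps_const c"
proof -
  have z: "shift_down 0 = (0 :: 'a fps fps)" by (intro fps_ext) (simp add: shift_down_def)
  have "fps_shift 1 (fps_const c) = 0" by (rule fps_ext) simp
  with shift_down_head_tail[of "fps_const c"] z show ?thesis by simp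
qed

lemma shift_down_X_mult: "shift_down (fps_X * f) = u_minus_h * shift_down f"
proof -
  have "fps_shift 1 (fps_X * f) = f" by (rule fps_ext) simp
  with shift_down_head_tail[of "fps_X * f"] show ?thesis by simp
qed

lemma shift_down_const_mult: "shift_down (fps_const c * g) = fps_const c * shift_down g"
proof -
  define d where "d = (\<lambda>g. shift_down (fps_const c * g) - fps_const c * shift_down g)"
  have "d g = u_minus_h * d (fps_shift 1 g)" for g
  proof -
    have "fps_shift 1 (fps_const c * g) = fps_const c * fps_shift 1 g" by (rule fps_ext) simp
    then have "shift_down (fps_const c * g) = fps_const c * fps_const (fps_nth g 0) + u_minus_h * shift_down (fps_const c * fps_shift 1 g)"
      using shift_down_head_tail[of "fps_const c * g"] by simp
    moreover have "fps_const c * shift_down g = fps_const c * fps_const (fps_nth g 0) + u_minus_h * (fps_const c * shift_down (fps_shift 1 g))"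
    proof -
      have "fps_const c * (u_minus_h * shift_down (fps_shift 1 g)) = u_minus_h * (fps_const c * shift_down (fps_shift 1 g))"
        by (metis mult.assoc u_minus_h_central)
      then show ?thesis by (subst shift_down_head_tail) (simp only: distrib_left)
    qed
    ultimately show ?thesis by (simp add: d_def right_diff_distrib)
  qed
  from u_minus_h_descent[where d = d, OF this] show ?thesis by (simp add: d_def)
qed

lemma shift_down_mult: "shift_down (f * g) = shift_down f * shift_down g"
proof -
  define d where "d = (\<lambda>f. shift_down (f * g) - shift_down f * shift_down g)"
  have "d f = u_minus_h * d (fps_shift 1 f)" for f
  proof -
    have "f * g = fps_const (fps_nth f 0) * g + fps_X * (fps_shift 1 f * g)"
      by (subst fps_head_tail[of f]) (simp only: distrib_right mult.assoc)
    then have "shift_down (f * g) = fps_const (fps_nth f 0) * shift_down g + u_minus_h * shift_down (fps_shift 1 f * g)"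
      by (simp only: shift_down_add shift_down_const_mult shift_down_X_mult)
    moreover have "shift_down f * shift_down g = fps_const (fps_nth f 0) * shift_down g + u_minus_h * (shift_down (fps_shift 1 f) * shift_down g)"
      by (subst shift_down_head_tail) (simp only: distrib_right mult.assoc)
    ultimately show ?thesis by (simp add: d_def right_diff_distrib)
  qed
  from u_minus_h_descent[where d = d, OF this] show ?thesis by (simp add: d_def)
qed

interpretation shift_down: unital_hom shift_down
  using shift_down_const[of 1] by unfold_locales (simp_all add: shift_down_add shift_down_mult)

lemma shift_down_fmap:
  assumes "unital_hom h" and h_X: "h fps_X = fps_X"
  shows "map_coeffs h (shift_down f) = shift_down (map_coeffs h f)"
proof -
  interpret h: unital_hom h by fact
  interpret H: unital_hom "map_coeffs h" by (rule unital_hom_map_coeffs) fact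
  have const: "map_coeffs h (fps_const c) = fps_const (h c)" for c
    by (rule fps_ext) (simp add: h.hom_0)
  have X: "map_coeffs h fps_X = fps_X"
    by (rule fps_ext) (simp add: fps_X_nth h.hom_0 h.hom_1)
  have u_minus_h: "map_coeffs h u_minus_h = u_minus_h"
    by (simp add: u_minus_h_def H.hom_diff const X h_X)
  define d where "d = (\<lambda>f. map_coeffs h (shift_down f) - shift_down (map_coeffs h f))"
  have "d f = u_minus_h * d (fps_shift 1 f)" for f
  proof -
    have "map_coeffs h (shift_down f) = fps_const (h (fps_nth f 0)) + u_minus_h * map_coeffs h (shift_down (fps_shift 1 f))"
      by (subst shift_down_head_tail) (simp add: H.hom_add H.hom_mult const u_minus_h)
    moreover have "fps_shift 1 (map_coeffs h f) = map_coeffs h (fps_shift 1 f)" by (rule fps_ext) simp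
    then have "shift_down (map_coeffs h f) = fps_const (h (fps_nth f 0)) + u_minus_h * shift_down (map_coeffs h (fps_shift 1 f))"
      using shift_down_head_tail[of "map_coeffs h f"] by simp
    ultimately show ?thesis by (simp add: d_def right_diff_distrib)
  qed
  from u_minus_h_descent[where d = d, OF this] show ?thesis by (simp add: d_def)
qed

lemma shift_series_eq_shift_down: "shift_series (- 1) f = shift_down f"
proof (rule fps_ext, rule fps_ext)
  fix k N
  have of_nat: "single (0 :: gword) (of_nat n :: complex) = of_nat n" for n
    by (induction n) (simp_all add: single_add)
  have neg1: "single (0 :: gword) ((- 1) ^ n :: complex) = (- 1) ^ n" for n
  proof (induction n)
    case (Suc n)
    have "single (0 :: gword) ((- 1) ^ Suc n :: complex)
       = single 0 (- 1) * single 0 ((- 1) ^ n)"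
      by (simp add: mult_single)
    also have "single (0 :: gword) (- 1 :: complex) = - 1"
      by (simp add: single_uminus)
    finally show ?case using Suc by simp
  qed simp
  have "single (0 :: gword) (of_nat m * (- 1) ^ n :: complex) = of_nat m * (- 1) ^ n" for m n
    using mult_single[of "0 :: gword" "of_nat m :: complex" 0 "(- 1) ^ n"] by (simp add: of_nat neg1)
  then show "fps_nth (fps_nth (shift_series (- 1) f) k) N = fps_nth (fps_nth (shift_down f) k) N"
    by (simp add: shift_series_nth shift_down_def)
qed

section \<open>Extending operators from generators to the completed free algebra\<close>

definition word_op :: "(gen \<Rightarrow> endo fps) \<Rightarrow> gword \<Rightarrow> endo fps" where
  "word_op t w = prod_list (map t (letters w))"

lemma fps_const_scal_commute: "fps_const (scal c) * x = x * fps_const (scal c)"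
  by (rule fps_const_commute_all) (rule scal_commute)

interpretation word_lift: monoid_algebra_lift "\<lambda>c. fps_const (scal c)" "word_op t" for t
proof
  have "scal (a + b) = scal a + scal b" "scal (a * b) = scal a * scal b" for a b
    by (intro endo_eqI; simp add: algebra_simps)+
  then show "fps_const (scal (a + b)) = fps_const (scal a) + fps_const (scal b)"
    "fps_const (scal (a * b)) = fps_const (scal a) * fps_const (scal b)" for a b
    by simp_all
  have "scal 1 = 1" by (intro endo_eqI) simp
  then show "fps_const (scal 1) = 1" by simp
qed (simp_all add: word_op_def zero_gword_def plus_gword_def fps_const_scal_commute)

lemma word_lift_word: "word_lift.lift t (single (GWord [g]) 1) = t g"
proof -
  have "scal 1 = 1" by (intro endo_eqI) simp
  then show ?thesis by (simp add: word_lift.lift_single word_op_def)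
qed

text \<open>
  The coefficient of $h^i$ in an element acts by an operator that is itself a power series in $h$; the
  two expansions are merged into one.
\<close>

definition action :: "(gen \<Rightarrow> endo fps) \<Rightarrow> falg \<Rightarrow> endo fps" where
  "action t a = Abs_fps (\<lambda>n. \<Sum>i\<le>n. fps_nth (word_lift.lift t (fps_nth a i)) (n - i))"

lemma action_head_tail: "action t a = word_lift.lift t (fps_nth a 0) + fps_X * action t (fps_shift 1 a)"
proof (rule fps_ext)
  fix n
  show "fps_nth (action t a) n = fps_nth (word_lift.lift t (fps_nth a 0) + fps_X * action t (fps_shift 1 a)) n"
    by (cases n) (simp_all add: action_def sum.atMost_Suc_shift del: sum.atMost_Suc)
qed

lemma action_add: "action t (a + b) = action t a + action t b"
  by (rule fps_ext) (simp add: action_def word_lift.lift_add sum.distrib)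

lemma action_const: "action t (fps_const p) = word_lift.lift t p"
proof -
  have z: "action t 0 = 0" by (rule fps_ext) (simp add: action_def)
  have "fps_shift 1 (fps_const p) = 0" by (rule fps_ext) simp
  with action_head_tail[of t "fps_const p"] z show ?thesis by simp
qed

lemma action_X_mult: "action t (fps_X * a) = fps_X * action t a"
proof -
  have "fps_shift 1 (fps_X * a) = a" by (rule fps_ext) simp
  with action_head_tail[of t "fps_X * a"] show ?thesis by simp
qed

lemma action_const_mult: "action t (fps_const p * b) = word_lift.lift t p * action t b"
proof -
  define d where "d = (\<lambda>b. action t (fps_const p * b) - word_lift.lift t p * action t b)"
  have "d b = fps_X * d (fps_shift 1 b)" for b
  proof -
    have "fps_shift 1 (fps_const p * b) = fps_const p * fps_shift 1 b" by (rule fps_ext) simp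
    then have "action t (fps_const p * b) = word_lift.lift t p * word_lift.lift t (fps_nth b 0) + fps_X * action t (fps_const p * fps_shift 1 b)"
      using action_head_tail[of t "fps_const p * b"] by (simp add: word_lift.lift_mult)
    moreover have "word_lift.lift t p * action t b
       = word_lift.lift t p * word_lift.lift t (fps_nth b 0) + fps_X * (word_lift.lift t p * action t (fps_shift 1 b))"
    proof -
      have "word_lift.lift t p * (fps_X * action t (fps_shift 1 b)) = fps_X * (word_lift.lift t p * action t (fps_shift 1 b))"
        by (metis mult.assoc fps_X_central)
      then show ?thesis by (subst action_head_tail) (simp only: distrib_left)
    qed
    ultimately show ?thesis by (simp add: d_def right_diff_distrib)
  qed
  from fps_X_descent[where d = d, OF this] show ?thesis by (simp add: d_def)
qed

lemma action_mult: "action t (a * b) = action t a * action t b"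
proof -
  define d where "d = (\<lambda>a. action t (a * b) - action t a * action t b)"
  have "d a = fps_X * d (fps_shift 1 a)" for a
  proof -
    have "a * b = fps_const (fps_nth a 0) * b + fps_X * (fps_shift 1 a * b)"
      by (subst fps_head_tail[of a]) (simp only: distrib_right mult.assoc)
    then have "action t (a * b) = word_lift.lift t (fps_nth a 0) * action t b + fps_X * action t (fps_shift 1 a * b)"
      by (simp only: action_add action_const_mult action_X_mult)
    moreover have "action t a * action t b
        = word_lift.lift t (fps_nth a 0) * action t b + fps_X * (action t (fps_shift 1 a) * action t b)"
      by (subst action_head_tail) (simp only: distrib_right mult.assoc)
    ultimately show ?thesis by (simp add: d_def right_diff_distrib)
  qed
  from fps_X_descent[where d = d, OF this] show ?thesis by (simp add: d_def)
qed

lemma unital_hom_action: "unital_hom (action t)"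
  using action_const[of t 1] by unfold_locales (simp_all add: action_add action_mult)

lemma action_X: "action t fps_X = fps_X"
  using action_X_mult[of t 1] action_const[of t 1] by simp

lemma action_tgen: "action t (tgen i j r) = t (Gen i j (r - 1))"
  by (simp add: tgen_def action_const word_lift_word)

lemma action_series: "action t (falg_of_series f) = Abs_fps (\<lambda>n. scal (fps_nth f n))"
proof (rule fps_ext)
  fix n
  have "fps_nth (word_lift.lift t (single 0 c)) k = (if k = 0 then scal c else 0)" for c k
    by (simp add: word_lift.lift_single word_op_def zero_gword_def)
  then show "fps_nth (action t (falg_of_series f)) n = fps_nth (Abs_fps (\<lambda>n. scal (fps_nth f n))) n"
    by (simp add: action_def falg_of_series_def sum.delta' if_distrib cong: if_cong)
       (simp add: sum.remove[of _ n] sum.neutral)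
qed

section \<open>A module for $\mathfrak{gl}_2$ with vanishing Casimir element\<close>

text \<open>
  For each \<open>k\<close>, the generator $E_{12}$ shifts the variable $\alpha_k$, so products of
  these operators for different \<open>k\<close> are independent. The
  diagonal generators act by $\mp\alpha_k$, and the coefficient $-\alpha_k(\alpha_k - 1)$ of $E_{21}$ is the one that
  makes the Casimir element vanish. At $\alpha_k = 0$ this coefficient is zero, which makes the value of the
  truncated $\alpha_k - 1$ irrelevant.
\<close>

lift_definition op12 :: "nat \<Rightarrow> endo" is "\<lambda>k F \<alpha>. F (\<alpha>(k := Suc (\<alpha> k)))"
  by simp
lift_definition op22 :: "nat \<Rightarrow> endo" is "\<lambda>k F \<alpha>. of_nat (\<alpha> k) * F \<alpha>"
  by (simp add: algebra_simps)
lift_definition op21 :: "nat \<Rightarrow> endo" is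
  "\<lambda>k F \<alpha>. - (of_nat (\<alpha> k) * (of_nat (\<alpha> k) - 1) * F (\<alpha>(k := \<alpha> k - 1)))"
  by (simp add: algebra_simps)

lemma op_simps [simp]:
  "app (op12 k) F = (\<lambda>\<alpha>. F (\<alpha>(k := Suc (\<alpha> k))))"
  "app (op22 k) F = (\<lambda>\<alpha>. of_nat (\<alpha> k) * F \<alpha>)"
  "app (op21 k) F = (\<lambda>\<alpha>. - (of_nat (\<alpha> k) * (of_nat (\<alpha> k) - 1) * F (\<alpha>(k := \<alpha> k - 1))))"
  by (transfer, simp)+

definition gl :: "nat \<Rightarrow> 2 \<Rightarrow> 2 \<Rightarrow> endo" where
  "gl k i j = (if i = 1 then if j = 1 then - op22 k else op12 k
               else if j = 1 then op21 k else op22 k)"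

lemma gl_simps: "gl k 1 1 = - op22 k" "gl k 1 2 = op12 k" "gl k 2 1 = op21 k" "gl k 2 2 = op22 k"
  by (simp_all add: gl_def)

lemma op_comm:
  "op22 k * op12 k - op12 k * op22 k = - op12 k"
  "op22 k * op21 k - op21 k * op22 k = op21 k"
  "op12 k * op21 k - op21 k * op12 k = - op22 k - op22 k"
proof -
  show "op22 k * op12 k - op12 k * op22 k = - op12 k"
    by (rule endo_eqI) (simp add: algebra_simps)
  show "op22 k * op21 k - op21 k * op22 k = op21 k"
  proof (rule endo_eqI)
    fix F \<alpha>
    show "app (op22 k * op21 k - op21 k * op22 k) F \<alpha> = app (op21 k) F \<alpha>"
      by (cases "\<alpha> k") (simp_all add: algebra_simps fun_upd_idem)
  qed
  show "op12 k * op21 k - op21 k * op12 k = - op22 k - op22 k"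
  proof (rule endo_eqI)
    fix F \<alpha>
    show "app (op12 k * op21 k - op21 k * op12 k) F \<alpha> = app (- op22 k - op22 k) F \<alpha>"
      by (cases "\<alpha> k") (simp_all add: algebra_simps fun_upd_idem)
  qed
qed

lemma two_cases: "(\<forall>i :: 2. P i) \<longleftrightarrow> P 1 \<and> P 2"
  by (metis exhaust_2)

lemma gl_comm:
  "gl k i j * gl k p l - gl k p l * gl k i j = of_bool (p = j) * gl k i l - of_bool (i = l) * gl k p j"
proof -
  have "op12 k * op22 k - op22 k * op12 k = op12 k" "op21 k * op22 k - op22 k * op21 k = - op21 k"
    "op21 k * op12 k - op12 k * op21 k = op22 k + op22 k"
    using arg_cong[OF op_comm(1)[of k], of uminus] arg_cong[OF op_comm(2)[of k], of uminus]
      arg_cong[OF op_comm(3)[of k], of uminus] by simp_all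
  then have "\<forall>i j p l. gl k i j * gl k p l - gl k p l * gl k i j = of_bool (p = j) * gl k i l - of_bool (i = l) * gl k p j"
    unfolding two_cases gl_simps using op_comm[of k] by simp
  then show ?thesis by blast
qed

lemma op_commute_distinct:
  assumes "k \<noteq> k'" "A \<in> {op12 k, op22 k, op21 k}" "B \<in> {op12 k', op22 k', op21 k'}"
  shows "A * B = B * A"
  using assms by (auto intro!: endo_eqI simp: fun_upd_twist)

lemma gl_commute_distinct: "k \<noteq> k' \<Longrightarrow> gl k i j * gl k' p l = gl k' p l * gl k i j"
proof -
  assume k: "k \<noteq> k'"
  have "\<forall>i j p l. gl k i j * gl k' p l = gl k' p l * gl k i j"
  proof -
    have "\<forall>A\<in>{op12 k, op22 k, op21 k}. \<forall>B\<in>{op12 k', op22 k', op21 k'}. A * B = B * A"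
      using op_commute_distinct[OF k] by blast
    then show ?thesis unfolding two_cases gl_simps by simp
  qed
  then show ?thesis by blast
qed

lemma gl_casimir: "gl k 1 1 * gl k 2 2 - gl k 1 1 - gl k 2 1 * gl k 1 2 = 0"
proof (rule endo_eqI)
  fix F \<alpha>
  show "app (gl k 1 1 * gl k 2 2 - gl k 1 1 - gl k 2 1 * gl k 1 2) F \<alpha> = app 0 F \<alpha>"
    unfolding gl_simps by (cases "\<alpha> k") (simp_all add: algebra_simps fun_upd_idem)
qed

lemma gl_trace: "gl k 1 1 = - gl k 2 2"
  by (simp add: gl_simps)

section \<open>The RTT relation and the quantum determinant of products\<close>

definition central :: "'a::ring_1 \<Rightarrow> bool" where
  "central z \<longleftrightarrow> (\<forall>x. z * x = x * z)"

text \<open>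
  The entries of the RTT relation for \<open>t\<close> at $u$ and \<open>t'\<close> at $v$, where \<open>w\<close> is
  $u - v$.
\<close>

definition RTT :: "'a::ring_1 \<Rightarrow> 'a \<Rightarrow> (2 \<Rightarrow> 2 \<Rightarrow> 'a) \<Rightarrow> (2 \<Rightarrow> 2 \<Rightarrow> 'a) \<Rightarrow> bool" where
  "RTT w h t t' \<longleftrightarrow> (\<forall>i j k l. w * (t i j * t' k l - t' k l * t i j) = h * (t k j * t' i l - t' k j * t i l))"

definition mat_prod :: "(2 \<Rightarrow> 2 \<Rightarrow> 'a::ring_1) \<Rightarrow> (2 \<Rightarrow> 2 \<Rightarrow> 'a) \<Rightarrow> 2 \<Rightarrow> 2 \<Rightarrow> 'a" where
  "mat_prod t s i j = (\<Sum>a\<in>UNIV. t i a * s a j)"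

text \<open>
  This is the coproduct: the commutator of the products splits into those of the factors, and the two
  middle terms cancel.
\<close>

lemma RTT_mat_prod:
  assumes w: "central w" and h: "central h" and t: "RTT w h t t'" and s: "RTT w h s s'"
    and c: "\<And>i j k l. t i j * s' k l = s' k l * t i j" "\<And>i j k l. t' i j * s k l = s k l * t' i j"
  shows "RTT w h (mat_prod t s) (mat_prod t' s')"
  unfolding RTT_def
proof (intro allI)
  fix i j k l
  have split: "w * (A * B * (C * D) - E * G * (H * I)) = w * (A * C - E * H) * (B * D) + E * H * (w * (B * D - G * I))"
    if "B * C = C * B" "G * H = H * G" for A B C D E G H I
  proof -
    have "A * B * (C * D) = A * C * (B * D)" using that(1) by (metis mult.assoc)
    moreover have "E * G * (H * I) = E * H * (G * I)" using that(2) by (metis mult.assoc)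
    moreover have "E * H * (w * (B * D - G * I)) = w * (E * H * (B * D - G * I))"
      using w by (metis central_def mult.assoc)
    ultimately show ?thesis by (simp add: algebra_simps)
  qed
  have "w * (mat_prod t s i j * mat_prod t' s' k l - mat_prod t' s' k l * mat_prod t s i j)
     = (\<Sum>a\<in>UNIV. \<Sum>b\<in>UNIV. w * (t i a * s a j * (t' k b * s' b l) - t' k b * s' b l * (t i a * s a j)))"
  proof -
    have "mat_prod t s i j * mat_prod t' s' k l = (\<Sum>a\<in>UNIV. \<Sum>b\<in>UNIV. t i a * s a j * (t' k b * s' b l))"
      by (simp only: mat_prod_def sum_product)
    moreover have "mat_prod t' s' k l * mat_prod t s i j = (\<Sum>a\<in>UNIV. \<Sum>b\<in>UNIV. t' k b * s' b l * (t i a * s a j))"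
      unfolding mat_prod_def sum_product by (rule sum.swap)
    ultimately show ?thesis by (simp only: sum_distrib_left sum_subtractf right_diff_distrib)
  qed
  also have "\<dots> = (\<Sum>a\<in>UNIV. \<Sum>b\<in>UNIV. h * (t k a * t' i b - t' k a * t i b) * (s a j * s' b l)
       + t' k b * t i a * (h * (s b j * s' a l - s' b j * s a l)))"
  proof (intro sum.cong refl)
    fix a b :: 2
    have "w * (t i a * s a j * (t' k b * s' b l) - t' k b * s' b l * (t i a * s a j))
       = w * (t i a * t' k b - t' k b * t i a) * (s a j * s' b l) + t' k b * t i a * (w * (s a j * s' b l - s' b l * s a j))"
      using c(2)[of k b a j] c(1)[of i a b l] by (intro split) simp_all
    also have "w * (t i a * t' k b - t' k b * t i a) = h * (t k a * t' i b - t' k a * t i b)"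
      using t unfolding RTT_def by blast
    also have "w * (s a j * s' b l - s' b l * s a j) = h * (s b j * s' a l - s' b j * s a l)"
      using s unfolding RTT_def by blast
    finally show "w * (t i a * s a j * (t' k b * s' b l) - t' k b * s' b l * (t i a * s a j))
      = h * (t k a * t' i b - t' k a * t i b) * (s a j * s' b l)
       + t' k b * t i a * (h * (s b j * s' a l - s' b j * s a l))" .
  qed
  also have "\<dots> = h * ((\<Sum>a\<in>UNIV. \<Sum>b\<in>UNIV. t k a * t' i b * (s a j * s' b l)) - (\<Sum>a\<in>UNIV. \<Sum>b\<in>UNIV. t' k b * t i a * (s' b j * s a l)))"
  proof -
    have hc: "t' k b * t i a * (h * y) = h * (t' k b * t i a * y)" for a b y
      using h by (metis central_def mult.assoc)
    have sw: "(\<Sum>a\<in>UNIV. \<Sum>b\<in>UNIV. h * (t' k a * t i b * (s a j * s' b l)))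
        = (\<Sum>a\<in>UNIV. \<Sum>b\<in>UNIV. h * (t' k b * t i a * (s b j * s' a l)))"
      by (rule sum.swap)
    show ?thesis
      unfolding hc by (simp add: sum.distrib sum_subtractf left_diff_distrib right_diff_distrib mult.assoc sum_distrib_left)
        (use sw in \<open>simp add: mult.assoc\<close>)
  qed
  also have "(\<Sum>a\<in>UNIV. \<Sum>b\<in>UNIV. t k a * t' i b * (s a j * s' b l)) = mat_prod t s k j * mat_prod t' s' i l"
    unfolding mat_prod_def sum_product
    by (intro sum.cong refl) (metis c(2) mult.assoc)
  also have "(\<Sum>a\<in>UNIV. \<Sum>b\<in>UNIV. t' k b * t i a * (s' b j * s a l)) = mat_prod t' s' k j * mat_prod t s i l"
    unfolding mat_prod_def sum_product
    by (subst sum.swap, intro sum.cong refl) (metis c(1) mult.assoc)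
  finally show "w * (mat_prod t s i j * mat_prod t' s' k l - mat_prod t' s' k l * mat_prod t s i j)
     = h * (mat_prod t s k j * mat_prod t' s' i l - mat_prod t' s' k j * mat_prod t s i l)" .
qed

definition eps :: "2 \<Rightarrow> 2 \<Rightarrow> 'a::ring_1" where
  "eps j l = of_bool (j = 1 \<and> l = 2) - of_bool (j = 2 \<and> l = 1)"

text \<open>
  With \<open>t'\<close> the matrix at $u - h$, the entry $j = 1$, $l = 2$ says that the quantum determinant
  is one. The other three entries follow from it by the RTT relation at $v = u - h$. Carrying all four along
  makes the property multiplicative by a direct computation and avoids that specialisation.
\<close>

definition unimodular :: "(2 \<Rightarrow> 2 \<Rightarrow> 'a::ring_1) \<Rightarrow> (2 \<Rightarrow> 2 \<Rightarrow> 'a) \<Rightarrow> bool" where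
  "unimodular t t' \<longleftrightarrow> (\<forall>j l. t 1 j * t' 2 l - t 2 j * t' 1 l = eps j l)"

lemma unimodular_mat_prod:
  assumes t: "unimodular t t'" and s: "unimodular s s'"
    and c: "\<And>i j k l. t' i j * s k l = s k l * t' i j"
  shows "unimodular (mat_prod t s) (mat_prod t' s')"
  unfolding unimodular_def
proof (intro allI)
  fix j l
  have r: "t i a * s a j * (t' k b * s' b l) = t i a * t' k b * (s a j * s' b l)" for i k a b
    by (metis c mult.assoc)
  have "mat_prod t s 1 j * mat_prod t' s' 2 l - mat_prod t s 2 j * mat_prod t' s' 1 l
    = (\<Sum>a\<in>UNIV. \<Sum>b\<in>UNIV. (t 1 a * t' 2 b - t 2 a * t' 1 b) * (s a j * s' b l))"
    unfolding mat_prod_def sum_product r by (simp add: sum_subtractf left_diff_distrib)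
  also have "\<dots> = (\<Sum>a\<in>UNIV. \<Sum>b\<in>UNIV. eps a b * (s a j * s' b l))"
    using t by (simp add: unimodular_def)
  also have "\<dots> = s 1 j * s' 2 l - s 2 j * s' 1 l"
    unfolding UNIV_2 by (simp add: eps_def)
  also have "\<dots> = eps j l" using s by (simp add: unimodular_def)
  finally show "mat_prod t s 1 j * mat_prod t' s' 2 l - mat_prod t s 2 j * mat_prod t' s' 1 l = eps j l" .
qed

text \<open>
  Both sides are the commutator relation of $\mathfrak{gl}_2$ times the same scalar.
\<close>

lemma RTT_evaluation:
  assumes K: "central K" "central K'" and h: "h * (K - K') = w * (K * K')"
    and E: "\<And>i j k l. E i j * E k l - E k l * E i j = of_bool (k = j) * E i l - of_bool (i = l) * E k j"
    and hc: "central h" "central w"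
  shows "RTT w h (\<lambda>i j. of_bool (i = j) - K * E i j) (\<lambda>i j. of_bool (i = j) - K' * E i j)"
  unfolding RTT_def
proof (intro allI)
  fix i j k l
  have c: "E a b * K = K * E a b" "E a b * (K * y) = K * (E a b * y)"
    "E a b * K' = K' * E a b" "E a b * (K' * y) = K' * (E a b * y)" "K' * K = K * K'" "K' * (K * y) = K * (K' * y)" for a b y
    using K by (metis central_def mult.assoc)+
  have "w * ((of_bool (i = j) - K * E i j) * (of_bool (k = l) - K' * E k l) - (of_bool (k = l) - K' * E k l) * (of_bool (i = j) - K * E i j))
     = w * (K * K' * (E i j * E k l - E k l * E i j))"
    by (simp add: left_diff_distrib right_diff_distrib mult.assoc c)
  also have "\<dots> = h * (K - K') * (of_bool (k = j) * E i l - of_bool (i = l) * E k j)"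
    unfolding E h by (simp only: mult.assoc)
  also have "\<dots> = h * ((of_bool (k = j) - K * E k j) * (of_bool (i = l) - K' * E i l) - (of_bool (k = j) - K' * E k j) * (of_bool (i = l) - K * E i l))"
    unfolding mult.assoc by (rule arg_cong[where f = "(*) h"])
      (cases "k = j"; cases "i = l"; simp add: left_diff_distrib right_diff_distrib mult.assoc c)
  finally show "w * ((of_bool (i = j) - K * E i j) * (of_bool (k = l) - K' * E k l) - (of_bool (k = l) - K' * E k l) * (of_bool (i = j) - K * E i j))
    = h * ((of_bool (k = j) - K * E k j) * (of_bool (i = l) - K' * E i l) - (of_bool (k = j) - K' * E k j) * (of_bool (i = l) - K * E i l))" .
qed

text \<open>
  Each entry differs from its required value by a multiple of $K - K' - K K'$, by the
  commutation relations, the vanishing trace and the vanishing Casimir element.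
\<close>

lemma unimodular_evaluation:
  assumes K: "central K" "central K'" and KK: "K - K' = K * K'"
    and E: "\<And>i j k l. E i j * E k l - E k l * E i j = of_bool (k = j) * E i l - of_bool (i = l) * E k j"
    and cas: "E 1 1 * E 2 2 - E 1 1 - E 2 1 * E 1 2 = 0" and tr: "E 1 1 = - E 2 2"
  shows "unimodular (\<lambda>i j. of_bool (i = j) - K * E i j) (\<lambda>i j. of_bool (i = j) - K' * E i j)"
proof -
  have c: "E a b * K = K * E a b" "E a b * (K * y) = K * (E a b * y)"
    "E a b * K' = K' * E a b" "E a b * (K' * y) = K' * (E a b * y)" "K' * K = K * K'" "K' * (K * y) = K * (K' * y)" for a b y
    using K by (metis central_def mult.assoc)+
  have Keq: "K = K' + K * K'" using KK by (simp add: algebra_simps)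
  have e1: "E 1 1 * E 2 1 = E 2 1 * E 1 1 - E 2 1" using E[of 1 1 2 1] by (simp add: algebra_simps)
  have e2: "E 1 2 * E 2 2 = E 2 2 * E 1 2 + E 1 2" using E[of 1 2 2 2] by (simp add: algebra_simps)
  have e3: "E 2 1 * E 1 2 = E 1 1 * E 2 2 - E 1 1" using cas by (simp add: algebra_simps)
  have e4: "E 1 2 * E 2 1 = E 2 2 * E 1 1 - E 2 2" 
  proof -
    have "E 1 2 * E 2 1 = E 2 1 * E 1 2 + (E 1 1 - E 2 2)" using E[of 1 2 2 1] by (simp add: algebra_simps)
    then show ?thesis unfolding e3 by (simp add: tr)
  qed
  have u11: "(1 - K * E 1 1) * (0 - K' * E 2 1) - (0 - K * E 2 1) * (1 - K' * E 1 1) = (K - K' - K * K') * E 2 1"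
    by (simp add: left_diff_distrib right_diff_distrib mult.assoc c e1)
  have u22: "(0 - K * E 1 2) * (1 - K' * E 2 2) - (1 - K * E 2 2) * (0 - K' * E 1 2) = - ((K - K' - K * K') * E 1 2)"
    by (simp add: left_diff_distrib right_diff_distrib mult.assoc c e2 distrib_left)
  have u12: "(1 - K * E 1 1) * (1 - K' * E 2 2) - (0 - K * E 2 1) * (0 - K' * E 1 2) = 1 + (K - K' - K * K') * E 2 2"
    by (simp add: left_diff_distrib right_diff_distrib mult.assoc c e3) (simp add: tr algebra_simps)
  have u21: "(0 - K * E 1 2) * (0 - K' * E 2 1) - (1 - K * E 2 2) * (1 - K' * E 1 1) = - 1 + (K - K' - K * K') * E 2 2"
    by (simp add: left_diff_distrib right_diff_distrib mult.assoc c e4) (simp add: tr algebra_simps)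
  have "K - K' - K * K' = 0" using KK by simp
  with u11 u22 u12 u21 show ?thesis
    unfolding unimodular_def two_cases eps_def by simp
qed

section \<open>Products of evaluation matrices\<close>

lemma central_mult: "central a \<Longrightarrow> central b \<Longrightarrow> central (a * b)"
  unfolding central_def by (metis mult.assoc)
lemma central_diff: "central a \<Longrightarrow> central b \<Longrightarrow> central (a - b)"
  by (simp add: central_def left_diff_distrib right_diff_distrib)
lemma central_of_nat: "central (of_nat n)"
  by (simp add: central_def mult_of_nat_commute)
lemma central_fps:
  fixes f :: "'a::ring_1 fps"
  assumes "\<And>n. central (fps_nth f n)"
  shows "central f"
  unfolding central_def
proof (intro allI fps_ext)
  fix x :: "'a fps" and n
  have "fps_nth (f * x) n = (\<Sum>i=0..n. fps_nth x (n - i) * fps_nth f i)"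
    using assms by (simp add: fps_mult_nth central_def)
  also have "\<dots> = (\<Sum>i=0..n. fps_nth x i * fps_nth f (n - i))"
    by (rule sum.reindex_bij_witness[of _ "\<lambda>i. n - i" "\<lambda>i. n - i"]) auto
  finally show "fps_nth (f * x) n = fps_nth (x * f) n" by (simp add: fps_mult_nth)
qed

lemma central_fps_const: "central a \<Longrightarrow> central (fps_const a)"
  unfolding central_def by (intro allI fps_const_commute_all) blast

lemma central_fps_X: "central (fps_X :: 'a::ring_1 fps)"
  by (simp add: central_def fps_X_central)

lemma inverse_difference:
  fixes g :: "'a::ring_1"
  assumes "central g" "A * g = 1" "A' * g' = 1"
  shows "g - g' = (A' - A) * (g' * g)"
proof -
  have "(A' - A) * (g' * g) = A' * g' * g - A * g * g'"
    using assms(1) by (simp add: left_diff_distrib mult.assoc central_def)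
  then show ?thesis by (simp add: assms)
qed

abbreviation in_first :: "'a::ring_1 fps \<Rightarrow> 'a fps fps" where "in_first \<equiv> fps_const"
abbreviation in_second :: "'a::ring_1 fps \<Rightarrow> 'a fps fps" where "in_second \<equiv> map_coeffs fps_const"

lemma unital_hom_fps_const: "unital_hom (fps_const :: 'a::ring_1 \<Rightarrow> 'a fps)"
  by unfold_locales simp_all

interpretation fst_var: unital_hom "in_first :: 'a::ring_1 fps \<Rightarrow> 'a fps fps"
  by (rule unital_hom_fps_const)
interpretation snd_var: unital_hom "in_second :: 'a::ring_1 fps \<Rightarrow> 'a fps fps"
  by (rule unital_hom_map_coeffs) (rule unital_hom_fps_const)

lemma hom_of_nat: "unital_hom h \<Longrightarrow> h (of_nat n) = of_nat n"
proof -
  assume "unital_hom h" then interpret unital_hom h .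
  show ?thesis by (induction n) (simp_all add: hom_0 hom_add hom_1)
qed

lemma in_second_const: "in_second (fps_const a) = fps_const (fps_const a)"
  by (rule fps_ext) simp

lemma in_second_X: "in_second fps_X = fps_X"
  by (rule fps_ext) (simp add: fps_X_nth)

abbreviation h_ser :: "endo fps fps" where "h_ser \<equiv> fps_const fps_X"
abbreviation op_const :: "endo \<Rightarrow> endo fps fps" where "op_const A \<equiv> fps_const (fps_const A)"

text \<open>
The series $1 / (1 - b u)$; the inner variable is $h$ and the outer one is $u$.
\<close>

definition geo :: "nat \<Rightarrow> endo fps fps" where
  "geo b = Abs_fps (\<lambda>n. of_nat (b ^ n))"

lemma central_geo: "central (geo b)"
  by (rule central_fps) (simp only: geo_def fps_nth_Abs_fps central_of_nat)

lemma geo_inverse: "(1 - of_nat b * fps_X) * geo b = 1"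
proof -
  have "geo b = 1 + of_nat b * (fps_X * geo b)"
  proof (rule fps_ext)
    fix n
    have "fps_nth (of_nat b * (fps_X * geo b)) n = of_nat b * fps_nth (fps_X * geo b) n"
      by (metis fps_mult_left_const_nth fps_of_nat)
    then show "fps_nth (geo b) n = fps_nth (1 + of_nat b * (fps_X * geo b)) n"
      by (cases n) (simp_all add: geo_def)
  qed
  then have "geo b - of_nat b * (fps_X * geo b) = 1"
    by (simp only: diff_eq_eq)
  then show ?thesis by (simp add: left_diff_distrib mult.assoc)
qed

definition pole :: "nat \<Rightarrow> endo fps fps" where
  "pole b = of_nat b * geo b"

lemma central_h_ser: "central h_ser"
  by (rule central_fps_const) (rule central_fps_X)

lemma central_pole: "central (pole b)"
  unfolding pole_def by (intro central_mult central_of_nat central_geo)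

lemma central_h_ser_pole: "central (h_ser * pole b)"
  by (intro central_mult central_h_ser central_pole)

lemma central_rearrange:
  fixes H :: "'a::ring_1"
  assumes "central H" "central b" "central w" "central g"
  shows "H * (H * (b * (b * w * (g' * g)))) = w * ((H * (b * g)) * (H * (b * g')))"
proof -
  have c: "b * H = H * b" "b * (H * y) = H * (b * y)" "w * H = H * w" "w * (H * y) = H * (w * y)"
    "w * b = b * w" "w * (b * y) = b * (w * y)" "g * H = H * g" "g * (H * y) = H * (g * y)"
    "g * b = b * g" "g * (b * y) = b * (g * y)" "g' * g = g * g'" "g * (w * y) = w * (g * y)" for y
    using assms by (metis central_def mult.assoc)+
  show ?thesis by (simp add: mult.assoc c)
qed

text \<open>
  For $K = h b / (1 - b u)$ this is $K(u) - K(u-h) = K(u) K(u-h)$, the difference of two inverses.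
\<close>

lemma pole_shift: "h_ser * pole b - shift_down (h_ser * pole b) = h_ser * pole b * shift_down (h_ser * pole b)"
proof -
  define g' where "g' = shift_down (geo b)"
  have "shift_down ((1 - of_nat b * fps_X) * geo b) = 1" by (simp add: geo_inverse shift_down.hom_1)
  moreover have gX: "shift_down fps_X = (u_minus_h :: endo fps fps)" using shift_down_X_mult[of 1] by (simp add: shift_down.hom_1)
  ultimately have g': "(1 - of_nat b * u_minus_h) * g' = 1"
    by (simp only: shift_down.hom_mult shift_down.hom_diff shift_down.hom_1 hom_of_nat[OF shift_down.unital_hom_axioms] g'_def)
  have d: "geo b - g' = of_nat b * h_ser * (g' * geo b)"
    using inverse_difference[OF central_geo geo_inverse g']
    by (simp add: u_minus_h_def right_diff_distrib)
  have s: "shift_down (h_ser * pole b) = h_ser * (of_nat b * g')"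
    by (simp add: pole_def shift_down.hom_mult shift_down_const hom_of_nat[OF shift_down.unital_hom_axioms] g'_def)
  have "h_ser * pole b - shift_down (h_ser * pole b) = h_ser * (of_nat b * (geo b - g'))"
    unfolding s by (simp add: pole_def right_diff_distrib)
  also have "\<dots> = 1 * ((h_ser * (of_nat b * geo b)) * (h_ser * (of_nat b * g')))"
  proof -
    have "h_ser * (of_nat b * (of_nat b * h_ser * (g' * geo b))) = (h_ser * (of_nat b * geo b)) * (h_ser * (of_nat b * g'))"
    proof -
      have c: "of_nat b * (h_ser * y) = h_ser * (of_nat b * y)" "geo b * (h_ser * y) = h_ser * (geo b * y)"
        "geo b * (of_nat b * y) = of_nat b * (geo b * y)" "g' * geo b = geo b * g'" for y
        using central_h_ser central_geo[of b] central_of_nat[of b, where 'a = "endo fps fps"] by (metis central_def mult.assoc)+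
      show ?thesis by (simp only: mult.assoc c)
    qed
    then show ?thesis unfolding d by simp
  qed
  finally show ?thesis unfolding s by (simp add: pole_def)
qed

abbreviation spectral_diff :: "endo fps fps fps" where
  "spectral_diff \<equiv> in_first fps_X - in_second fps_X"

lemma central_spectral_diff: "central spectral_diff"
  unfolding in_second_X by (intro central_diff central_fps_const central_fps_X)

text \<open>
  For $K = h b / (1 - b u)$ this is $h (K(u) - K(v)) = (u - v) K(u) K(v)$.
\<close>

lemma pole_two_variables:
  "in_first h_ser * (in_first (h_ser * pole b) - in_second (h_ser * pole b))
    = spectral_diff * (in_first (h_ser * pole b) * in_second (h_ser * pole b))"
proof -
  define g g' where "g = in_first (geo b)" and "g' = in_second (geo b)"
  have n1: "in_first (of_nat b :: endo fps fps) = of_nat b" by (rule hom_of_nat) (rule fst_var.unital_hom_axioms)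
  have n2: "in_second (of_nat b :: endo fps fps) = of_nat b" by (rule hom_of_nat) (rule snd_var.unital_hom_axioms)
  have "in_first ((1 - of_nat b * fps_X) * geo b) = 1" "in_second ((1 - of_nat b * fps_X) * geo b) = 1"
    by (simp_all only: geo_inverse fst_var.hom_1 snd_var.hom_1)
  then have i: "(1 - of_nat b * in_first fps_X) * g = 1" "(1 - of_nat b * in_second fps_X) * g' = 1"
    by (simp_all only: fst_var.hom_mult fst_var.hom_diff fst_var.hom_1 snd_var.hom_mult snd_var.hom_diff snd_var.hom_1 n1 n2 g_def g'_def)
  have cg: "central g" unfolding g_def by (rule central_fps_const) (rule central_geo)
  have d: "g - g' = of_nat b * spectral_diff * (g' * g)"
    using inverse_difference[OF cg i] by (simp add: right_diff_distrib)
  have s: "in_first (h_ser * pole b) = in_first h_ser * (of_nat b * g)" "in_second (h_ser * pole b) = in_first h_ser * (of_nat b * g')"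
    unfolding pole_def fst_var.hom_mult snd_var.hom_mult n1 n2 in_second_const g_def g'_def by simp_all
  have "in_first h_ser * (in_first (h_ser * pole b) - in_second (h_ser * pole b))
     = in_first h_ser * (in_first h_ser * (of_nat b * (of_nat b * spectral_diff * (g' * g))))"
    unfolding s d[symmetric] by (simp only: right_diff_distrib)
  also have "\<dots> = spectral_diff * ((in_first h_ser * (of_nat b * g)) * (in_first h_ser * (of_nat b * g')))"
    by (rule central_rearrange) (intro central_fps_const central_fps_X central_of_nat central_spectral_diff cg)+
  finally show ?thesis unfolding s .
qed

text \<open>
  The evaluation matrix at $1/b$, with $b = k + 1$, acting on the variable $\alpha_k$. The points
  are distinct for distinct \<open>k\<close>, and $b$ is nonzero.
\<close>

definition evaluation :: "nat \<Rightarrow> 2 \<Rightarrow> 2 \<Rightarrow> endo fps fps" where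
  "evaluation k i j = of_bool (i = j) - h_ser * pole (Suc k) * op_const (gl k i j)"

fun monodromy :: "nat \<Rightarrow> 2 \<Rightarrow> 2 \<Rightarrow> endo fps fps" where
  "monodromy 0 = (\<lambda>i j. of_bool (i = j))"
| "monodromy (Suc N) = mat_prod (monodromy N) (evaluation N)"

lemma hom_gl_relation:
  assumes "unital_hom h"
  shows "h (gl k i j) * h (gl k p l) - h (gl k p l) * h (gl k i j)
     = of_bool (p = j) * h (gl k i l) - of_bool (i = l) * h (gl k p j)"
proof -
  interpret unital_hom h by fact
  have "h (gl k i j) * h (gl k p l) - h (gl k p l) * h (gl k i j) = h (gl k i j * gl k p l - gl k p l * gl k i j)"
    by (simp only: hom_mult hom_diff)
  also have "\<dots> = of_bool (p = j) * h (gl k i l) - of_bool (i = l) * h (gl k p j)"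
    unfolding gl_comm by (simp only: hom_mult hom_diff hom_of_bool)
  finally show ?thesis .
qed

lemma unital_hom_comp: "unital_hom g \<Longrightarrow> unital_hom h \<Longrightarrow> unital_hom (\<lambda>x. g (h x))"
  by (simp add: unital_hom_def)

lemma unital_hom_op_const: "unital_hom op_const" "unital_hom (\<lambda>A. in_first (op_const A))"
  by (rule unital_hom_comp[OF unital_hom_fps_const unital_hom_fps_const],
      rule unital_hom_comp[OF unital_hom_fps_const unital_hom_comp[OF unital_hom_fps_const unital_hom_fps_const]])

lemma pole_nth: "fps_nth (h_ser * pole b) n = fps_X * (of_nat b * of_nat (b ^ n))"
proof -
  have "fps_nth (of_nat b * geo b) n = of_nat b * fps_nth (geo b) n"
    using fps_mult_left_const_nth[of "of_nat b :: endo fps" "geo b" n] unfolding fps_of_nat .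
  then show ?thesis by (simp add: pole_def geo_def)
qed

lemma central_in_second_pole: "central (in_second (h_ser * pole b))"
  by (rule central_fps)
    (simp only: map_coeffs_nth pole_nth central_fps_const central_mult central_fps_X central_of_nat)

lemma evaluation_RTT: "RTT spectral_diff (in_first h_ser) (\<lambda>i j. in_first (evaluation k i j)) (\<lambda>i j. in_second (evaluation k i j))"
proof -
  have cu: "central (in_first (h_ser * pole (Suc k)))"
    by (rule central_fps_const) (rule central_h_ser_pole)
  have "RTT spectral_diff (in_first h_ser)
      (\<lambda>i j. of_bool (i = j) - in_first (h_ser * pole (Suc k)) * in_first (op_const (gl k i j)))
      (\<lambda>i j. of_bool (i = j) - in_second (h_ser * pole (Suc k)) * in_first (op_const (gl k i j)))"
  proof (rule RTT_evaluation)
    show "central (in_first h_ser)" by (intro central_fps_const central_fps_X)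
  qed (rule cu central_in_second_pole pole_two_variables hom_gl_relation[OF unital_hom_op_const(2)] central_spectral_diff)+
  then show ?thesis
    by (simp only: evaluation_def fst_var.hom_diff snd_var.hom_diff fst_var.hom_mult snd_var.hom_mult
      fst_var.hom_of_bool snd_var.hom_of_bool in_second_const)
qed

lemma evaluation_unimodular: "unimodular (evaluation k) (\<lambda>i j. shift_down (evaluation k i j))"
proof -
  have "unimodular (\<lambda>i j. of_bool (i = j) - h_ser * pole (Suc k) * op_const (gl k i j))
     (\<lambda>i j. of_bool (i = j) - shift_down (h_ser * pole (Suc k)) * op_const (gl k i j))"
  proof (rule unimodular_evaluation)
    interpret op_const: unital_hom op_const by (rule unital_hom_op_const)
    have "op_const (gl k 1 1 * gl k 2 2 - gl k 1 1 - gl k 2 1 * gl k 1 2) = 0" by (simp add: gl_casimir)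
    then show "op_const (gl k 1 1) * op_const (gl k 2 2) - op_const (gl k 1 1) - op_const (gl k 2 1) * op_const (gl k 1 2) = 0"
      by (simp only: op_const.hom_diff op_const.hom_mult)
    show "op_const (gl k 1 1) = - op_const (gl k 2 2)" using gl_trace[of k] by simp
    show "central (shift_down (h_ser * pole (Suc k)))"
    proof -
      have "central (shift_down z)" if c: "\<And>n. central (fps_nth z n)" for z :: "endo fps fps"
      proof (rule central_fps, rule central_fps)
        fix k N
        have cc: "central (fps_nth (fps_nth z n) N)" for n N
        proof -
          have "fps_nth (fps_nth z n * fps_const x) N = fps_nth (fps_const x * fps_nth z n) N" for x
            using c[of n] by (metis central_def)
          then show ?thesis by (simp add: central_def)
        qed
        have cs: "central (\<Sum>i\<in>A. f i)" if "\<And>i. central (f i)" for A :: "nat set" and f :: "nat \<Rightarrow> endo"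
          using that by (simp add: central_def sum_distrib_left sum_distrib_right)
        have cm: "central ((- 1) ^ n :: endo)" for n
          by (cases "even n") (simp_all add: central_def)
        show "central (fps_nth (fps_nth (shift_down z) k) N)"
          unfolding shift_down_def fps_nth_Abs_fps by (intro cs central_mult central_of_nat cm cc)
      qed
      moreover have "central (fps_nth (h_ser * pole (Suc k)) n)" for n
        by (simp only: pole_nth central_mult central_fps_X central_of_nat)
      ultimately show ?thesis by blast
    qed
  qed (rule central_h_ser_pole pole_shift hom_gl_relation[OF unital_hom_op_const(1)])+
  then show ?thesis
    by (simp only: evaluation_def[abs_def] shift_down.hom_diff shift_down.hom_mult[of "h_ser * pole (Suc k)"] shift_down.hom_of_bool shift_down_const)
qed

lemma commute_affine_central:
  assumes z: "central z" and "B * A = A * B"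
  shows "A * (of_bool b - z * B) = (of_bool b - z * B) * (A :: 'a::ring_1)"
proof -
  have "A * z = z * A"
    using z by (simp add: central_def)
  then have "A * z * B = z * A * B"
    by (rule arg_cong)
  then have "A * (z * B) = z * (A * B)"
    by (simp only: mult.assoc)
  then have "A * (z * B) = z * B * A"
    by (simp only: assms(2)[symmetric] mult.assoc)
  then show ?thesis by (cases b) (simp_all add: left_diff_distrib right_diff_distrib)
qed

lemma monodromy_commute: "N \<le> k \<Longrightarrow> op_const (gl k i j) * monodromy N p l = monodromy N p l * op_const (gl k i j)"
proof (induction N arbitrary: p l)
  case (Suc N)
  have "op_const (gl k i j) * evaluation N p l = evaluation N p l * op_const (gl k i j)" for p l
    unfolding evaluation_def
    by (rule commute_affine_central[OF central_h_ser_pole]) (use Suc.prems gl_commute_distinct[of N k] in simp)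
  note ev = this
  have mo: "op_const (gl k i j) * monodromy N p l = monodromy N p l * op_const (gl k i j)" for p l
    by (rule Suc.IH) (use Suc.prems in simp)
  have "op_const (gl k i j) * (monodromy N p a * evaluation N a l) = monodromy N p a * evaluation N a l * op_const (gl k i j)" for a
    unfolding mult.assoc[symmetric] mo unfolding mult.assoc ev ..
  then show ?case
    by (simp only: monodromy.simps mat_prod_def sum_distrib_left sum_distrib_right)
qed (simp add: of_bool_def)

lemma monodromy_RTT: "RTT spectral_diff (in_first h_ser) (\<lambda>i j. in_first (monodromy N i j)) (\<lambda>i j. in_second (monodromy N i j))"
proof (induction N)
  case 0
  show ?case
    by (simp add: RTT_def fst_var.hom_of_bool snd_var.hom_of_bool of_bool_def snd_var.hom_0)
next
  case (Suc N)
  have e: "op_const (gl N i j) * monodromy N p l = monodromy N p l * op_const (gl N i j)" for i j p l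
    by (rule monodromy_commute) simp
  have c1: "in_first (monodromy N i j) * in_second (evaluation N k l) = in_second (evaluation N k l) * in_first (monodromy N i j)" for i j k l
  proof -
    have "in_first (op_const (gl N k l)) * in_first (monodromy N i j) = in_first (monodromy N i j) * in_first (op_const (gl N k l))"
      by (simp only: fst_var.hom_mult[symmetric] e)
    then show ?thesis
      unfolding evaluation_def snd_var.hom_diff snd_var.hom_of_bool snd_var.hom_mult[of "h_ser * pole (Suc N)"] in_second_const
      by (rule commute_affine_central[OF central_in_second_pole])
  qed
  have c2: "in_second (monodromy N i j) * in_first (evaluation N k l) = in_first (evaluation N k l) * in_second (monodromy N i j)" for i j k l
  proof -
    have "in_second (op_const (gl N k l)) * in_second (monodromy N i j) = in_second (monodromy N i j) * in_second (op_const (gl N k l))"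
      by (simp only: snd_var.hom_mult[symmetric] e)
    then show ?thesis
      unfolding evaluation_def fst_var.hom_diff fst_var.hom_of_bool fst_var.hom_mult[of "h_ser * pole (Suc N)"] in_second_const
      by (rule commute_affine_central[OF central_fps_const[OF central_h_ser_pole]])
  qed
  have "RTT spectral_diff (in_first h_ser)
     (mat_prod (\<lambda>i j. in_first (monodromy N i j)) (\<lambda>i j. in_first (evaluation N i j)))
     (mat_prod (\<lambda>i j. in_second (monodromy N i j)) (\<lambda>i j. in_second (evaluation N i j)))"
    by (rule RTT_mat_prod[OF central_spectral_diff _ Suc evaluation_RTT c1 c2])
      (intro central_fps_const central_fps_X)
  moreover have "mat_prod (\<lambda>i j. in_first (monodromy N i j)) (\<lambda>i j. in_first (evaluation N i j))
      = (\<lambda>i j. in_first (monodromy (Suc N) i j))"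
    "mat_prod (\<lambda>i j. in_second (monodromy N i j)) (\<lambda>i j. in_second (evaluation N i j))
      = (\<lambda>i j. in_second (monodromy (Suc N) i j))"
    by (intro ext; simp only: mat_prod_def monodromy.simps fst_var.hom_sum snd_var.hom_sum fst_var.hom_mult snd_var.hom_mult)+
  ultimately show ?case by simp
qed

lemma monodromy_unimodular: "unimodular (monodromy N) (\<lambda>i j. shift_down (monodromy N i j))"
proof (induction N)
  case 0
  show ?case
    unfolding unimodular_def two_cases by (simp add: eps_def shift_down.hom_1 shift_down.hom_0)
next
  case (Suc N)
  have c: "shift_down (monodromy N i j) * evaluation N k l = evaluation N k l * shift_down (monodromy N i j)" for i j k l
  proof -
    have "op_const (gl N k l) * shift_down (monodromy N i j) = shift_down (op_const (gl N k l) * monodromy N i j)"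
      by (simp only: shift_down.hom_mult shift_down_const)
    also have "op_const (gl N k l) * monodromy N i j = monodromy N i j * op_const (gl N k l)"
      by (rule monodromy_commute) simp
    finally have "op_const (gl N k l) * shift_down (monodromy N i j) = shift_down (monodromy N i j) * op_const (gl N k l)"
      by (simp only: shift_down.hom_mult shift_down_const)
    then show ?thesis
      unfolding evaluation_def by (intro commute_affine_central central_h_ser_pole)
  qed
  have "unimodular (mat_prod (monodromy N) (evaluation N))
     (mat_prod (\<lambda>i j. shift_down (monodromy N i j)) (\<lambda>i j. shift_down (evaluation N i j)))"
    by (rule unimodular_mat_prod[OF Suc evaluation_unimodular c])
  moreover have "mat_prod (\<lambda>i j. shift_down (monodromy N i j)) (\<lambda>i j. shift_down (evaluation N i j))
      = (\<lambda>i j. shift_down (monodromy (Suc N) i j))"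
    by (intro ext) (simp only: mat_prod_def monodromy.simps shift_down.hom_sum shift_down.hom_mult)
  ultimately show ?case by simp
qed

section \<open>Functionals on the dual Yangian\<close>

fun current :: "nat \<Rightarrow> 2 \<Rightarrow> 2 \<Rightarrow> endo fps fps" where
  "current 0 = (\<lambda>i j. 0)"
| "current (Suc N) = (\<lambda>i j. current N i j + pole (Suc N) * op_const (gl N i j)
      - h_ser * (\<Sum>a\<in>UNIV. current N i a * (pole (Suc N) * op_const (gl N a j))))"

text \<open>
  The matrices are $1 - h X(u)$, in the same normalisation as $T^+(u)$, so the coefficients
  of $X(u)$ are the images of the generators.
\<close>

lemma monodromy_current: "monodromy N i j = of_bool (i = j) - h_ser * current N i j"
proof (induction N arbitrary: i j)
  case (Suc N)
  define Y where "Y = (\<lambda>a j. pole (Suc N) * op_const (gl N a j))"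
  have hx: "current N i a * (h_ser * y) = h_ser * (current N i a * y)" for a y
    using fps_const_X_central[of "current N i a"] by (simp only: mult.assoc[symmetric])
  have "(of_bool (i = a) - h_ser * current N i a) * (of_bool (a = j) - h_ser * Y a j)
    = of_bool (i = a) * of_bool (a = j) - of_bool (i = a) * (h_ser * Y a j) - (h_ser * current N i a) * of_bool (a = j)
      + h_ser * (h_ser * (current N i a * Y a j))" for a
    by (simp add: left_diff_distrib right_diff_distrib mult.assoc hx)
  then have "monodromy (Suc N) i j = (\<Sum>a\<in>UNIV. of_bool (i = a) * of_bool (a = j) - of_bool (i = a) * (h_ser * Y a j)
      - (h_ser * current N i a) * of_bool (a = j) + h_ser * (h_ser * (current N i a * Y a j)))"
    by (simp add: mat_prod_def evaluation_def Suc Y_def mult.assoc)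
  also have "\<dots> = of_bool (i = j) - h_ser * Y i j - h_ser * current N i j + (\<Sum>a\<in>UNIV. h_ser * (h_ser * (current N i a * Y a j)))"
    by (simp add: sum.distrib sum_subtractf of_bool_def if_distrib[of "\<lambda>x. x * _"] if_distrib[of "\<lambda>x. _ * x"] cong: if_cong)
  also have "\<dots> = of_bool (i = j) - h_ser * current (Suc N) i j"
    by (simp add: Y_def distrib_left right_diff_distrib sum_distrib_left)
  finally show ?case .
qed simp

definition gen_action :: "nat \<Rightarrow> gen \<Rightarrow> endo fps" where
  "gen_action N g = (case g of Gen i j k \<Rightarrow> fps_nth (current N i j) k)"

definition raising :: "nat \<Rightarrow> nat \<Rightarrow> endo" where
  "raising N n = (\<Sum>k<N. of_nat (Suc k ^ Suc n) * op12 k)"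

lemma fps_of_nat_mult_nth: "fps_nth (of_nat b * g) n = of_nat b * fps_nth g n"
  using fps_mult_left_const_nth[of "of_nat b" g n] unfolding fps_of_nat .

text \<open>
  Modulo $h$ the coproduct is additive, hence $x(-n-1)$ acts by $\sum_k b_k^{n+1} E_{12}^{(k)}$.
\<close>

lemma current_leading: "fps_nth (fps_nth (current N 1 2) n) 0 = raising N n"
proof (induction N)
  case (Suc N)
  have "fps_nth (fps_nth (pole (Suc N) * op_const (gl N 1 2)) n) 0 = of_nat (Suc N ^ Suc n) * op12 N"
  proof -
    have "fps_nth (pole (Suc N) * op_const (gl N 1 2)) n = of_nat (Suc N) * of_nat (Suc N ^ n) * fps_const (op12 N)"
      by (simp add: pole_def fps_of_nat_mult_nth geo_def gl_simps del: of_nat_Suc)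
    also have "\<dots> = of_nat (Suc N ^ Suc n) * fps_const (op12 N)"
      by (simp only: of_nat_mult power_Suc)
    finally show ?thesis by (simp only: fps_of_nat_mult_nth fps_nth_fps_const if_True simp_thms)
  qed
  then show ?case
    using Suc by (simp add: raising_def)
qed (simp add: raising_def)

abbreviation rep :: "nat \<Rightarrow> falg \<Rightarrow> endo fps" where
  "rep N \<equiv> action (gen_action N)"

interpretation rep: unital_hom "rep N" for N
  by (rule unital_hom_action)
interpretation rep1: unital_hom "map_coeffs (rep N)" for N
  by (rule unital_hom_map_coeffs) (rule unital_hom_action)
interpretation rep2: unital_hom "map_coeffs (map_coeffs (rep N))" for N
  by (intro unital_hom_map_coeffs unital_hom_action)

lemma rep1_const: "map_coeffs (rep N) (fps_const a) = fps_const (rep N a)"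
  by (rule fps_ext) (simp add: rep.hom_0)

lemma rep_tgen: "rep N (tgen i j (Suc k)) = fps_nth (current N i j) k"
  by (simp add: action_tgen gen_action_def)

lemma rep_tplus: "map_coeffs (rep N) (tplus i j) = monodromy N i j"
proof -
  have "map_coeffs (rep N) (gen_series i j) = current N i j"
    by (rule fps_ext) (simp add: gen_series_def action_tgen gen_action_def)
  then show ?thesis
    by (simp only: tplus_def rep1.hom_diff rep1.hom_of_bool rep1.hom_mult rep1_const action_X monodromy_current)
qed

lemma rep2_in_u: "map_coeffs (map_coeffs (rep N)) (in_u f) = in_first (map_coeffs (rep N) f)"
  by (rule fps_ext) (simp add: in_u_def rep1.hom_0)

lemma rep2_in_v: "map_coeffs (map_coeffs (rep N)) (in_v f) = in_second (map_coeffs (rep N) f)"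
  by (rule fps_ext) (simp add: in_v_def rep1_const)

lemma rep1_X: "map_coeffs (rep N) fps_X = fps_X"
  by (rule fps_ext) (simp add: fps_X_nth rep.hom_0 rep.hom_1)

lemma rep_rtt: "map_coeffs (map_coeffs (rep N)) (rtt $ a $ b) = 0"
proof -
  obtain i k j l where ab: "a = (i, k)" "b = (j, l)" by (metis surj_pair)
  define u v where "u = (\<lambda>i j. in_first (monodromy N i j))" and "v = (\<lambda>i j. in_second (monodromy N i j))"
  have hh: "map_coeffs (map_coeffs (rep N)) hh = in_first h_ser"
    unfolding hh_def by (rule fps_ext) (simp add: rep1.hom_0 rep1_const action_X)
  have "map_coeffs (map_coeffs (rep N)) (rtt $ a $ b) = (spectral_diff * u i j * v k l - in_first h_ser * u k j * v i l)
      - (v k l * u i j * spectral_diff - v k j * u i l * in_first h_ser)"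
    unfolding ab rtt_entry
    by (simp only: rep2.hom_diff rep2.hom_mult rep2_in_u rep2_in_v rep_tplus rep1_X hh u_def v_def)
  also have "\<dots> = spectral_diff * (u i j * v k l - v k l * u i j) - in_first h_ser * (u k j * v i l - v k j * u i l)"
  proof -
    have "v k l * u i j * spectral_diff = spectral_diff * (v k l * u i j)"
      using central_spectral_diff by (simp only: central_def)
    moreover have "v k j * u i l * in_first h_ser = in_first h_ser * (v k j * u i l)"
      using central_fps_const[OF central_h_ser] by (simp only: central_def)
    ultimately show ?thesis by (simp only: right_diff_distrib mult.assoc) simp
  qed
  also have "\<dots> = 0"
    using monodromy_RTT[of N] unfolding RTT_def u_def v_def by simp
  finally show ?thesis .
qed

lemma rep_qdet: "map_coeffs (rep N) (qdet - 1) = 0"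
proof -
  have s: "map_coeffs (rep N) (shift_series (- 1) f) = shift_down (map_coeffs (rep N) f)" for f
    unfolding shift_series_eq_shift_down by (rule shift_down_fmap[OF unital_hom_action action_X])
  have "map_coeffs (rep N) qdet = eps 1 2"
    using monodromy_unimodular[of N] unfolding unimodular_def
    by (simp only: qdet_def rep1.hom_diff rep1.hom_mult s rep_tplus)
  then show ?thesis by (simp add: rep1.hom_diff rep1.hom_1 eps_def)
qed

lemma fps_X_power_cancel: "fps_X ^ n * x = 0 \<Longrightarrow> (x :: 'a::ring_1 fps) = 0"
proof (rule fps_ext)
  fix k
  assume "fps_X ^ n * x = 0"
  then have "fps_nth (fps_X ^ n * x) (n + k) = 0" by simp
  then show "fps_nth x k = fps_nth 0 k" by (simp add: fps_X_power_mult_nth)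
qed

text \<open>
  The relators are defined by division by $h^2$ and by $h$, which is harmless because operator-valued power series have no
  $h$-torsion.
\<close>

lemma rep_relator: "\<rho> \<in> relators \<Longrightarrow> rep N \<rho> = 0"
proof -
  assume "\<rho> \<in> relators"
  then consider a b r s where "fps_X ^ 2 * \<rho> = fps_nth (fps_nth (rtt $ a $ b) s) r"
    | r where "fps_X ^ 1 * \<rho> = fps_nth (qdet - 1) r"
    by (auto simp: relators_def)
  then show ?thesis
  proof cases
    case 1
    have "fps_X ^ 2 * rep N \<rho> = rep N (fps_nth (fps_nth (rtt $ a $ b) s) r)"
      by (simp only: 1[symmetric] rep.hom_mult rep.hom_power action_X)
    also have "\<dots> = fps_nth (fps_nth (map_coeffs (map_coeffs (rep N)) (rtt $ a $ b)) s) r"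
      by simp
    also have "\<dots> = 0" unfolding rep_rtt by simp
    finally show ?thesis by (rule fps_X_power_cancel)
  next
    case 2
    have "fps_X ^ 1 * rep N \<rho> = rep N (fps_nth (qdet - 1) r)"
      by (simp only: 2[symmetric] rep.hom_mult rep.hom_power action_X)
    also have "\<dots> = fps_nth (map_coeffs (rep N) (qdet - 1)) r"
      by simp
    also have "\<dots> = 0" unfolding rep_qdet by simp
    finally show ?thesis by (rule fps_X_power_cancel)
  qed
qed

lemma rep_relation_ideal: "x \<in> relation_ideal \<Longrightarrow> rep N x = 0"
  by (induction rule: relation_ideal.induct)
    (simp_all add: rep.hom_0 rep.hom_add rep.hom_mult rep_relator)

lemma rep_closed_ideal:
  assumes "x \<in> closed_ideal"
  shows "rep N x = 0"
proof (rule fps_ext)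
  fix n
  obtain y z where y: "y \<in> relation_ideal" "x - y = fps_X ^ Suc n * z"
    using assms unfolding hadic_closure_def by blast
  have "rep N x = rep N (x - y)"
    using rep_relation_ideal[OF y(1)] by (simp add: rep.hom_diff)
  also have "\<dots> = fps_X ^ Suc n * rep N z"
    by (simp only: y(2) rep.hom_mult rep.hom_power action_X)
  finally show "fps_nth (rep N x) n = fps_nth 0 n"
    by (simp add: fps_X_power_mult_nth del: power_Suc)
qed

text \<open>
  The combination of row $r + 1$ with $-b_N$ times row $r$ does not contain the last unknown.
\<close>

lemma vandermonde_solvable:
  fixes b :: "nat \<Rightarrow> complex" and p :: "nat \<Rightarrow> poly_ring"
  assumes "inj_on b {..<N}" "\<And>k. k < N \<Longrightarrow> b k \<noteq> 0"
  shows "\<exists>Y. \<forall>r<N. (\<Sum>k<N. single 0 (b k ^ Suc r) * Y k) = p r"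
  using assms
proof (induction N arbitrary: p)
  case (Suc N)
  define sc where "sc = (\<lambda>a :: complex. single (0 :: nat multiset) a)"
  have sc_mult: "sc (a * a') = sc a * sc a'" and sc_diff: "sc (a - a') = sc a - sc a'" and sc_1: "sc 1 = 1" for a a'
    by (simp_all add: sc_def mult_single single_diff)
  have bN: "b k - b N \<noteq> 0" if "k < N" for k
    using Suc.prems(1) that by (auto simp: inj_on_def)
  have bN0: "b N \<noteq> 0" using Suc.prems(2) by simp
  obtain Z where Z: "\<And>r. r < N \<Longrightarrow> (\<Sum>k<N. sc (b k ^ Suc r) * Z k) = p (Suc r) - sc (b N) * p r"
    using Suc.IH[of "\<lambda>r. p (Suc r) - sc (b N) * p r"] Suc.prems unfolding sc_def
    by (auto simp: inj_on_def)
  define Y' where "Y' = (\<lambda>k. sc (1 / (b k - b N)) * Z k)"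
  define YN where "YN = sc (1 / b N) * (p 0 - (\<Sum>k<N. sc (b k) * Y' k))"
  define Y where "Y = Y'(N := YN)"
  have Z_Y': "Z k = sc (b k - b N) * Y' k" if "k < N" for k
  proof -
    have "sc (b k - b N) * Y' k = sc ((b k - b N) * (1 / (b k - b N))) * Z k"
      by (simp only: Y'_def sc_mult mult.assoc)
    then show ?thesis using bN[OF that] by (simp add: sc_1)
  qed
  have sum_Y: "(\<Sum>k<Suc N. sc (b k ^ Suc r) * Y k) = (\<Sum>k<N. sc (b k ^ Suc r) * Y' k) + sc (b N ^ Suc r) * YN" for r
    by (simp add: Y_def)
  have YN: "sc (b N) * YN = p 0 - (\<Sum>k<N. sc (b k) * Y' k)"
  proof -
    have "sc (b N) * YN = sc (b N * (1 / b N)) * (p 0 - (\<Sum>k<N. sc (b k) * Y' k))"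
      by (simp only: YN_def sc_mult mult.assoc)
    then show ?thesis using bN0 by (simp add: sc_1)
  qed
  have "(\<Sum>k<Suc N. sc (b k ^ Suc r) * Y k) = p r" if "r < Suc N" for r
    using that
  proof (induction r)
    case 0
    show ?case unfolding sum_Y by (simp add: YN)
  next
    case (Suc r)
    have "(\<Sum>k<Suc N. sc (b k ^ Suc (Suc r)) * Y k)
       = sc (b N) * ((\<Sum>k<N. sc (b k ^ Suc r) * Y' k) + sc (b N ^ Suc r) * YN)
         + (\<Sum>k<N. sc (b k ^ Suc r) * (sc (b k - b N) * Y' k))"
      unfolding sum_Y
      by (simp add: sc_mult sc_diff distrib_left sum_distrib_left sum_subtractf algebra_simps)
    also have "(\<Sum>k<N. sc (b k ^ Suc r) * (sc (b k - b N) * Y' k)) = p (Suc r) - sc (b N) * p r"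
      using Z[of r] Suc.prems by (simp add: Z_Y' del: power_Suc)
    also have "(\<Sum>k<N. sc (b k ^ Suc r) * Y' k) + sc (b N ^ Suc r) * YN = p r"
      using Suc.IH Suc.prems unfolding sum_Y by simp
    finally show ?case by simp
  qed
  then show ?case unfolding sc_def by blast
qed simp

lemma fps_nth_prod_list_0: "fps_nth (prod_list xs) 0 = prod_list (map (\<lambda>x. fps_nth x 0) (xs :: 'a::ring_1 fps list))"
  by (induction xs) simp_all

text \<open>
  Let $Y_k$ be the combination of the variables that solves $\sum_k b_k^{r+1} Y_k = x_r$ for $r < N$.
  The vector $\beta \mapsto f(z \prod_k Y_k^{\beta_k})$ is turned by $E_{12}^{(k)}$ into the one with $z$
  replaced by $z Y_k$, hence by the leading term of $x(-r-1)$ into the one with $z$ replaced by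
  $z x_r$. Starting from $z = 1$ and evaluating at $\beta = 0$ recovers $f$ on all
  monomials in the first $N$ variables.
\<close>

theorem coefficient_functional_extends:
  fixes c :: "nat multiset \<Rightarrow> complex" and N :: nat
  shows "\<exists>\<Lambda> :: dual_yangian \<Rightarrow> complex fps.
    (\<forall>x y. \<Lambda> (x + y) = \<Lambda> x + \<Lambda> y) \<and> (\<forall>f x. \<Lambda> (hscale f x) = f * \<Lambda> x) \<and>
    (\<forall>ks. set ks \<subseteq> {..<N} \<longrightarrow> fps_nth (\<Lambda> (prod_list (map (\<lambda>k. x_gen (Suc k)) ks))) 0 = c (mset ks))"
proof -
  obtain Y where Y: "\<And>r. r < N \<Longrightarrow> (\<Sum>k<N. single 0 (of_nat (Suc k) ^ Suc r) * Y k) = var r"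
    using vandermonde_solvable[of "\<lambda>k. of_nat (Suc k)" N var] by (auto simp: inj_on_def simp del: of_nat_Suc power_Suc)
  define Ym where "Ym = (\<lambda>\<beta> :: nat \<Rightarrow> nat. \<Prod>k<N. Y k ^ \<beta> k)"
  define V where "V = (\<lambda>z \<beta>. functional c (z * Ym \<beta>))"
  have Ym_Suc: "Ym (\<beta>(k := Suc (\<beta> k))) = Y k * Ym \<beta>" if "k < N" for k \<beta>
  proof -
    have "Ym (\<beta>(k := Suc (\<beta> k))) = Y k ^ Suc (\<beta> k) * (\<Prod>i\<in>{..<N} - {k}. Y i ^ \<beta> i)"
      unfolding Ym_def using that by (subst prod.remove[of _ k]) (auto intro!: prod.cong)
    also have "\<dots> = Y k * (\<Prod>i<N. Y i ^ \<beta> i)"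
      using that by (subst prod.remove[of _ k]) (auto simp: mult.assoc)
    finally show ?thesis by (simp add: Ym_def)
  qed
  have raise: "app (raising N r) (V z) = V (z * var r)" if "r < N" for r z
  proof
    fix \<beta>
    have "app (raising N r) (V z) \<beta> = (\<Sum>k<N. of_nat (Suc k) ^ Suc r * functional c (z * (Y k * Ym \<beta>)))"
      unfolding raising_def app_sum V_def by (intro sum.cong refl) (simp add: Ym_Suc del: of_nat_Suc power_Suc flip: of_nat_power)
    also have "\<dots> = functional c (\<Sum>k<N. single 0 (of_nat (Suc k) ^ Suc r) * (z * (Y k * Ym \<beta>)))"
      by (simp only: functional_sum functional_scale)
    also have "(\<Sum>k<N. single 0 (of_nat (Suc k) ^ Suc r) * (z * (Y k * Ym \<beta>)))
       = z * (\<Sum>k<N. single 0 (of_nat (Suc k) ^ Suc r) * Y k) * Ym \<beta>"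
      by (simp only: sum_distrib_left sum_distrib_right mult_ac)
    finally show "app (raising N r) (V z) \<beta> = V (z * var r) \<beta>"
      using Y[OF that] by (simp only: V_def)
  qed
  have words: "app (prod_list (map (raising N) ks)) (V z) = V (z * single (mset ks) 1)"
    if "set ks \<subseteq> {..<N}" for ks z
    using that
  proof (induction ks)
    case (Cons k ks)
    then have "app (prod_list (map (raising N) (k # ks))) (V z) = V (z * single (mset ks) 1 * var k)"
      by (simp add: raise)
    also have "z * single (mset ks) 1 * var k = z * single (mset (k # ks)) 1"
      by (simp add: var_def mult.assoc mult_single)
    finally show ?case .
  qed simp
  define L where "L = (\<lambda>a. Abs_fps (\<lambda>n. app (fps_nth (rep N a) n) (V 1) (\<lambda>_. 0)))"
  define \<Lambda> where "\<Lambda> = (\<lambda>y. L (SOME a. yangian_of a = y))"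
  have \<Lambda>: "\<Lambda> (yangian_of a) = L a" for a
  proof -
    have "yangian_of (SOME b. yangian_of b = yangian_of a) = yangian_of a"
      by (rule someI) (rule refl)
    then have "(SOME b. yangian_of b = yangian_of a) - a \<in> closed_ideal"
      by (simp add: yangian_of_diff flip: yangian_of_eq_0_iff)
    from rep_closed_ideal[OF this, of N]
    have "rep N (SOME b. yangian_of b = yangian_of a) = rep N a"
      by (simp add: rep.hom_diff)
    then show ?thesis by (simp add: \<Lambda>_def L_def)
  qed
  have "\<Lambda> (x + y) = \<Lambda> x + \<Lambda> y" for x y
  proof -
    obtain a b where "x = yangian_of a" "y = yangian_of b" using yangian_of_surj by metis
    then show ?thesis
      by (simp add: \<Lambda> flip: yangian_of_add) (rule fps_ext, simp add: L_def rep.hom_add)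
  qed
  moreover have "\<Lambda> (hscale f x) = f * \<Lambda> x" for f x
  proof -
    obtain a where "x = yangian_of a" using yangian_of_surj by metis
    then have "\<Lambda> (hscale f x) = L (falg_of_series f * a)" "\<Lambda> x = L a"
      by (simp_all add: \<Lambda> hscale_def flip: yangian_of_mult)
    moreover have "L (falg_of_series f * a) = f * L a"
      by (rule fps_ext) (simp add: L_def rep.hom_mult action_series fps_mult_nth app_sum)
    ultimately show ?thesis by simp
  qed
  moreover have "fps_nth (\<Lambda> (prod_list (map (\<lambda>k. x_gen (Suc k)) ks))) 0 = c (mset ks)"
    if "set ks \<subseteq> {..<N}" for ks
  proof -
    have "prod_list (map (\<lambda>k. x_gen (Suc k)) ks) = yangian_of (prod_list (map (\<lambda>k. tgen 1 2 (Suc k)) ks))"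
      by (induction ks) (simp_all add: x_gen_def yangian_of_1 yangian_of_mult)
    moreover have "rep N (prod_list (map (\<lambda>k. tgen 1 2 (Suc k)) ks))
        = prod_list (map (\<lambda>k. fps_nth (current N 1 2) k) ks)"
      by (induction ks) (simp_all add: rep.hom_1 rep.hom_mult rep_tgen del: One_nat_def)
    moreover have "fps_nth (prod_list (map (\<lambda>k. fps_nth (current N 1 2) k) ks)) 0 = prod_list (map (raising N) ks)"
      by (simp add: fps_nth_prod_list_0 current_leading o_def)
    ultimately have "fps_nth (\<Lambda> (prod_list (map (\<lambda>k. x_gen (Suc k)) ks))) 0
       = app (prod_list (map (raising N) ks)) (V 1) (\<lambda>_. 0)"
      by (simp add: \<Lambda> L_def)
    also have "\<dots> = V (1 * single (mset ks) 1) (\<lambda>_. 0)"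
      unfolding words[OF that] ..
    also have "\<dots> = c (mset ks)" by (simp add: V_def Ym_def)
    finally show ?thesis .
  qed
  ultimately show ?thesis by (intro exI[of _ \<Lambda>]) blast
qed

section \<open>The generators of the principal subspace commute\<close>

lemma in_u_in_v_nth:
  "fps_nth (fps_nth (in_u f * in_v g) s) r = fps_nth f r * fps_nth g s"
  "fps_nth (fps_nth (in_v g * in_u f) s) r = fps_nth g s * fps_nth f r"
  by (simp_all add: in_u_def in_v_def)

lemma hbar_central: "hbar * x = x * hbar"
proof -
  obtain a where "x = yangian_of a" using yangian_of_surj by blast
  then show ?thesis by (simp add: hbar_def fps_X_commute flip: yangian_of_mult)
qed

lemma hbar_power_central: "hbar ^ n * x = x * hbar ^ n"
  by (induction n) (simp_all add: mult.assoc, metis hbar_central mult.assoc)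

definition x_comm :: "nat \<Rightarrow> nat \<Rightarrow> dual_yangian" where
  "x_comm r s = x_gen (Suc r) * x_gen (Suc s) - x_gen (Suc s) * x_gen (Suc r)"

text \<open>
  The entry of the RTT relation for $t_{12}(u)$ and $t_{12}(v)$ is $h^2 (u - v - h) [x(u), x(v)]$.
\<close>

lemma x_comm_relation:
  "(if r = 0 then 0 else x_comm (r - 1) s) - (if s = 0 then 0 else x_comm r (s - 1)) = hbar * x_comm r s"
proof -
  define u v where "u = in_u (gen_series 1 2)" and "v = in_v (gen_series 1 2)"
  define D where "D = u * v - v * u"
  have tu: "in_u (tplus 1 2) = - (hh * u)"
    by (simp add: u_def in_u_def tplus_def hh_def flip: fps_const_mult fps_const_neg)
  have tv: "in_v (tplus 1 2) = - (hh * v)"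
    unfolding v_def by (intro fps_ext) (auto simp: in_v_def tplus_def hh_def)
  have vX: "in_v fps_X = (fps_X :: falg fps fps)"
    by (intro fps_ext) (auto simp: in_v_def fps_X_def)
  have w: "(in_u fps_X - in_v fps_X) * x = x * (in_u fps_X - in_v fps_X)" for x :: "falg fps fps"
    unfolding vX in_u_def
    by (simp add: left_diff_distrib right_diff_distrib fps_X_central fps_const_X_central)
  have hx: "u * (hh * y) = hh * (u * y)" "v * (hh * y) = hh * (v * y)" for y
    by (metis hh_commute mult.assoc)+
  have "rtt $ (1, 1) $ (2, 2) = (in_u fps_X - in_v fps_X) * (hh * u * (hh * v)) - hh * (hh * u * (hh * v))
      - ((in_u fps_X - in_v fps_X) * (hh * v * (hh * u)) - hh * (hh * v * (hh * u)))"
    unfolding rtt_entry tu tv by (simp only: mult_minus_left mult_minus_right minus_minus mult.assoc)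
      (simp only: mult.assoc[symmetric] w[symmetric, of "hh * v * hh * u"] hh_commute[of "hh * v * hh * u", symmetric])
  also have "\<dots> = hh ^ 2 * ((in_u fps_X - in_v fps_X - hh) * D)"
  proof -
    have "(in_u fps_X - in_v fps_X) * (hh * (hh * y)) = hh * (hh * ((in_u fps_X - in_v fps_X) * y))" for y
      by (metis hh_commute mult.assoc)
    then show ?thesis
      by (simp only: D_def mult.assoc hx power2_eq_square left_diff_distrib[of _ _ "_ - _"] right_diff_distrib[of _ "_ * _" "_ * _"])
        (simp add: right_diff_distrib left_diff_distrib mult.assoc algebra_simps)
  qed
  finally have rtt: "rtt $ (1, 1) $ (2, 2) = hh ^ 2 * ((in_u fps_X - in_v fps_X - hh) * D)" .
  define \<rho> where "\<rho> = fps_nth (fps_nth ((in_u fps_X - in_v fps_X - hh) * D) s) r"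
  have "hh ^ 2 = fps_const (fps_const (fps_X ^ 2))"
    by (simp add: hh_def power2_eq_square)
  then have "fps_X ^ 2 * \<rho> = fps_nth (fps_nth (rtt $ (1, 1) $ (2, 2)) s) r"
    unfolding rtt \<rho>_def by simp
  then have "\<rho> \<in> relators" unfolding relators_def by blast
  then have "\<rho> \<in> closed_ideal"
    using relation_ideal.relator[of \<rho> 1 1] by (intro closed_ideal_base) simp
  then have z: "yangian_of \<rho> = 0" by (simp only: yangian_of_eq_0_iff)
  have D: "yangian_of (fps_nth (fps_nth D s) r) = x_comm r s" for r s
    by (simp add: D_def u_def v_def in_u_in_v_nth yangian_of_diff yangian_of_mult x_comm_def x_gen_def gen_series_def)
  have rho: "\<rho> = (if r = 0 then 0 else fps_nth (fps_nth D s) (r - 1)) - (if s = 0 then 0 else fps_nth (fps_nth D (s - 1)) r)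
      - fps_X * fps_nth (fps_nth D s) r"
    unfolding \<rho>_def vX by (simp add: left_diff_distrib in_u_def hh_def)
  have "yangian_of \<rho> = (if r = 0 then 0 else x_comm (r - 1) s) - (if s = 0 then 0 else x_comm r (s - 1)) - hbar * x_comm r s"
  proof -
    have "yangian_of 0 = 0" by (simp only: yangian_of_eq_0_iff closed_ideal_zero)
    then show ?thesis unfolding rho by (simp add: yangian_of_diff yangian_of_mult D hbar_def)
  qed
  with z show ?thesis by simp
qed

lemma hbar_descent:
  fixes f :: "nat \<Rightarrow> dual_yangian"
  assumes "\<And>s. f s = hbar * - f (Suc s)"
  shows "f s = 0"
proof (rule yangian_separated)
  fix n
  show "\<exists>z. f s = hbar ^ n * z"
  proof (induction n arbitrary: s)
    case (Suc n)
    obtain z where z: "f (Suc s) = hbar ^ n * z" using Suc by blast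
    have "f s = hbar * - (hbar ^ n * z)" by (subst assms) (simp only: z)
    then have "f s = hbar ^ Suc n * - z" by (simp add: mult.assoc)
    then show ?case by blast
  qed simp
qed

text \<open>
  In $(u - v - h) [x(u), x(v)] = 0$, each coefficient is $-h$ times the next one in the $v$-direction, once the
  coefficients at lower powers of $u$ vanish. It is thus divisible by all powers of $h$.
\<close>

lemma x_gen_commute: "x_gen (Suc r) * x_gen (Suc s) = x_gen (Suc s) * x_gen (Suc r)"
proof -
  have "x_comm r s = 0" for s
  proof (induction r arbitrary: s)
    case 0
    show ?case
    proof (rule hbar_descent[where f = "x_comm 0"])
      fix s
      have "- x_comm 0 s = hbar * x_comm 0 (Suc s)" using x_comm_relation[of 0 "Suc s"] by simp
      from arg_cong[OF this, of uminus] show "x_comm 0 s = hbar * - x_comm 0 (Suc s)" by simp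
    qed
  next
    case (Suc r)
    show ?case
    proof (rule hbar_descent[where f = "x_comm (Suc r)"])
      fix s
      have "- x_comm (Suc r) s = hbar * x_comm (Suc r) (Suc s)"
        using x_comm_relation[of "Suc r" "Suc s"] Suc.IH[of "Suc s"] by simp
      from arg_cong[OF this, of uminus] show "x_comm (Suc r) s = hbar * - x_comm (Suc r) (Suc s)" by simp
    qed
  qed
  then show ?thesis by (simp add: x_comm_def)
qed

section \<open>The subalgebra generated by $x(-1), x(-2), \ldots$ and its closure\<close>

lemma prod_list_commute:
  fixes f :: "'a \<Rightarrow> 'b::monoid_mult"
  assumes c: "\<And>a b. f a * f b = f b * f a" and "mset xs = mset ys"
  shows "prod_list (map f xs) = prod_list (map f ys)"
  using assms(2)
proof (induction xs arbitrary: ys)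
  case (Cons x xs)
  have move: "prod_list (map f as) * f x = f x * prod_list (map f as)" for as
  proof (induction as)
    case (Cons a as)
    have "prod_list (map f (a # as)) * f x = f a * (f x * prod_list (map f as))"
      using Cons by (simp add: mult.assoc)
    also have "\<dots> = f x * prod_list (map f (a # as))"
      using c[of a x] by (simp add: mult.assoc[symmetric])
    finally show ?case .
  qed simp
  from Cons.prems have "x \<in> set ys" by (metis list.set_intros(1) mset_eq_setD)
  then obtain as bs where ys: "ys = as @ x # bs" by (meson split_list)
  with Cons.prems have "mset xs = mset (as @ bs)" by simp
  from Cons.IH[OF this] have "prod_list (map f (x # xs)) = f x * (prod_list (map f as) * prod_list (map f bs))"
    by simp
  also have "\<dots> = prod_list (map f ys)"
    unfolding ys by (simp add: mult.assoc[symmetric] move)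
  finally show ?case .
qed simp

definition x_monomial :: "nat multiset \<Rightarrow> dual_yangian" where
  "x_monomial M = prod_list (map (\<lambda>k. x_gen (Suc k)) (sorted_list_of_multiset M))"

lemma x_monomial_mset: "x_monomial (mset ks) = prod_list (map (\<lambda>k. x_gen (Suc k)) ks)"
  unfolding x_monomial_def by (rule prod_list_commute) (simp_all add: x_gen_commute)

lemma x_monomial_add: "x_monomial (M + N) = x_monomial M * x_monomial N"
proof -
  obtain xs ys where "M = mset xs" "N = mset ys" by (metis ex_mset)
  then have "x_monomial (M + N) = x_monomial (mset (xs @ ys))" by simp
  then show ?thesis
    unfolding x_monomial_mset \<open>M = mset xs\<close> \<open>N = mset ys\<close> by simp
qed

definition scalar :: "complex fps \<Rightarrow> dual_yangian" where
  "scalar f = yangian_of (falg_of_series f)"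

lemma hscale_eq: "hscale f x = scalar f * x"
  by (simp add: hscale_def scalar_def)

lemma scalar_central: "scalar f * x = x * scalar f"
proof -
  obtain a where "x = yangian_of a" using yangian_of_surj by blast
  then show ?thesis by (simp add: scalar_def falg_of_series_commute flip: yangian_of_mult)
qed

lemma scalar_add: "scalar (f + g) = scalar f + scalar g"
  and scalar_mult: "scalar (f * g) = scalar f * scalar g" and scalar_1: "scalar 1 = 1"
  and scalar_X: "scalar fps_X = hbar"
  by (simp_all add: scalar_def falg_of_series_add falg_of_series_mult falg_of_series_1 falg_of_series_X
      yangian_of_add yangian_of_mult yangian_of_1 hbar_def)

lemma scalar_X_power: "scalar (fps_X ^ n) = hbar ^ n"
  by (induction n) (simp_all add: scalar_1 scalar_mult scalar_X)

interpretation alg: monoid_algebra_lift scalar x_monomial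
proof
  show "x_monomial 0 = 1" by (simp add: x_monomial_def)
qed (rule scalar_add scalar_mult scalar_1 scalar_central x_monomial_add)+

interpretation pol: monoid_algebra_lift "\<lambda>a. scalar (fps_const a)" x_monomial
proof
  show "x_monomial 0 = 1" by (simp add: x_monomial_def)
  show "scalar (fps_const (a + b)) = scalar (fps_const a) + scalar (fps_const b)" for a b
    by (simp flip: scalar_add)
  show "scalar (fps_const (a * b)) = scalar (fps_const a) * scalar (fps_const b)" for a b
    by (simp flip: scalar_mult)
  show "scalar (fps_const 1) = 1" by (simp add: scalar_1)
qed (rule scalar_central x_monomial_add)+

definition x_algebra :: "dual_yangian set" where
  "x_algebra = unital_subalgebra {x_gen r |r. r \<ge> 1}"

lemma x_algebra_closed:
  shows x_algebra_one: "1 \<in> x_algebra" and x_algebra_hscale: "x \<in> x_algebra \<Longrightarrow> hscale f x \<in> x_algebra"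
    and x_algebra_add: "x \<in> x_algebra \<Longrightarrow> y \<in> x_algebra \<Longrightarrow> x + y \<in> x_algebra"
    and x_algebra_mult: "x \<in> x_algebra \<Longrightarrow> y \<in> x_algebra \<Longrightarrow> x * y \<in> x_algebra"
    and x_algebra_gen: "x_gen (Suc k) \<in> x_algebra"
  unfolding x_algebra_def by (auto intro: unital_subalgebra.intros)

lemma x_algebra_0: "0 \<in> x_algebra"
  using x_algebra_hscale[OF x_algebra_one, of 0] by (simp only: hscale_eq alg.s_0 mult_zero_left)

lemma range_alg_lift: "range alg.lift = x_algebra"
proof
  have mono: "x_monomial M \<in> x_algebra" for M
  proof -
    have "prod_list (map (\<lambda>k. x_gen (Suc k)) ks) \<in> x_algebra" for ks
    proof (induction ks)
      case (Cons k ks)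
      then show ?case by (simp add: x_algebra_mult x_algebra_gen)
    qed (simp add: x_algebra_one)
    then show ?thesis by (simp add: x_monomial_def)
  qed
  show "range alg.lift \<subseteq> x_algebra"
  proof
    fix y assume "y \<in> range alg.lift"
    then obtain P where y: "y = alg.lift P" by blast
    have "alg.lift P \<in> x_algebra"
    proof (induction P rule: poly_mapping_induct)
      case zero
      show ?case unfolding alg.lift_0 by (rule x_algebra_0)
    next
      case (single M f)
      show ?case using x_algebra_hscale[OF mono[of M], of f] by (simp add: hscale_eq alg.lift_single)
    qed (simp add: alg.lift_add x_algebra_add)
    then show "y \<in> x_algebra" by (simp add: y)
  qed
  show "x_algebra \<subseteq> range alg.lift"
  proof
    fix y assume "y \<in> x_algebra"
    then show "y \<in> range alg.lift"
      unfolding x_algebra_def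
    proof induction
      case one
      show ?case by (metis alg.lift_1 rangeI)
    next
      case (base x)
      then obtain r where "x = x_gen (Suc r)" by (auto simp: Suc_le_D dest!: Suc_le_D)
      then have "x = alg.lift (single {#r#} 1)"
        by (simp add: alg.lift_single scalar_1 x_monomial_def)
      then show ?case by blast
    next
      case (scale x f)
      then obtain P where "x = alg.lift P" by blast
      then have "hscale f x = alg.lift (single 0 f * P)"
        by (simp add: alg.lift_mult alg.lift_single hscale_eq x_monomial_def)
      then show ?case by blast
    next
      case (add x y)
      then show ?case by (auto simp flip: alg.lift_add)
    next
      case (mult x y)
      then show ?case by (auto simp flip: alg.lift_mult)
    qed
  qed
qed

lemma pol_lift_x_algebra: "pol.lift p \<in> x_algebra"
proof (induction p rule: poly_mapping_induct)
  case (single M a)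
  have "pol.lift (single M a) = alg.lift (single M (fps_const a))"
    by (simp add: pol.lift_single alg.lift_single)
  then show ?case using range_alg_lift by blast
qed (simp_all only: pol.lift_0 x_algebra_0 pol.lift_add x_algebra_add)

lemma coefficient_functional:
  "\<exists>\<Lambda> :: dual_yangian \<Rightarrow> complex fps. (\<forall>x y. \<Lambda> (x + y) = \<Lambda> x + \<Lambda> y) \<and> (\<forall>f x. \<Lambda> (scalar f * x) = f * \<Lambda> x) \<and>
    (\<forall>M. set_mset M \<subseteq> {..<N} \<longrightarrow> fps_nth (\<Lambda> (x_monomial M)) 0 = c M)"
proof -
  obtain \<Lambda> :: "dual_yangian \<Rightarrow> complex fps" where L:
    "(\<forall>x y. \<Lambda> (x + y) = \<Lambda> x + \<Lambda> y) \<and> (\<forall>f x. \<Lambda> (hscale f x) = f * \<Lambda> x) \<and>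
    (\<forall>ks. set ks \<subseteq> {..<N} \<longrightarrow> fps_nth (\<Lambda> (prod_list (map (\<lambda>k. x_gen (Suc k)) ks))) 0 = c (mset ks))"
    using coefficient_functional_extends[of N c] by (rule exE)
  have "fps_nth (\<Lambda> (x_monomial M)) 0 = c M" if "set_mset M \<subseteq> {..<N}" for M
    unfolding x_monomial_def using L[THEN conjunct2, THEN conjunct2, rule_format, of "sorted_list_of_multiset M"] that
    by simp
  with L show ?thesis unfolding hscale_eq by (intro exI[of _ \<Lambda>]) simp
qed

locale coeff_functional =
  fixes \<Lambda> :: "dual_yangian \<Rightarrow> complex fps" and N :: nat and c :: "nat multiset \<Rightarrow> complex"
  assumes add: "\<Lambda> (x + y) = \<Lambda> x + \<Lambda> y" and scale: "\<Lambda> (scalar f * x) = f * \<Lambda> x"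
    and monomial: "set_mset M \<subseteq> {..<N} \<Longrightarrow> fps_nth (\<Lambda> (x_monomial M)) 0 = c M"
begin

lemma zero: "\<Lambda> 0 = 0" using add[of 0 0] by simp

lemma sum: "\<Lambda> (\<Sum>i\<in>A. f i) = (\<Sum>i\<in>A. \<Lambda> (f i))"
  by (induction A rule: infinite_finite_induct) (simp_all add: add zero)

lemma hbar_power: "\<Lambda> (hbar ^ n * x) = fps_X ^ n * \<Lambda> x"
  using scale[of "fps_X ^ n" x] by (simp add: scalar_X_power)

lemma lift_leading:
  assumes "(\<Union>M\<in>keys P. set_mset M) \<subseteq> {..<N}"
  shows "fps_nth (\<Lambda> (alg.lift P)) 0 = (\<Sum>M\<in>keys P. fps_nth (lookup P M) 0 * c M)"
  unfolding alg.lift_def pm_sum_def sum fps_sum_nth scale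
  using assms by (intro sum.cong refl) (auto simp: monomial UN_subset_iff)

lemma pol_lift_leading:
  assumes "(\<Union>M\<in>keys p. set_mset M) \<subseteq> {..<N}"
  shows "fps_nth (\<Lambda> (pol.lift p)) 0 = functional c p"
  unfolding pol.lift_def functional_def pm_sum_def sum fps_sum_nth scale
  using assms by (intro sum.cong refl) (auto simp: monomial UN_subset_iff)

end

lemma ex_coeff_functional: "\<exists>\<Lambda>. coeff_functional \<Lambda> N c"
  using coefficient_functional[of N c] unfolding coeff_functional_def by simp

lemma ex_support_bound: "finite A \<Longrightarrow> \<exists>N. (\<Union>M\<in>A. set_mset M) \<subseteq> {..<N :: nat}"
proof -
  assume "finite A"
  then have "finite (\<Union>M\<in>A. set_mset M)" by simp
  then show ?thesis by (auto simp: finite_nat_set_iff_bounded subset_iff)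
qed

text \<open>
  The weak form of the Poincare--Birkhoff--Witt theorem. If the combination is divisible by $h$, then a
  functional that extends the coefficient of the monomial \<open>M0\<close> shows that this coefficient is divisible by $h$. Functionals
  take values in the torsion-free ring $\mathbb{C}[[h]]$, so the argument can be repeated after dividing by $h$.
\<close>

lemma lift_saturated:
  assumes "alg.lift P = hbar ^ n * z"
  shows "\<exists>P'. P = single 0 (fps_X ^ n) * P'"
  using assms
proof (induction n arbitrary: z)
  case 0
  have "single 0 1 * P = P" by simp
  then show ?case by (intro exI[of _ P]) simp
next
  case (Suc n)
  have "alg.lift P = hbar ^ n * (hbar * z)"
    using Suc.prems by (simp add: power_commutes mult.assoc[symmetric])
  from Suc.IH[OF this] obtain P' where P': "P = single 0 (fps_X ^ n) * P'" by blast
  obtain N where N: "(\<Union>M\<in>keys P'. set_mset M) \<subseteq> {..<N}"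
    using ex_support_bound[OF finite_keys] by blast
  have z: "fps_nth (lookup P' M0) 0 = 0" for M0
  proof (cases "M0 \<in> keys P'")
    case True
    obtain \<Lambda> where "coeff_functional \<Lambda> N (\<lambda>M. of_bool (M = M0))" using ex_coeff_functional by blast
    then interpret coeff_functional \<Lambda> N "\<lambda>M. of_bool (M = M0)" .
    have "fps_X ^ n * \<Lambda> (alg.lift P') = \<Lambda> (alg.lift P)"
      unfolding P' alg.lift_mult alg.lift_single scalar_X_power alg.mon_0 by (simp add: hbar_power)
    also have "\<dots> = fps_X ^ n * (fps_X * \<Lambda> z)"
      unfolding Suc.prems hbar_power by (simp add: mult.assoc power_commutes)
    finally have "\<Lambda> (alg.lift P') = fps_X * \<Lambda> z" by simp
    then have "fps_nth (\<Lambda> (alg.lift P')) 0 = 0" by simp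
    then show ?thesis
      unfolding lift_leading[OF N] using True by (simp add: sum.delta')
  qed (simp add: in_keys_iff)
  define P'' where "P'' = (\<Sum>M\<in>keys P'. single M (fps_shift 1 (lookup P' M)))"
  have "single 0 fps_X * P'' = (\<Sum>M\<in>keys P'. single M (lookup P' M))"
    unfolding P''_def sum_distrib_left mult_single add_0_left
  proof (intro sum.cong refl)
    fix M
    show "single M (fps_X * fps_shift 1 (lookup P' M)) = single M (lookup P' M)"
    proof -
      have "lookup P' M = fps_X * fps_shift 1 (lookup P' M)"
        by (rule trans[OF fps_head_tail]) (simp add: z)
      then show ?thesis by (rule arg_cong[where f = "single M", OF sym])
    qed
  qed
  then have "P' = single 0 fps_X * P''" by (simp only: single_sum_keys)
  then have "P = single 0 (fps_X ^ Suc n) * P''"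
    unfolding P' by (simp add: mult.assoc[symmetric] mult_single power_commutes)
  then show ?case by blast
qed

lemma lift_divide:
  assumes "alg.lift P = hbar ^ n * z"
  shows "\<exists>P'. alg.lift P = hbar ^ n * alg.lift P'"
proof -
  obtain P' where "P = single 0 (fps_X ^ n) * P'" using lift_saturated[OF assms] by blast
  then have "alg.lift P = hbar ^ n * alg.lift P'"
    by (simp add: alg.lift_mult alg.lift_single scalar_X_power alg.mon_0)
  then show ?thesis by blast
qed

definition x_closure :: "dual_yangian set" where
  "x_closure = hadic_closure hbar x_algebra"

lemma principal_subspace_eq: "principal_subspace c = x_closure"
  by (simp add: principal_subspace_def vacuum_module_def x_closure_def x_algebra_def)

lemma x_closure_iff: "x \<in> x_closure \<longleftrightarrow> (\<forall>n. \<exists>y\<in>x_algebra. \<exists>z. x = y + hbar ^ n * z)"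
  unfolding x_closure_def hadic_closure_def mem_Collect_eq diff_eq_eq by (simp only: add.commute)

lemma x_algebra_x_closure: "x \<in> x_algebra \<Longrightarrow> x \<in> x_closure"
  unfolding x_closure_iff by (intro allI bexI[of _ x] exI[of _ 0]) simp_all

lemma x_closure_add: "x \<in> x_closure \<Longrightarrow> y \<in> x_closure \<Longrightarrow> x + y \<in> x_closure"
  unfolding x_closure_iff
proof
  fix n
  assume x: "\<forall>n. \<exists>y\<in>x_algebra. \<exists>z. x = y + hbar ^ n * z" and y: "\<forall>n. \<exists>ya\<in>x_algebra. \<exists>z. y = ya + hbar ^ n * z"
  obtain a b where a: "a \<in> x_algebra" "x = a + hbar ^ n * b" using x by blast
  obtain a' b' where a': "a' \<in> x_algebra" "y = a' + hbar ^ n * b'" using y by blast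
  have "x + y = (a + a') + hbar ^ n * (b + b')" unfolding a a' by (simp add: distrib_left)
  then show "\<exists>ya\<in>x_algebra. \<exists>z. x + y = ya + hbar ^ n * z"
    using x_algebra_add[OF a(1) a'(1)] by blast
qed

lemma x_closure_mult: "x \<in> x_closure \<Longrightarrow> y \<in> x_closure \<Longrightarrow> x * y \<in> x_closure"
  unfolding x_closure_iff
proof
  fix n
  assume x: "\<forall>n. \<exists>y\<in>x_algebra. \<exists>z. x = y + hbar ^ n * z" and y: "\<forall>n. \<exists>ya\<in>x_algebra. \<exists>z. y = ya + hbar ^ n * z"
  obtain a b where a: "a \<in> x_algebra" "x = a + hbar ^ n * b" using x by blast
  obtain a' b' where a': "a' \<in> x_algebra" "y = a' + hbar ^ n * b'" using y by blast
  have "a * hbar ^ n * b' = hbar ^ n * a * b'"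
    by (simp only: hbar_power_central)
  then have "a * (hbar ^ n * b') = hbar ^ n * (a * b')"
    by (simp only: mult.assoc)
  then have "x * y = a * a' + hbar ^ n * (a * b' + b * y)"
    unfolding a a' by (simp add: distrib_left distrib_right mult.assoc)
  then show "\<exists>ya\<in>x_algebra. \<exists>z. x * y = ya + hbar ^ n * z"
    using x_algebra_mult[OF a(1) a'(1)] by blast
qed

lemma x_algebra_scalar: "scalar f \<in> x_algebra"
  using x_algebra_hscale[OF x_algebra_one, of f] by (simp add: hscale_eq)

lemma x_closure_0: "0 \<in> x_closure" by (rule x_algebra_x_closure) (rule x_algebra_0)
lemma x_closure_scalar: "x \<in> x_closure \<Longrightarrow> scalar f * x \<in> x_closure"
  by (rule x_closure_mult[OF x_algebra_x_closure[OF x_algebra_scalar]])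
lemma x_closure_hbar: "x \<in> x_closure \<Longrightarrow> hbar * x \<in> x_closure" using x_closure_scalar[of x fps_X] by (simp add: scalar_X)
lemma x_closure_sum: "(\<And>i. i \<in> A \<Longrightarrow> f i \<in> x_closure) \<Longrightarrow> (\<Sum>i\<in>A. f i) \<in> x_closure"
  by (induction A rule: infinite_finite_induct) (simp_all add: x_closure_0 x_closure_add)

text \<open>
  An element of the closure is a limit of elements of the subalgebra. By saturation the differences of
  consecutive approximations are divisible by powers of $h$ inside the subalgebra, so the sum
  of the quotients converges to an element of the closure.
\<close>

lemma x_closure_decompose:
  assumes "v \<in> x_closure"
  shows "\<exists>P. \<exists>z\<in>x_closure. v = alg.lift P + hbar * z"
proof -
  have "\<exists>P z. v = alg.lift P + hbar ^ n * z" for n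
    using assms unfolding x_closure_iff range_alg_lift[symmetric] by blast
  then obtain P Z where v: "\<And>n. v = alg.lift (P n) + hbar ^ n * Z n" by metis
  have "\<exists>D. alg.lift (P (Suc n)) - alg.lift (P n) = hbar ^ n * alg.lift D" for n
  proof -
    have e: "alg.lift (P k) = v - hbar ^ k * Z k" for k
      by (subst v[of k]) simp
    have "alg.lift (P (Suc n) - P n) = hbar ^ n * Z n - hbar ^ Suc n * Z (Suc n)"
      unfolding alg.lift_diff e by simp
    also have "\<dots> = hbar ^ n * (Z n - hbar * Z (Suc n))"
      unfolding power_Suc2 mult.assoc right_diff_distrib ..
    finally have "alg.lift (P (Suc n) - P n) = hbar ^ n * (Z n - hbar * Z (Suc n))" .
    from lift_divide[OF this] show ?thesis by (simp add: alg.lift_diff)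
  qed
  then obtain D where D: "\<And>n. alg.lift (P (Suc n)) - alg.lift (P n) = hbar ^ n * alg.lift (D n)" by metis
  define a where "a = (\<lambda>i. \<Sum>n<i. hbar ^ n * alg.lift (D (Suc n)))"
  have "a (Suc i) - a i = hbar ^ i * alg.lift (D (Suc i))" for i by (simp add: a_def)
  then have "\<exists>z. a (Suc i) - a i = hbar ^ i * z" for i by blast
  from yangian_complete[of a, OF this] obtain l where l: "\<forall>n. \<exists>z. l - a n = hbar ^ n * z" by blast
  have a: "a i \<in> x_algebra" for i
  proof (induction i)
    case 0
    show ?case by (simp add: a_def x_algebra_0 del: One_nat_def)
  next
    case (Suc i)
    have "hbar ^ i * alg.lift (D (Suc i)) \<in> x_algebra"
      unfolding scalar_X_power[symmetric] using range_alg_lift by (intro x_algebra_mult x_algebra_scalar) blast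
    then show ?case using Suc by (simp add: a_def x_algebra_add del: One_nat_def)
  qed
  then have "l \<in> x_closure" unfolding x_closure_def hadic_closure_def using l a by blast
  have tele: "alg.lift (P (Suc i)) - alg.lift (P 1) = hbar * a i" for i
  proof (induction i)
    case (Suc i)
    have "alg.lift (P (Suc (Suc i))) - alg.lift (P 1)
        = (alg.lift (P (Suc (Suc i))) - alg.lift (P (Suc i))) + (alg.lift (P (Suc i)) - alg.lift (P 1))" by simp
    also have "\<dots> = hbar ^ Suc i * alg.lift (D (Suc i)) + hbar * a i" by (simp only: Suc D)
    also have "\<dots> = hbar * a (Suc i)" by (simp add: a_def distrib_left mult.assoc)
    finally show ?case .
  qed (simp add: a_def)
  have "v - alg.lift (P 1) - hbar * l = 0"
  proof (rule yangian_separated)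
    fix i
    obtain z where z: "l - a i = hbar ^ i * z" using l by blast
    have "v - alg.lift (P 1) - hbar * l = hbar ^ Suc i * Z (Suc i) + (alg.lift (P (Suc i)) - alg.lift (P 1)) - hbar * l"
      by (subst v[of "Suc i"]) simp
    also have "\<dots> = hbar ^ Suc i * Z (Suc i) - hbar * (l - a i)"
      unfolding tele by (simp add: right_diff_distrib)
    also have "\<dots> = hbar ^ i * (hbar * Z (Suc i) - hbar * z)"
    proof -
      have "hbar * (hbar ^ i * z) = hbar ^ i * (hbar * z)" "hbar ^ Suc i * Z (Suc i) = hbar ^ i * (hbar * Z (Suc i))"
        by (simp_all only: mult.assoc[symmetric] power_commutes power_Suc)
      then show ?thesis unfolding z by (simp only: right_diff_distrib)
    qed
    finally show "\<exists>z. v - alg.lift (P 1) - hbar * l = hbar ^ i * z" by blast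
  qed
  then have "v = alg.lift (P 1) + hbar * l" by (simp add: algebra_simps)
  then show ?thesis using \<open>l \<in> x_closure\<close> by blast
qed

lemma lift_reduce: "\<exists>p. \<exists>z\<in>x_closure. alg.lift P = pol.lift p + hbar * z"
proof -
  define p where "p = (\<Sum>M\<in>keys P. single M (fps_nth (lookup P M) 0))"
  define z where "z = (\<Sum>M\<in>keys P. scalar (fps_shift 1 (lookup P M)) * x_monomial M)"
  have x: "x_monomial M \<in> x_closure" for M
  proof -
    have "pol.lift (single M 1) = x_monomial M" by (simp add: pol.lift_single scalar_1)
    then show ?thesis using x_algebra_x_closure[OF pol_lift_x_algebra] by metis
  qed
  have split: "scalar f * y = scalar (fps_const (fps_nth f 0)) * y + hbar * (scalar (fps_shift 1 f) * y)" for f y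
  proof -
    have "scalar f = scalar (fps_const (fps_nth f 0) + fps_X * fps_shift 1 f)"
      by (rule arg_cong[where f = scalar, OF fps_head_tail])
    also have "\<dots> = scalar (fps_const (fps_nth f 0)) + hbar * scalar (fps_shift 1 f)"
      by (simp only: scalar_add scalar_mult scalar_X)
    finally have "scalar f * y = (scalar (fps_const (fps_nth f 0)) + hbar * scalar (fps_shift 1 f)) * y"
      by (rule arg_cong[where f = "\<lambda>x. x * y"])
    then show ?thesis by (simp only: distrib_right mult.assoc)
  qed
  have "alg.lift P = pol.lift p + hbar * z"
    unfolding alg.lift_def pm_sum_def p_def z_def pol.lift_sum pol.lift_single sum_distrib_left sum.distrib[symmetric]
    by (intro sum.cong refl) (rule split)
  moreover have "z \<in> x_closure" unfolding z_def by (intro x_closure_sum x_closure_scalar x)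
  ultimately show ?thesis by blast
qed

text \<open>
  Being congruent to a polynomial modulo $h$ times the closure, which is stronger than modulo $h$ times the
  whole dual Yangian.
\<close>

definition approx :: "dual_yangian \<Rightarrow> poly_ring \<Rightarrow> bool" where
  "approx y p \<longleftrightarrow> (\<exists>z\<in>x_closure. y = pol.lift p + hbar * z)"

lemma approx_x_closure: "approx y p \<Longrightarrow> y \<in> x_closure"
  unfolding approx_def using x_closure_add[OF x_algebra_x_closure[OF pol_lift_x_algebra] x_closure_hbar] by blast

lemma approx_1: "approx 1 1"
  unfolding approx_def by (rule bexI[of _ 0]) (simp_all add: x_closure_0)

lemma approx_0: "approx 0 0"
  unfolding approx_def by (rule bexI[of _ 0]) (simp_all add: x_closure_0)

lemma approx_add: "approx x p \<Longrightarrow> approx y q \<Longrightarrow> approx (x + y) (p + q)"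
  unfolding approx_def
proof (elim bexE)
  fix z z' assume z: "z \<in> x_closure" "z' \<in> x_closure" and e: "x = pol.lift p + hbar * z" "y = pol.lift q + hbar * z'"
  have "x + y = pol.lift (p + q) + hbar * (z + z')"
    unfolding e by (simp add: pol.lift_add distrib_left)
  then show "\<exists>z\<in>x_closure. x + y = pol.lift (p + q) + hbar * z" using x_closure_add[OF z] by blast
qed

lemma approx_sum: "(\<And>i. i \<in> A \<Longrightarrow> approx (f i) (g i)) \<Longrightarrow> approx (\<Sum>i\<in>A. f i) (\<Sum>i\<in>A. g i)"
  by (induction A rule: infinite_finite_induct) (simp_all add: approx_0 approx_add)

lemma approx_mult: "approx x p \<Longrightarrow> approx y q \<Longrightarrow> approx (x * y) (p * q)"
proof -
  assume x: "approx x p" and y: "approx y q"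
  then obtain z z' where z: "z \<in> x_closure" "z' \<in> x_closure" and e: "x = pol.lift p + hbar * z" "y = pol.lift q + hbar * z'"
    unfolding approx_def by blast
  have "pol.lift p * hbar * z' = hbar * pol.lift p * z'"
    by (simp only: hbar_central)
  then have "pol.lift p * (hbar * z') = hbar * (pol.lift p * z')"
    by (simp only: mult.assoc)
  then have "x * y = pol.lift (p * q) + hbar * (pol.lift p * z' + z * y)"
    unfolding e by (simp add: pol.lift_mult distrib_left distrib_right mult.assoc)
  moreover have "pol.lift p * z' + z * y \<in> x_closure"
    by (rule x_closure_add[OF x_closure_mult[OF x_algebra_x_closure[OF pol_lift_x_algebra] z(2)]
      x_closure_mult[OF z(1) approx_x_closure[OF y]]])
  ultimately show ?thesis unfolding approx_def by blast
qed

section \<open>Quasi-particles modulo $h$\<close>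

lemma shifted_gen_x_closure:
  fixes S :: falg
  assumes S: "\<And>N. fps_nth S N = single (GWord [Gen 1 2 (N + k)]) (c N)"
  shows "yangian_of S \<in> x_closure"
  unfolding x_closure_iff
proof
  fix n
  define T where "T = (\<lambda>n. \<Sum>N<n. falg_of_series (fps_X ^ N * fps_const (c N)) * tgen 1 2 (Suc (N + k)))"
  have gen: "falg_of_series (fps_const a) * tgen 1 2 (Suc m) = fps_const (single (GWord [Gen 1 2 m]) a)" for a m
  proof -
    have "falg_of_series (fps_const a) = fps_const (single 0 a)"
      by (rule fps_ext) (simp add: falg_of_series_def)
    then show ?thesis by (simp add: tgen_def mult_single)
  qed
  have X: "falg_of_series (fps_X ^ N) = fps_X ^ N" for N
    by (induction N) (simp_all add: falg_of_series_1 falg_of_series_mult falg_of_series_X)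
  have T: "T n = (\<Sum>N<n. fps_X ^ N * fps_const (fps_nth S N))"
    unfolding T_def by (intro sum.cong refl) (simp add: falg_of_series_mult X mult.assoc gen S)
  have "S = T n + fps_X ^ n * fps_shift n S"
  proof (rule fps_ext)
    fix i
    have "fps_nth (T n) i = (if i < n then fps_nth S i else 0)"
    proof -
      have "fps_nth (T n) i = (\<Sum>N<n. if i = N then fps_nth S N else 0)"
        unfolding T fps_sum_nth by (intro sum.cong refl) (auto simp: fps_X_power_mult_nth)
      then show ?thesis by simp
    qed
    then show "fps_nth S i = fps_nth (T n + fps_X ^ n * fps_shift n S) i"
      by (simp add: fps_X_power_mult_nth)
  qed
  then have "yangian_of S = yangian_of (T n) + hbar ^ n * yangian_of (fps_shift n S)"
    by (metis hbar_def yangian_of_add yangian_of_mult yangian_of_power)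
  moreover have "yangian_of (T n) \<in> x_algebra" for n
  proof (induction n)
    case 0
    have "yangian_of 0 = 0" by (simp only: yangian_of_eq_0_iff closed_ideal_zero)
    then show ?case by (simp add: T_def x_algebra_0)
  next
    case (Suc n)
    have "yangian_of (T (Suc n)) = yangian_of (T n) + hscale (fps_X ^ n * fps_const (c n)) (x_gen (Suc (n + k)))"
      by (simp add: T_def yangian_of_add yangian_of_mult hscale_def x_gen_def)
    then show ?case using Suc by (simp add: x_algebra_add x_algebra_hscale x_algebra_gen)
  qed
  ultimately show "\<exists>y\<in>x_algebra. \<exists>z. yangian_of S = y + hbar ^ n * z" by blast
qed

lemma shifted_series_nth:
  "fps_nth (fps_nth (shift_series a (gen_series 1 2)) k) N
     = single (GWord [Gen 1 2 (N + k)]) (of_nat ((N + k) choose k) * a ^ N)"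
proof -
  have "fps_nth (fps_nth (gen_series 1 2) (n + k)) (N - n) =
     (if n = N then single (GWord [Gen 1 2 (N + k)]) 1 else 0)" if "n \<le> N" for n
    using that by (auto simp: gen_series_def tgen_def)
  then have "fps_nth (fps_nth (shift_series a (gen_series 1 2)) k) N
     = (\<Sum>n\<le>N. if n = N then single 0 (of_nat ((N + k) choose k) * a ^ N)
        * single (GWord [Gen 1 2 (N + k)]) 1 else 0)"
    unfolding shift_series_nth by (intro sum.cong refl) auto
  then show ?thesis by (simp add: mult_single)
qed

text \<open>
  The coefficient of $h^N u^k$ in $x(u + a h)$ is a multiple of $x(-N-k-1)$, so all terms except the
  first are $h$ times an element of the closure.
\<close>

lemma approx_shifted_gen: "approx (yangian_of (fps_nth (shift_series a (gen_series 1 2)) k)) (var k)"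
proof -
  define S where "S = fps_nth (shift_series a (gen_series 1 2)) k"
  define w where "w = fps_shift 1 S"
  have "S = tgen 1 2 (Suc k) + fps_X * w"
  proof -
    have "fps_nth S 0 = single (GWord [Gen 1 2 k]) 1"
      unfolding S_def shifted_series_nth by simp
    then show ?thesis using fps_head_tail[of S] by (simp add: w_def tgen_def)
  qed
  then have "yangian_of S = yangian_of (tgen 1 2 (Suc k) + fps_X * w)" by (rule arg_cong)
  also have "\<dots> = pol.lift (var k) + hbar * yangian_of w"
    by (simp add: yangian_of_add yangian_of_mult hbar_def var_def pol.lift_single scalar_1 x_monomial_def x_gen_def)
  finally have e: "yangian_of S = pol.lift (var k) + hbar * yangian_of w" .
  have "yangian_of w \<in> x_closure"
  proof (rule shifted_gen_x_closure)
    fix N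
    show "fps_nth w N = single (GWord [Gen 1 2 (N + Suc k)]) (of_nat ((Suc N + k) choose k) * a ^ Suc N)"
      by (simp add: w_def S_def shifted_series_nth del: binomial_Suc_Suc power_Suc)
  qed
  with e show ?thesis unfolding approx_def S_def by blast
qed

lemma yangian_of_sum: "finite A \<Longrightarrow> yangian_of (\<Sum>i\<in>A. f i) = (\<Sum>i\<in>A. yangian_of (f i))"
proof (induction A rule: finite_induct)
  case empty
  show ?case by (simp only: sum.empty yangian_of_eq_0_iff closed_ideal_zero)
qed (simp add: yangian_of_add)

lemma approx_prod_list:
  assumes "\<And>f k. f \<in> set fs \<Longrightarrow> approx (yangian_of (fps_nth f k)) (var k)"
  shows "approx (yangian_of (fps_nth (prod_list fs) k)) (fps_nth (var_series ^ length fs) k)"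
  using assms
proof (induction fs arbitrary: k)
  case Nil
  have "yangian_of 0 = 0" by (simp only: yangian_of_eq_0_iff closed_ideal_zero)
  then show ?case by (simp add: fps_one_nth yangian_of_1 approx_1 approx_0)
next
  case (Cons f fs)
  have "approx (yangian_of (fps_nth f i) * yangian_of (fps_nth (prod_list fs) (k - i)))
     (fps_nth var_series i * fps_nth (var_series ^ length fs) (k - i))" for i
    using Cons.prems[of f i] Cons.IH[of "k - i"] Cons.prems by (intro approx_mult) (auto simp: var_series_def)
  then show ?case
    by (simp add: fps_mult_nth yangian_of_sum yangian_of_mult approx_sum)
qed

lemma approx_quasi_particle: "approx (quasi_particle t m n) (qcoeff m (- n - int m))"
proof (cases "n \<le> - int m")
  case True
  have "approx (yangian_of (fps_nth (quasi_series t m) k)) (fps_nth (var_series ^ m) k)" for k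
  proof -
    define fs where "fs = map (\<lambda>k. shift_series (of_nat k * t) (gen_series 1 2)) [0..<m]"
    have "approx (yangian_of (fps_nth f k)) (var k)" if "f \<in> set fs" for f k
      using that by (auto simp: fs_def approx_shifted_gen)
    from approx_prod_list[OF this, of fs k] show ?thesis
      by (simp add: quasi_series_def fs_def)
  qed
  then show ?thesis using True by (simp add: quasi_particle_def qcoeff_def)
qed (simp add: quasi_particle_def qcoeff_def approx_0)

lemma approx_quasi_monomial:
  "approx (prod_list (map (\<lambda>s. quasi_particle t (m s) (n s)) (rev [1..<r + 1])))
     (qmono r (\<lambda>p. m (Suc p)) (\<lambda>p. - n (Suc p) - int (m (Suc p))))"
proof -
  have "approx (prod_list (map (\<lambda>s. quasi_particle t (m s) (n s)) xs))
     (prod_list (map (\<lambda>s. qcoeff (m s) (- n s - int (m s))) xs))" for xs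
    by (induction xs) (simp_all add: approx_1 approx_mult approx_quasi_particle)
  moreover have "prod_list (map (\<lambda>s. qcoeff (m s) (- n s - int (m s))) (rev [1..<r + 1]))
     = qmono r (\<lambda>p. m (Suc p)) (\<lambda>p. - n (Suc p) - int (m (Suc p)))"
  proof (induction r)
    case (Suc r)
    have "rev [1..<Suc r + 1] = Suc r # rev [1..<r + 1]" by simp
    then show ?case using Suc by (simp add: qmono_def mult.commute del: upt_Suc)
  qed (simp add: qmono_def)
  ultimately show ?thesis by metis
qed

section \<open>The topological basis\<close>

lemma quasi_basis_eq: "quasi_basis c t = quasi_monomials t"
  by (simp add: quasi_basis_def)

lemma quasi_monomials_admissible:
  "v \<in> quasi_monomials t \<longleftrightarrow> (\<exists>r m n. v = prod_list (map (\<lambda>s. quasi_particle t (m s) (n s)) (rev [1..<r + 1]))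
     \<and> admissible r (\<lambda>p. m (Suc p)) (\<lambda>p. - n (Suc p) - int (m (Suc p))))"
proof -
  have "admissible r (\<lambda>p. m (Suc p)) (\<lambda>p. - n (Suc p) - int (m (Suc p))) \<longleftrightarrow>
        (\<forall>s\<in>{1..r}. m s \<ge> 1 \<and> n s \<le> -1) \<and>
        (\<forall>s\<in>{1..<r}. m (s + 1) \<le> m s) \<and>
        (\<forall>s\<in>{1..<r}. m (s + 1) = m s \<longrightarrow> n (s + 1) \<le> n s - 2 * int (m s)) \<and>
        (\<forall>s\<in>{1..r}. n s \<le> - int (m s) - 2 * (int s - 1) * int (m s))" (is "?A \<longleftrightarrow> ?B") for r m n
  proof
    assume A: ?A
    have A1: "m (Suc p) \<ge> 1 \<and> - n (Suc p) - int (m (Suc p)) \<ge> 2 * int p * int (m (Suc p))" if "p < r" for p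
      using A that unfolding admissible_def by blast
    have A2: "m (Suc (Suc p)) \<le> m (Suc p) \<and> (m (Suc (Suc p)) = m (Suc p) \<longrightarrow>
       - n (Suc (Suc p)) - int (m (Suc (Suc p))) \<ge> - n (Suc p) - int (m (Suc p)) + 2 * int (m (Suc p)))"
      if "Suc p < r" for p
      using A that unfolding admissible_def by blast
    have "m s \<ge> 1 \<and> n s \<le> - int (m s) - 2 * (int s - 1) * int (m s)" if "s \<in> {1..r}" for s
      using A1[of "s - 1"] that by (cases s) (auto simp: algebra_simps)
    moreover have "n s \<le> -1" if "s \<in> {1..r}" for s
    proof -
      have "2 * (int s - 1) * int (m s) \<ge> 0" using that by simp
      then show ?thesis using \<open>\<And>s. s \<in> {1..r} \<Longrightarrow> _\<close>[OF that] by linarith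
    qed
    moreover have "m (s + 1) \<le> m s \<and> (m (s + 1) = m s \<longrightarrow> n (s + 1) \<le> n s - 2 * int (m s))" if "s \<in> {1..<r}" for s
      using A2[of "s - 1"] that by (cases s) auto
    ultimately show ?B by blast
  next
    assume B: ?B
    have "m (Suc p) \<ge> 1 \<and> - n (Suc p) - int (m (Suc p)) \<ge> 2 * int p * int (m (Suc p))" if "p < r" for p
    proof -
      have "Suc p \<in> {1..r}" using that by simp
      then have "m (Suc p) \<ge> 1" "n (Suc p) \<le> - int (m (Suc p)) - 2 * (int (Suc p) - 1) * int (m (Suc p))"
        using B by blast+
      then show ?thesis by simp
    qed
    moreover have "m (Suc (Suc p)) \<le> m (Suc p) \<and> (m (Suc (Suc p)) = m (Suc p) \<longrightarrow>
       - n (Suc (Suc p)) - int (m (Suc (Suc p))) \<ge> - n (Suc p) - int (m (Suc p)) + 2 * int (m (Suc p)))"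
      if "Suc p < r" for p
    proof -
      have "Suc p \<in> {1..<r}" using that by simp
      then have "m (Suc p + 1) \<le> m (Suc p)" "m (Suc p + 1) = m (Suc p) \<longrightarrow> n (Suc p + 1) \<le> n (Suc p) - 2 * int (m (Suc p))"
        using B by blast+
      then show ?thesis by auto
    qed
    ultimately show ?A unfolding admissible_def by blast
  qed
  then show ?thesis unfolding quasi_monomials_def by simp
qed

interpretation poly_space: vector_space "\<lambda>a (p :: poly_ring). single 0 a * p"
  by unfold_locales (simp_all add: distrib_left distrib_right single_add mult_single flip: mult.assoc)

interpretation poly_dual: vector_space_pair "\<lambda>a (p :: poly_ring). single 0 a * p" "(*) :: complex \<Rightarrow> complex \<Rightarrow> complex"
  by unfold_locales (simp_all add: algebra_simps)

lemma subspace_eq_UNIV_if_no_functional: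
  assumes U: "poly_space.subspace U" and no: "\<And>c. (\<And>p. p \<in> U \<Longrightarrow> functional c p = 0) \<Longrightarrow> c = (\<lambda>M. 0)"
  shows "x \<in> U"
proof (rule ccontr)
  assume x: "x \<notin> U"
  obtain C where C: "C \<subseteq> U" "poly_space.independent C" "U \<subseteq> poly_space.span C"
    using poly_space.maximal_independent_subset[of U] by blast
  have "poly_space.span C \<subseteq> U" using poly_space.span_minimal[OF C(1) U] .
  then have ins: "poly_space.independent (insert x C)"
    using x C(2) by (intro poly_space.independent_insertI) auto
  obtain g where g: "Vector_Spaces.linear (\<lambda>a (p :: poly_ring). single 0 a * p) (*) g"
    "\<forall>y\<in>insert x C. g y = of_bool (y = x)"
    using poly_dual.linear_independent_extend[OF ins, of "\<lambda>y. of_bool (y = x)"] by blast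
  interpret g: Vector_Spaces.linear "\<lambda>a (p :: poly_ring). single 0 a * p" "(*)" g by fact
  have lin: "linear_functional g"
    unfolding linear_functional_def using g.add g.scale by blast
  have gC: "g y = 0" if "y \<in> C" for y
    using g(2) that x C(1) by auto
  have "g p = 0" if "p \<in> U" for p
  proof -
    have "p \<in> poly_space.span C" using that C(3) by blast
    then show ?thesis
      by (rule g.eq_0_on_span[rotated]) (rule gC)
  qed
  then have "(\<lambda>M. g (single M 1)) = (\<lambda>M. 0)"
    by (intro no) (simp flip: linear_functional_eq_functional[OF lin])
  then have "g x = functional (\<lambda>M. 0) x"
    using linear_functional_eq_functional[OF lin] by metis
  then show False using g(2) by (simp add: functional_def pm_sum_def)
qed

lemma quasi_monomials_x_closure: "quasi_monomials t \<subseteq> x_closure"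
  unfolding quasi_monomials_admissible subset_iff using approx_x_closure[OF approx_quasi_monomial] by blast

text \<open>
  The polynomials that can be expressed by quasi-particle monomials modulo $h$ form a subspace, and it
  contains all admissible monomials, on which no nonzero functional vanishes.
\<close>

lemma hspan_reduction: "\<exists>w\<in>hspan (quasi_monomials t). \<exists>z\<in>x_closure. pol.lift p = w + hbar * z"
proof -
  define U where "U = {p. \<exists>w\<in>hspan (quasi_monomials t). \<exists>z\<in>x_closure. pol.lift p = w + hbar * z}"
  have "poly_space.subspace U"
  proof (rule poly_space.subspaceI)
    show "0 \<in> U"
      unfolding U_def using hmod.span_zero x_closure_0
      by (intro CollectI bexI[of _ 0] bexI[of _ 0]) simp_all
  next
    fix p q assume "p \<in> U" "q \<in> U"
    then obtain w z w' z' where w: "w \<in> hspan (quasi_monomials t)" "z \<in> x_closure" "pol.lift p = w + hbar * z"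
      "w' \<in> hspan (quasi_monomials t)" "z' \<in> x_closure" "pol.lift q = w' + hbar * z'" unfolding U_def by blast
    have "pol.lift (p + q) = (w + w') + hbar * (z + z')" using w by (simp add: pol.lift_add distrib_left)
    then show "p + q \<in> U" unfolding U_def using hmod.span_add[OF w(1,4)] x_closure_add[OF w(2,5)] by blast
  next
    fix a p assume "p \<in> U"
    then obtain w z where w: "w \<in> hspan (quasi_monomials t)" "z \<in> x_closure" "pol.lift p = w + hbar * z"
      unfolding U_def by blast
    have "scalar (fps_const a) * (hbar * z) = hbar * (scalar (fps_const a) * z)"
      by (metis mult.assoc scalar_central)
    then have "pol.lift (single 0 a * p) = hscale (fps_const a) w + hbar * (scalar (fps_const a) * z)"
      unfolding pol.lift_mult w(3) by (simp add: pol.lift_single x_monomial_def hscale_eq distrib_left)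
    then show "single 0 a * p \<in> U"
      unfolding U_def using hmod.span_scale[OF w(1), of "fps_const a"] x_closure_scalar[OF w(2), of "fps_const a"] by blast
  qed
  moreover have "c = (\<lambda>M. 0)" if c: "\<And>p. p \<in> U \<Longrightarrow> functional c p = 0" for c
  proof (rule functional_zero_of_admissible)
    fix r m and j :: "nat \<Rightarrow> int" assume adm: "admissible r m j"
    define m' where "m' = (\<lambda>s. m (s - 1))"
    define n' where "n' = (\<lambda>s. - j (s - 1) - int (m (s - 1)))"
    define b where "b = prod_list (map (\<lambda>s. quasi_particle t (m' s) (n' s)) (rev [1..<r + 1]))"
    have e: "(\<lambda>p. m' (Suc p)) = m" "(\<lambda>p. - n' (Suc p) - int (m' (Suc p))) = j"
      by (simp_all add: m'_def n'_def)
    have "b \<in> quasi_monomials t"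
      unfolding quasi_monomials_admissible b_def
      by (intro exI[of _ r] exI[of _ m'] exI[of _ n'] conjI refl) (simp only: e adm)
    moreover obtain z where z: "z \<in> x_closure" "b = pol.lift (qmono r m j) + hbar * z"
      using approx_quasi_monomial[of t m' n' r] unfolding e approx_def b_def by blast
    have "pol.lift (qmono r m j) = b + hbar * (scalar (- 1) * z)"
    proof -
      have "scalar (- 1) * z = - z"
        using scalar_add[of 1 "- 1"] scalar_1 alg.s_0 by (metis add.right_inverse add_eq_0_iff mult_1 mult_minus_left)
      then show ?thesis using z(2) by simp
    qed
    moreover have "scalar (- 1) * z \<in> x_closure" by (rule x_closure_scalar[OF z(1)])
    ultimately have "qmono r m j \<in> U"
      unfolding U_def using hmod.span_base[of b "quasi_monomials t"] by blast
    then show "functional c (qmono r m j) = 0" by (rule c)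
  qed
  ultimately have "p \<in> U" by (rule subspace_eq_UNIV_if_no_functional)
  then show ?thesis by (simp add: U_def)
qed

lemma x_closure_approximation:
  assumes "v \<in> x_closure"
  shows "\<exists>w\<in>hspan (quasi_monomials t). \<exists>z\<in>x_closure. v = w + hbar ^ n * z"
proof (induction n)
  case 0
  show ?case using assms hmod.span_zero by (intro bexI[of _ 0] bexI[of _ v]) simp_all
next
  case (Suc n)
  then obtain w z where w: "w \<in> hspan (quasi_monomials t)" "z \<in> x_closure" "v = w + hbar ^ n * z" by blast
  obtain P z1 where z1: "z1 \<in> x_closure" "z = alg.lift P + hbar * z1" using x_closure_decompose[OF w(2)] by blast
  obtain p z2 where z2: "z2 \<in> x_closure" "alg.lift P = pol.lift p + hbar * z2" using lift_reduce by blast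
  obtain w' z3 where z3: "w' \<in> hspan (quasi_monomials t)" "z3 \<in> x_closure" "pol.lift p = w' + hbar * z3"
    using hspan_reduction by blast
  have "v = (w + hscale (fps_X ^ n) w') + hbar ^ Suc n * (z3 + z2 + z1)"
    unfolding w(3) z1(2) z2(2) z3(3) power_Suc2
    by (simp add: hscale_eq scalar_X_power distrib_left mult.assoc add.assoc)
  moreover have "w + hscale (fps_X ^ n) w' \<in> hspan (quasi_monomials t)"
    by (intro hmod.span_add hmod.span_scale w(1) z3(1))
  moreover have "z3 + z2 + z1 \<in> x_closure"
    by (rule x_closure_add[OF x_closure_add[OF z3(2) z2(1)] z1(1)])
  ultimately show ?case by blast
qed

text \<open>
  If all coefficients of a relation are divisible by $h^k$, then functionals with prescribed leading terms
  produce a relation between the commutative monomials with the constant terms of the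
  quotients as coefficients. These vanish by \<open>admissible_independent\<close>, so the coefficients are divisible by $h^{k+1}$.
\<close>

lemma quasi_monomials_independent: "\<not> hdependent (quasi_monomials t)"
proof
  assume "hdependent (quasi_monomials t)"
  then obtain T u where T: "finite T" "T \<subseteq> quasi_monomials t" "(\<Sum>v\<in>T. hscale (u v) v) = 0"
      and ne: "\<exists>v\<in>T. u v \<noteq> 0"
    unfolding hmod.dependent_explicit by blast
  define Q where "Q = (\<lambda>v x. v = prod_list (map (\<lambda>s. quasi_particle t (fst (snd x) s) (snd (snd x) s)) (rev [1..<fst x + 1]))
     \<and> admissible (fst x) (\<lambda>p. fst (snd x) (Suc p)) (\<lambda>p. - snd (snd x) (Suc p) - int (fst (snd x) (Suc p))))"
  have "\<exists>x. Q v x" if v: "v \<in> T" for v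
  proof -
    obtain r where "\<exists>m n. v = prod_list (map (\<lambda>s. quasi_particle t (m s) (n s)) (rev [1..<r + 1]))
      \<and> admissible r (\<lambda>p. m (Suc p)) (\<lambda>p. - n (Suc p) - int (m (Suc p)))"
      using quasi_monomials_admissible[THEN iffD1, OF subsetD[OF T(2) v]] by (rule exE)
    then obtain m where "\<exists>n. v = prod_list (map (\<lambda>s. quasi_particle t (m s) (n s)) (rev [1..<r + 1]))
      \<and> admissible r (\<lambda>p. m (Suc p)) (\<lambda>p. - n (Suc p) - int (m (Suc p)))" by (rule exE)
    then obtain n where "v = prod_list (map (\<lambda>s. quasi_particle t (m s) (n s)) (rev [1..<r + 1]))
      \<and> admissible r (\<lambda>p. m (Suc p)) (\<lambda>p. - n (Suc p) - int (m (Suc p)))" by (rule exE)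
    then have "Q v (r, m, n)" unfolding Q_def fst_conv snd_conv .
    then show ?thesis by (rule exI)
  qed
  then have "\<forall>v\<in>T. \<exists>x. Q v x" by blast
  from bchoice[OF this] obtain x where x: "\<forall>v\<in>T. Q v (x v)" by (rule exE)
  define R where "R = (\<lambda>v. fst (x v))"
  define m where "m = (\<lambda>v. fst (snd (x v)))"
  define n where "n = (\<lambda>v. snd (snd (x v)))"
  have idx: "v = prod_list (map (\<lambda>s. quasi_particle t (m v s) (n v s)) (rev [1..<R v + 1]))"
    "admissible (R v) (\<lambda>p. m v (Suc p)) (\<lambda>p. - n v (Suc p) - int (m v (Suc p)))" if "v \<in> T" for v
    using x[rule_format, OF that] unfolding Q_def R_def m_def n_def by (rule conjunct1, rule conjunct2)
  define e where "e = (\<lambda>v. qmono (R v) (\<lambda>p. m v (Suc p)) (\<lambda>p. - n v (Suc p) - int (m v (Suc p))))"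
  define b where "b = (\<lambda>v. prod_list (map (\<lambda>s. quasi_particle t (m v s) (n v s)) (rev [1..<R v + 1])))"
  have b: "b v = v" if "v \<in> T" for v
    unfolding b_def by (rule idx(1)[OF that, symmetric])
  have approx: "approx v (e v)" if "v \<in> T" for v
  proof -
    have "approx (b v) (e v)" unfolding b_def e_def by (rule approx_quasi_monomial)
    then show ?thesis by (simp only: b[OF that])
  qed
  have distinct: "v = v'"
    if v: "v \<in> T" "v' \<in> T" and R: "R v = R v'" and mn: "\<And>p. p < R v \<Longrightarrow> m v (Suc p) = m v' (Suc p) \<and>
       - n v (Suc p) - int (m v (Suc p)) = - n v' (Suc p) - int (m v' (Suc p))" for v v'
  proof -
    have "quasi_particle t (m v s) (n v s) = quasi_particle t (m v' s) (n v' s)" if s: "s \<in> set (rev [1..<R v + 1])" for s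
    proof -
      have "1 \<le> s" "s < R v + 1" using s by (simp_all only: set_rev set_upt atLeastLessThan_iff)
      then have p: "s = Suc (s - 1)" "s - 1 < R v" by simp_all
      have "m v s = m v' s" "n v s = n v' s" using mn[OF p(2)] unfolding p(1)[symmetric] by simp_all
      then show ?thesis by simp
    qed
    then have "b v = b v'"
      unfolding b_def R by (intro arg_cong[where f = prod_list] map_cong refl) simp
    then show ?thesis by (simp only: b[OF v(1)] b[OF v(2)])
  qed
  obtain N where N: "(\<Union>M\<in>(\<Union>v\<in>T. keys (e v)). set_mset M) \<subseteq> {..<N}"
    using ex_support_bound[of "\<Union>v\<in>T. keys (e v)"] T(1) by auto
  have lead: "(\<Sum>v\<in>T. fps_nth (u' v) 0 * functional c (e v)) = 0"
    if rel: "\<And>v. v \<in> T \<Longrightarrow> u v = fps_X ^ k * u' v" for u' k c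
  proof -
    obtain L where "coeff_functional L N c" using ex_coeff_functional by blast
    then interpret coeff_functional L N c .
    have "fps_X ^ k * (\<Sum>v\<in>T. u' v * L v) = (\<Sum>v\<in>T. u v * L v)"
      unfolding sum_distrib_left by (intro sum.cong refl) (simp add: rel mult.assoc)
    also have "\<dots> = L (\<Sum>v\<in>T. hscale (u v) v)"
      by (simp add: sum scale hscale_eq)
    also have "\<dots> = 0" unfolding T(3) by (rule zero)
    finally have "(\<Sum>v\<in>T. u' v * L v) = 0" by simp
    then have "fps_nth (\<Sum>v\<in>T. u' v * L v) 0 = 0" by simp
    then have "(\<Sum>v\<in>T. fps_nth (u' v) 0 * fps_nth (L v) 0) = 0"
      unfolding fps_sum_nth by simp
    moreover have "fps_nth (L v) 0 = functional c (e v)" if v: "v \<in> T" for v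
    proof -
      obtain z where z: "v = pol.lift (e v) + hbar * z" using approx[OF v] unfolding approx_def by blast
      have "L v = L (pol.lift (e v)) + L (hbar ^ 1 * z)" by (subst z) (simp add: add)
      then have "fps_nth (L v) 0 = fps_nth (L (pol.lift (e v))) 0" using hbar_power[of 1 z] by simp
      also have "\<dots> = functional c (e v)" using N v by (intro pol_lift_leading) blast
      finally show ?thesis .
    qed
    ultimately show ?thesis by simp
  qed
  have "\<exists>u'. \<forall>v\<in>T. u v = fps_X ^ k * u' v" for k
  proof (induction k)
    case 0
    show ?case by (intro exI[of _ u]) simp
  next
    case (Suc k)
    then obtain u' where u': "\<And>v. v \<in> T \<Longrightarrow> u v = fps_X ^ k * u' v" by blast
    have u'0: "fps_nth (u' v) 0 = 0" if v: "v \<in> T" for v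
    proof (rule admissible_independent[OF T(1) idx(2) distinct])
      show "(\<Sum>v\<in>T. fps_nth (u' v) 0 * functional c
          (qmono (R v) (\<lambda>p. m v (Suc p)) (\<lambda>p. - n v (Suc p) - int (m v (Suc p))))) = 0" for c
        using lead[OF u'] unfolding e_def .
    qed (fact v | assumption)+
    have "u v = fps_X ^ Suc k * fps_shift 1 (u' v)" if v: "v \<in> T" for v
    proof -
      have "u' v = fps_X * fps_shift 1 (u' v)"
        by (rule trans[OF fps_head_tail]) (simp add: u'0[OF v])
      then have "fps_X ^ k * u' v = fps_X ^ k * (fps_X * fps_shift 1 (u' v))" by (rule arg_cong)
      then show ?thesis unfolding u'[OF v] by (simp only: power_Suc2 mult.assoc)
    qed
    then show ?case by (intro exI[of _ "\<lambda>v. fps_shift 1 (u' v)"]) blast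
  qed
  note divisible = this
  have "u v = 0" if v: "v \<in> T" for v
  proof (rule fps_ext)
    fix k
    obtain u' where "u v = fps_X ^ Suc k * u' v" using divisible[of "Suc k"] v by blast
    then show "fps_nth (u v) k = fps_nth 0 k" by (simp add: fps_X_power_mult_nth del: power_Suc)
  qed
  with ne show False by blast
qed

theorem proposition4p2:
  fixes c t :: complex
  shows "is_topological_basis (principal_subspace c) (quasi_basis c t)"
  unfolding is_topological_basis_def principal_subspace_eq quasi_basis_eq
proof (intro conjI ballI allI impI)
  show "quasi_monomials t \<subseteq> x_closure" by (rule quasi_monomials_x_closure)
  show "\<not> hdependent (quasi_monomials t)" by (rule quasi_monomials_independent)
next
  fix v n assume "v \<in> x_closure"
  from x_closure_approximation[OF this, of t n]
  obtain w z where "w \<in> hspan (quasi_monomials t)" "z \<in> x_closure" "v = w + hbar ^ n * z" by blast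
  then show "\<exists>w\<in>hspan (quasi_monomials t). \<exists>z\<in>x_closure. v - w = hscale (fps_X ^ n) z"
    by (intro bexI[of _ w] bexI[of _ z]) (simp_all add: hscale_eq scalar_X_power)
qed

end
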